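(* Let $(\mathcal{X},\omega)$ be a symplectic manifold with a torsion-free symplectic connection $\Gamma$ and an Ether Hamiltonian $\mathcal{H}$ (see context). Let $H$ be a smooth function on $\mathcal{X}$, and let $X=X^t(x)$ be the solution of $$\frac{d}{dt}X=\nabla H(X)\,\Psi(X),\qquad X\big|_{t=0}=x.\qquad(1)$$ Let $y\in\mathcal{X}$ be an arbitrary point, let $[X^t(y)]:\mathcal{X}\to\mathcal{X}$ be the symplectic path corresponding to the segment of trajectory $\{X^\tau(y)\mid0\le\tau\le t\}$, define $$H^t_y=[X^t(y)]^*\Big(H-\frac12\,\dot X^t(y)\,\mathcal{H}_{X^t(y)}\Big)-H(y),$$ and let $Z=Z^t_y(x)$ be the solution of $$\frac{d}{dt}Z=\nabla H^t_y(Z)\,\Psi(Z),\qquad Z\big|_{t=0}=x.\qquad(2)$$ (i) The translations along trajectories of the systems (1) and (2) are related by $$X^t=[X^t(y)]\circ Z^t_y .$$ (ii) The point $y$ is a stationary point of the Hamiltonian $H^t_y$ of system (2), namely $H^t_y(y)=0$ and $(\nabla H^t_y)(y)=0$. The second derivative matrix at $y$ is $$\nabla^2H^t_y(z)\big|_{z=y}=V^{t*}_y\cdot\nabla^2H(X^t(y))\cdot V^t_y,$$ where $\nabla^2_{jk}H=D^2_{jk}H-D_mH\cdot\Gamma^m_{jk}$ is the tensor of second covariant derivatives and $V^t_y:T_y\mathcal{X}\to T_{X^t(y)}\mathcal{X}$ is the parallel translation along the path $\{X^\tau(y)\mid0\le\tau\le t\}$ by means of the connection $\Gamma$. (iii)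 The symplectic mapping $Z^t_y$ has the fixed point $y$. The symplectic mapping $[X^t(y)]$ transports $y$ to $X^t(y)$. The differential of the solution to system (1) at the point $y$ is given by $$dX^t(y)=V^t_y\circ W^t_y,$$ where $W=W^t_y$ is the solution of the linear system over $T_y\mathcal{X}$ $$\frac{d}{dt}W=M^t_yW,\qquad W\big|_{t=0}=I,\qquad M^t_y=-\Psi(y)\cdot V^{t*}_y\cdot\nabla^2H(X^t(y))\cdot V^t_y .$$
   Context: $\mathcal{X}$ is a smooth manifold, $\dim\mathcal{X}=2n$, with symplectic form $\omega$ and a torsion-free connection $\Gamma$ with $\nabla\omega=0$. In local coordinates $\Psi=\omega^{-1}$ is the Poisson tensor, $\omega_{kj}\Psi^{jm}=\delta^m_k$, and $\{f,g\}=\partial_jf\,\Psi^{jk}\,\partial_kg$. The Hamiltonian system $\dot z=\nabla f(z)\Psi(z)$ means $\dot z^m=\partial_jf\,\Psi^{jm}$. An Ether Hamiltonian $\mathcal{H}$ is a 1-form on $\mathcal{X}$ with values in smooth real functions on $\mathcal{X}$, $\mathcal{H}_x(z)=\sum_{j=1}^{2n}\mathcal{H}_x(z)_j\,dx^j$, such that: (a) zero curvature: $\partial\mathcal{H}+\frac12\{\mathcal{H}\wedge\mathcal{H}\}=0$, i.e. $\partial_{x^j}\mathcal{H}_k-\partial_{x^k}\mathcal{H}_j+\{\mathcal{H}_j,\mathcal{H}_k\}=0$, with $\partial=d_x$ and brackets in $z$; (b) on the diagonal $z=x$: $\mathcal{H}=0$, $\nabla\mathcal{H}=2\omega$ (i.e.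 $\nabla_j\mathcal{H}_k=2\omega_{kj}$), $\nabla\nabla\mathcal{H}=0$, where $\nabla=\nabla_z$; (c) $\mathcal{H}_x(s_x(z))=-\mathcal{H}_x(z)$, where $s=s_x(z)$ is the solution of $\partial s=\nabla\mathcal{H}(s)\Psi(s)$, $s|_{x=z}=z$ ($\partial=d_x$). For a path $\sigma=\{y(\tau)\}$ in $\mathcal{X}$, the symplectic path $[\sigma]:\mathcal{X}\to\mathcal{X}$ is the translation over the whole path along the trajectories of the system $\dot Y^m=\frac12\dot y^k(\tau)\,\partial_j\mathcal{H}_{y(\tau)}(Y)_k\,\Psi^{jm}(Y)$. Here $[\sigma]^*f=f\circ[\sigma]$, and $\dot X^t(y)\,\mathcal{H}_{X^t(y)}$ denotes the function $z\mapsto\sum_k\dot X^t(y)^k\,\mathcal{H}_{X^t(y)}(z)_k$. $D$ denotes ordinary derivatives in local coordinates, and $V^{t*}_y$ is the transpose of $V^t_y$. All the Hamiltonian systems are assumed solvable for the times considered. *)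

theory Defs
  imports "HOL-Analysis.Analysis"
begin

section \<open>Smoothness on open subsets of Euclidean spaces\<close>

text \<open>The set \<open>S\<close> is always open in the uses below.\<close>

primrec Ck_on :: "nat \<Rightarrow> 'e::euclidean_space set \<Rightarrow> ('e \<Rightarrow> 'f::real_normed_vector) \<Rightarrow> bool" where
  "Ck_on 0 S f = continuous_on S f"
| "Ck_on (Suc n) S f =
    ((\<forall>x\<in>S. f differentiable (at x)) \<and> (\<forall>v. Ck_on n S (\<lambda>x. frechet_derivative f (at x) v)))"

definition smooth_on :: "'e::euclidean_space set \<Rightarrow> ('e \<Rightarrow> 'f::real_normed_vector) \<Rightarrow> bool" where
  "smooth_on S f \<longleftrightarrow> (\<forall>n. Ck_on n S f)"


section \<open>Smooth manifolds\<close>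

text \<open>
  A manifold is a whole Hausdorff, second countable type \<open>'a\<close> with an atlas. A chart is a pair
  of an open domain and a coordinate map; values of the coordinate map off the domain are irrelevant.
  The dimension is the cardinality of the index type \<open>'d\<close>.
\<close>

type_synonym ('a, 'd) chart = "'a set \<times> ('a \<Rightarrow> (real, 'd) vec)"

abbreviation dom_of :: "('a, 'd) chart \<Rightarrow> 'a set" where "dom_of c \<equiv> fst c"
abbreviation crd :: "('a, 'd) chart \<Rightarrow> 'a \<Rightarrow> (real, 'd) vec" where "crd c \<equiv> snd c"

definition crd_inv :: "('a, 'd) chart \<Rightarrow> (real, 'd) vec \<Rightarrow> 'a" where
  "crd_inv c = inv_into (dom_of c) (crd c)"

definition is_chart :: "('a::topological_space, 'd::finite) chart \<Rightarrow> bool" where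
  "is_chart c \<longleftrightarrow> open (dom_of c) \<and> open (crd c ` dom_of c) \<and>
     homeomorphism (dom_of c) (crd c ` dom_of c) (crd c) (crd_inv c)"

definition smooth_manifold ::
    "('a::{t2_space, second_countable_topology}, 'd::finite) chart set \<Rightarrow> bool" where
  "smooth_manifold A \<longleftrightarrow>
     (\<forall>c\<in>A. is_chart c) \<and> (\<Union>c\<in>A. dom_of c) = UNIV \<and>
     (\<forall>c\<in>A. \<forall>d\<in>A. smooth_on (crd c ` (dom_of c \<inter> dom_of d)) (crd d \<circ> crd_inv c))"

definition charts_at :: "('a, 'd) chart set \<Rightarrow> 'a \<Rightarrow> ('a, 'd) chart set" where
  "charts_at A p = {c \<in> A. p \<in> dom_of c}"

text \<open>An arbitrary chart, used only in expressions whose value does not depend on the choice.\<close>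

definition chart_at :: "('a, 'd) chart set \<Rightarrow> 'a \<Rightarrow> ('a, 'd) chart" where
  "chart_at A p = (SOME c. c \<in> charts_at A p)"

text \<open>The Jacobian has entries \<open>jac c d p $ m $ k = \<partial>d\<^sup>m/\<partial>c\<^sup>k\<close>.\<close>

definition jac :: "('a, 'd::finite) chart \<Rightarrow> ('a, 'd) chart \<Rightarrow> 'a \<Rightarrow> real^'d^'d" where
  "jac c d p = matrix (frechet_derivative (crd d \<circ> crd_inv c) (at (crd c p)))"

definition pd :: "('a, 'd::finite) chart \<Rightarrow> 'd \<Rightarrow> ('a \<Rightarrow> real) \<Rightarrow> 'a \<Rightarrow> real" where
  "pd c j f p = frechet_derivative (f \<circ> crd_inv c) (at (crd c p)) (axis j 1)"

definition smooth_function :: "('a, 'd::finite) chart set \<Rightarrow> ('a \<Rightarrow> real) \<Rightarrow> bool" where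
  "smooth_function A f \<longleftrightarrow> (\<forall>c\<in>A. smooth_on (crd c ` dom_of c) (f \<circ> crd_inv c))"

definition smooth_map ::
    "('a::topological_space, 'd::finite) chart set \<Rightarrow> ('a \<Rightarrow> 'a) \<Rightarrow> bool" where
  "smooth_map A F \<longleftrightarrow> continuous_on UNIV F \<and>
     (\<forall>c\<in>A. \<forall>d\<in>A. smooth_on (crd c ` (dom_of c \<inter> F -` dom_of d)) (crd d \<circ> F \<circ> crd_inv c))"


section \<open>Tangent vectors\<close>

text \<open>
  A tangent vector at \<open>p\<close> is the family of its components in all charts around \<open>p\<close>, related by
  the contravariant transformation law (and set to zero in the other charts, so that it is
  determined by its components in any one chart around \<open>p\<close>).
\<close>

type_synonym ('a, 'd) tangent = "('a, 'd) chart \<Rightarrow> (real, 'd) vec"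

definition tangent_space :: "('a, 'd::finite) chart set \<Rightarrow> 'a \<Rightarrow> ('a, 'd) tangent set" where
  "tangent_space A p =
     {v. (\<forall>c\<in>charts_at A p. \<forall>d\<in>charts_at A p. v d = jac c d p *v v c) \<and>
         (\<forall>c. c \<notin> charts_at A p \<longrightarrow> v c = 0)}"

definition tangent_of ::
    "('a, 'd::finite) chart set \<Rightarrow> 'a \<Rightarrow> ('a, 'd) chart \<Rightarrow> real^'d \<Rightarrow> ('a, 'd) tangent" where
  "tangent_of A p c \<xi> = (\<lambda>d. if d \<in> charts_at A p then jac c d p *v \<xi> else 0)"

text \<open>
  The matrix of a linear map from the tangent space at \<open>p\<close> to another tangent space, with respect
  to the coordinates \<open>c\<close> in the source and \<open>d\<close> in the target.
\<close>

definition matrix_in ::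
    "('a, 'd::finite) chart set \<Rightarrow> 'a \<Rightarrow> ('a, 'd) chart \<Rightarrow> ('a, 'd) chart \<Rightarrow>
     (('a, 'd) tangent \<Rightarrow> ('a, 'd) tangent) \<Rightarrow> real^'d^'d" where
  "matrix_in A p c d L = matrix (\<lambda>\<xi>. L (tangent_of A p c \<xi>) d)"

definition has_differential ::
    "('a::t2_space, 'd::finite) chart set \<Rightarrow> ('a \<Rightarrow> 'a) \<Rightarrow>
     (('a, 'd) tangent \<Rightarrow> ('a, 'd) tangent) \<Rightarrow> 'a \<Rightarrow> bool" where
  "has_differential A F L p \<longleftrightarrow>
     isCont F p \<and> L ` tangent_space A p \<subseteq> tangent_space A (F p) \<and>
     (\<forall>c\<in>charts_at A p. \<forall>d\<in>charts_at A (F p).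
        ((crd d \<circ> F \<circ> crd_inv c) has_derivative (\<lambda>\<xi>. L (tangent_of A p c \<xi>) d)) (at (crd c p)))"


section \<open>Differential equations on a manifold\<close>

text \<open>
  Derivatives in time are taken within the time interval \<open>T\<close>, hence one-sided at its end points.
  \<open>v t p c\<close> are the components in the chart \<open>c\<close> of a time-dependent vector field.
\<close>

definition solves ::
    "('a::topological_space, 'd::finite) chart set \<Rightarrow> real set \<Rightarrow>
     (real \<Rightarrow> 'a \<Rightarrow> ('a, 'd) tangent) \<Rightarrow> (real \<Rightarrow> 'a) \<Rightarrow> bool" where
  "solves A T v \<gamma> \<longleftrightarrow> continuous_on T \<gamma> \<and>
     (\<forall>t\<in>T. \<forall>c\<in>charts_at A (\<gamma> t).
        ((\<lambda>s. crd c (\<gamma> s)) has_vector_derivative v t (\<gamma> t) c) (at t within T))"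

text \<open>\<open>F t\<close> is the translation along the trajectories from time \<open>0\<close> to time \<open>t\<close>.\<close>

definition is_flow ::
    "('a::topological_space, 'd::finite) chart set \<Rightarrow> real set \<Rightarrow>
     (real \<Rightarrow> 'a \<Rightarrow> ('a, 'd) tangent) \<Rightarrow> (real \<Rightarrow> 'a \<Rightarrow> 'a) \<Rightarrow> bool" where
  "is_flow A T v F \<longleftrightarrow> (\<forall>x. F 0 x = x \<and> solves A T v (\<lambda>t. F t x))"

definition velocity ::
    "real set \<Rightarrow> (real \<Rightarrow> 'a) \<Rightarrow> real \<Rightarrow> ('a, 'd::finite) tangent" where
  "velocity T \<sigma> t c = vector_derivative (\<lambda>s. crd c (\<sigma> s)) (at t within T)"


section \<open>Symplectic structure and connection\<close>

text \<open>
  Tensor fields and connections are given by their components in all charts. Here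
  \<open>\<omega> c p $ j $ k = \<omega>\<^sub>j\<^sub>k\<close> and \<open>\<Gamma> c p m j k = \<Gamma>\<^sup>m\<^sub>j\<^sub>k\<close> in the chart \<open>c\<close>.
\<close>

type_synonym ('a, 'd) two_form = "('a, 'd) chart \<Rightarrow> 'a \<Rightarrow> ((real, 'd) vec, 'd) vec"
type_synonym ('a, 'd) christoffel = "('a, 'd) chart \<Rightarrow> 'a \<Rightarrow> 'd \<Rightarrow> 'd \<Rightarrow> 'd \<Rightarrow> real"

definition symplectic_form ::
    "('a::topological_space, 'd::finite) chart set \<Rightarrow> ('a, 'd) two_form \<Rightarrow> bool" where
  "symplectic_form A \<omega> \<longleftrightarrow>
     (\<forall>c\<in>A. smooth_on (crd c ` dom_of c) (\<omega> c \<circ> crd_inv c)) \<and>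
     (\<forall>p. \<forall>c\<in>charts_at A p. \<forall>d\<in>charts_at A p.
        \<omega> c p = transpose (jac c d p) ** \<omega> d p ** jac c d p) \<and>
     (\<forall>p. \<forall>c\<in>charts_at A p. transpose (\<omega> c p) = - \<omega> c p \<and> invertible (\<omega> c p) \<and>
        (\<forall>i j k. pd c i (\<lambda>q. \<omega> c q $ j $ k) p + pd c j (\<lambda>q. \<omega> c q $ k $ i) p
                 + pd c k (\<lambda>q. \<omega> c q $ i $ j) p = 0))"

text \<open>The Poisson tensor, \<open>\<omega>\<^sub>k\<^sub>j \<Psi>\<^sup>j\<^sup>m = \<delta>\<^sup>m\<^sub>k\<close>.\<close>

definition poisson :: "('a, 'd::finite) two_form \<Rightarrow> ('a, 'd) two_form" where
  "poisson \<omega> c p = matrix_inv (\<omega> c p)"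

definition bracket ::
    "('a, 'd::finite) two_form \<Rightarrow> ('a, 'd) chart \<Rightarrow> ('a \<Rightarrow> real) \<Rightarrow> ('a \<Rightarrow> real) \<Rightarrow> 'a \<Rightarrow> real" where
  "bracket \<omega> c f g p = (\<Sum>j\<in>UNIV. \<Sum>k\<in>UNIV. pd c j f p * poisson \<omega> c p $ j $ k * pd c k g p)"

definition ham_field ::
    "('a, 'd::finite) two_form \<Rightarrow> ('a \<Rightarrow> real) \<Rightarrow> 'a \<Rightarrow> ('a, 'd) tangent" where
  "ham_field \<omega> f p c = (\<chi> m. \<Sum>j\<in>UNIV. pd c j f p * poisson \<omega> c p $ j $ m)"

definition symplectic_map ::
    "('a::topological_space, 'd::finite) chart set \<Rightarrow> ('a, 'd) two_form \<Rightarrow> ('a \<Rightarrow> 'a) \<Rightarrow> bool" where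
  "symplectic_map A \<omega> F \<longleftrightarrow> smooth_map A F \<and>
     (\<forall>p. \<forall>c\<in>charts_at A p. \<forall>d\<in>charts_at A (F p).
        let J = matrix (frechet_derivative (crd d \<circ> F \<circ> crd_inv c) (at (crd c p)))
        in transpose J ** \<omega> d (F p) ** J = \<omega> c p)"

text \<open>
  The transformation law of the Christoffel symbols is written with the second derivatives of the
  coordinates \<open>d\<close> with respect to the coordinates \<open>c\<close>.
\<close>

definition connection ::
    "('a::topological_space, 'd::finite) chart set \<Rightarrow> ('a, 'd) christoffel \<Rightarrow> bool" where
  "connection A \<Gamma> \<longleftrightarrow>
     (\<forall>c\<in>A. \<forall>m j k. smooth_on (crd c ` dom_of c) ((\<lambda>p. \<Gamma> c p m j k) \<circ> crd_inv c)) \<and>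
     (\<forall>p. \<forall>c\<in>charts_at A p. \<forall>d\<in>charts_at A p. \<forall>m j k.
        pd c j (\<lambda>q. jac c d q $ m $ k) p =
          (\<Sum>l\<in>UNIV. jac c d p $ m $ l * \<Gamma> c p l j k)
          - (\<Sum>a\<in>UNIV. \<Sum>b\<in>UNIV. \<Gamma> d p m a b * jac c d p $ a $ j * jac c d p $ b $ k))"

definition torsion_free ::
    "('a, 'd::finite) chart set \<Rightarrow> ('a, 'd) christoffel \<Rightarrow> bool" where
  "torsion_free A \<Gamma> \<longleftrightarrow> (\<forall>p. \<forall>c\<in>charts_at A p. \<forall>m j k. \<Gamma> c p m j k = \<Gamma> c p m k j)"

text \<open>This is \<open>\<nabla>\<omega> = 0\<close>.\<close>

definition preserves_form ::
    "('a, 'd::finite) chart set \<Rightarrow> ('a, 'd) two_form \<Rightarrow> ('a, 'd) christoffel \<Rightarrow> bool" where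
  "preserves_form A \<omega> \<Gamma> \<longleftrightarrow>
     (\<forall>p. \<forall>c\<in>charts_at A p. \<forall>i j k.
        pd c i (\<lambda>q. \<omega> c q $ j $ k) p
        - (\<Sum>m\<in>UNIV. \<Gamma> c p m i j * \<omega> c p $ m $ k)
        - (\<Sum>m\<in>UNIV. \<Gamma> c p m i k * \<omega> c p $ j $ m) = 0)"

text \<open>The matrix of second covariant derivatives of a function.\<close>

definition cov_hess ::
    "('a, 'd::finite) christoffel \<Rightarrow> ('a, 'd) chart \<Rightarrow> ('a \<Rightarrow> real) \<Rightarrow> 'a \<Rightarrow> real^'d^'d" where
  "cov_hess \<Gamma> c f p =
     (\<chi> j k. pd c j (pd c k f) p - (\<Sum>m\<in>UNIV. pd c m f p * \<Gamma> c p m j k))"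

definition parallel_along ::
    "('a::topological_space, 'd::finite) chart set \<Rightarrow> ('a, 'd) christoffel \<Rightarrow> real set \<Rightarrow>
     (real \<Rightarrow> 'a) \<Rightarrow> (real \<Rightarrow> ('a, 'd) tangent) \<Rightarrow> bool" where
  "parallel_along A \<Gamma> T \<sigma> u \<longleftrightarrow>
     (\<forall>t\<in>T. u t \<in> tangent_space A (\<sigma> t) \<and>
       (\<forall>c\<in>charts_at A (\<sigma> t).
         ((\<lambda>s. u s c) has_vector_derivative
            (\<chi> m. - (\<Sum>j\<in>UNIV. \<Sum>k\<in>UNIV. \<Gamma> c (\<sigma> t) m j k * velocity T \<sigma> t c $ j * u t c $ k)))
         (at t within T)))"

text \<open>
  \<open>V t\<close> is the parallel translation from the tangent space at \<open>\<sigma> 0\<close> to the one at \<open>\<sigma> t\<close>.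
\<close>

definition parallel_translation ::
    "('a::topological_space, 'd::finite) chart set \<Rightarrow> ('a, 'd) christoffel \<Rightarrow> real set \<Rightarrow>
     (real \<Rightarrow> 'a) \<Rightarrow> (real \<Rightarrow> ('a, 'd) tangent \<Rightarrow> ('a, 'd) tangent) \<Rightarrow> bool" where
  "parallel_translation A \<Gamma> T \<sigma> V \<longleftrightarrow>
     (\<forall>v\<in>tangent_space A (\<sigma> 0). V 0 v = v \<and> parallel_along A \<Gamma> T \<sigma> (\<lambda>t. V t v))"


section \<open>Ether Hamiltonians and symplectic paths\<close>

text \<open>\<open>\<H> c x z $ k\<close> is the component \<open>\<H>\<^sub>x(z)\<^sub>k\<close> with respect to the chart \<open>c\<close> around \<open>x\<close>.\<close>

type_synonym ('a, 'd) fun_one_form = "('a, 'd) chart \<Rightarrow> 'a \<Rightarrow> 'a \<Rightarrow> (real, 'd) vec"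

definition fun_one_form ::
    "('a::topological_space, 'd::finite) chart set \<Rightarrow> ('a, 'd) fun_one_form \<Rightarrow> bool" where
  "fun_one_form A \<H> \<longleftrightarrow>
     (\<forall>c\<in>A. \<forall>e\<in>A. smooth_on ((crd c ` dom_of c) \<times> (crd e ` dom_of e))
        (\<lambda>(\<xi>, \<zeta>). \<H> c (crd_inv c \<xi>) (crd_inv e \<zeta>))) \<and>
     (\<forall>x z. \<forall>c\<in>charts_at A x. \<forall>d\<in>charts_at A x. \<H> c x z = transpose (jac c d x) *v \<H> d x z)"

definition zero_curvature ::
    "('a, 'd::finite) chart set \<Rightarrow> ('a, 'd) two_form \<Rightarrow> ('a, 'd) fun_one_form \<Rightarrow> bool" where
  "zero_curvature A \<omega> \<H> \<longleftrightarrow>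
     (\<forall>x z. \<forall>c\<in>charts_at A x. \<forall>e\<in>charts_at A z. \<forall>j k.
        pd c j (\<lambda>x'. \<H> c x' z $ k) x - pd c k (\<lambda>x'. \<H> c x' z $ j) x
        + bracket \<omega> e (\<lambda>z'. \<H> c x z' $ j) (\<lambda>z'. \<H> c x z' $ k) z = 0)"

definition diagonal_conditions ::
    "('a, 'd::finite) chart set \<Rightarrow> ('a, 'd) two_form \<Rightarrow> ('a, 'd) christoffel \<Rightarrow>
     ('a, 'd) fun_one_form \<Rightarrow> bool" where
  "diagonal_conditions A \<omega> \<Gamma> \<H> \<longleftrightarrow>
     (\<forall>x. \<forall>c\<in>charts_at A x. \<H> c x x = 0 \<and>
        (\<forall>j k. pd c j (\<lambda>z. \<H> c x z $ k) x = 2 * \<omega> c x $ k $ j) \<and>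
        (\<forall>k. cov_hess \<Gamma> c (\<lambda>z. \<H> c x z $ k) x = 0))"

text \<open>
  \<open>s x z\<close> is \<open>s\<^sub>x(z)\<close>; the equation is \<open>\<partial>s\<^sup>m/\<partial>x\<^sup>k = \<partial>\<^sub>j\<H>\<^sub>x(s)\<^sub>k \<Psi>\<^sup>j\<^sup>m(s)\<close> with \<open>s = z\<close> at \<open>x = z\<close>.
\<close>

definition ether_reflection ::
    "('a::topological_space, 'd::finite) chart set \<Rightarrow> ('a, 'd) two_form \<Rightarrow> ('a, 'd) fun_one_form \<Rightarrow>
     ('a \<Rightarrow> 'a \<Rightarrow> 'a) \<Rightarrow> bool" where
  "ether_reflection A \<omega> \<H> s \<longleftrightarrow>
     (\<forall>z. s z z = z \<and> continuous_on UNIV (\<lambda>x. s x z)) \<and>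
     (\<forall>x z. \<forall>c\<in>charts_at A x. \<forall>e\<in>charts_at A (s x z).
        ((\<lambda>\<xi>. crd e (s (crd_inv c \<xi>) z)) has_derivative
           (\<lambda>\<eta>. \<Sum>k\<in>UNIV. \<eta> $ k *\<^sub>R ham_field \<omega> (\<lambda>w. \<H> c x w $ k) (s x z) e)) (at (crd c x)))"

definition ether_hamiltonian ::
    "('a::topological_space, 'd::finite) chart set \<Rightarrow> ('a, 'd) two_form \<Rightarrow> ('a, 'd) christoffel \<Rightarrow>
     ('a, 'd) fun_one_form \<Rightarrow> bool" where
  "ether_hamiltonian A \<omega> \<Gamma> \<H> \<longleftrightarrow>
     fun_one_form A \<H> \<and> zero_curvature A \<omega> \<H> \<and> diagonal_conditions A \<omega> \<Gamma> \<H> \<and>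
     (\<exists>s. ether_reflection A \<omega> \<H> s \<and>
          (\<forall>x z. \<forall>c\<in>charts_at A x. \<H> c x (s x z) = - \<H> c x z))"

text \<open>The function \<open>z \<mapsto> v\<^sup>k \<H>\<^sub>x(z)\<^sub>k\<close> for a tangent vector \<open>v\<close> at \<open>x\<close>.\<close>

definition contract ::
    "('a, 'd::finite) chart set \<Rightarrow> ('a, 'd) fun_one_form \<Rightarrow> 'a \<Rightarrow> ('a, 'd) tangent \<Rightarrow> 'a \<Rightarrow> real" where
  "contract A \<H> x v z = (let c = chart_at A x in \<Sum>k\<in>UNIV. v c $ k * \<H> c x z $ k)"

definition path_field ::
    "('a, 'd::finite) chart set \<Rightarrow> ('a, 'd) two_form \<Rightarrow> ('a, 'd) fun_one_form \<Rightarrow> real set \<Rightarrow>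
     (real \<Rightarrow> 'a) \<Rightarrow> real \<Rightarrow> 'a \<Rightarrow> ('a, 'd) tangent" where
  "path_field A \<omega> \<H> T \<sigma> \<tau> p e = (let c = chart_at A (\<sigma> \<tau>) in
     \<chi> m. 1/2 * (\<Sum>k\<in>UNIV. \<Sum>j\<in>UNIV.
       velocity T \<sigma> \<tau> c $ k * pd e j (\<lambda>z. \<H> c (\<sigma> \<tau>) z $ k) p * poisson \<omega> e p $ j $ m))"

text \<open>\<open>F t\<close> is the symplectic path of the segment of \<open>\<sigma>\<close> between the times \<open>0\<close> and \<open>t\<close>.\<close>

definition symplectic_path ::
    "('a::topological_space, 'd::finite) chart set \<Rightarrow> ('a, 'd) two_form \<Rightarrow> ('a, 'd) fun_one_form \<Rightarrow>
     real set \<Rightarrow> (real \<Rightarrow> 'a) \<Rightarrow> (real \<Rightarrow> 'a \<Rightarrow> 'a) \<Rightarrow> bool" where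
  "symplectic_path A \<omega> \<H> T \<sigma> F \<longleftrightarrow> is_flow A T (path_field A \<omega> \<H> T \<sigma>) F"


section \<open>The Hamiltonian near a trajectory\<close>

text \<open>
  The function \<open>H\<^sup>t\<^sub>y\<close>, for the trajectory \<open>\<sigma>\<close> starting at \<open>\<sigma> 0 = y\<close> and its symplectic path \<open>F\<close>.
\<close>

definition moving_hamiltonian ::
    "('a, 'd::finite) chart set \<Rightarrow> ('a, 'd) fun_one_form \<Rightarrow> real set \<Rightarrow> ('a \<Rightarrow> real) \<Rightarrow>
     (real \<Rightarrow> 'a) \<Rightarrow> (real \<Rightarrow> 'a \<Rightarrow> 'a) \<Rightarrow> real \<Rightarrow> 'a \<Rightarrow> real" where
  "moving_hamiltonian A \<H> T H \<sigma> F t z =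
     ((\<lambda>w. H w - 1/2 * contract A \<H> (\<sigma> t) (velocity T \<sigma> t) w) \<circ> F t) z - H (\<sigma> 0)"

text \<open>
  The matrix \<open>V\<^sup>* \<nabla>\<^sup>2H(q) V\<close> of a bilinear form on the tangent space at \<open>p\<close>, in the coordinates \<open>c\<close>;
  the coordinates \<open>d\<close> around \<open>q\<close> are auxiliary.
\<close>

definition hess_pullback ::
    "('a, 'd::finite) chart set \<Rightarrow> ('a, 'd) christoffel \<Rightarrow> ('a \<Rightarrow> real) \<Rightarrow>
     (('a, 'd) tangent \<Rightarrow> ('a, 'd) tangent) \<Rightarrow> 'a \<Rightarrow> 'a \<Rightarrow> ('a, 'd) chart \<Rightarrow> ('a, 'd) chart \<Rightarrow>
     real^'d^'d" where
  "hess_pullback A \<Gamma> H V p q c d =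
     transpose (matrix_in A p c d V) ** cov_hess \<Gamma> d H q ** matrix_in A p c d V"

text \<open>The linear system for \<open>W\<close> over the tangent space at \<open>\<sigma> 0\<close>.\<close>

definition linear_system_solution ::
    "('a, 'd::finite) chart set \<Rightarrow> ('a, 'd) two_form \<Rightarrow> ('a, 'd) christoffel \<Rightarrow> real set \<Rightarrow>
     ('a \<Rightarrow> real) \<Rightarrow> (real \<Rightarrow> 'a) \<Rightarrow> (real \<Rightarrow> ('a, 'd) tangent \<Rightarrow> ('a, 'd) tangent) \<Rightarrow>
     (real \<Rightarrow> ('a, 'd) tangent \<Rightarrow> ('a, 'd) tangent) \<Rightarrow> bool" where
  "linear_system_solution A \<omega> \<Gamma> T H \<sigma> V W \<longleftrightarrow>
     (\<forall>v\<in>tangent_space A (\<sigma> 0). W 0 v = v \<and>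
       (\<forall>t\<in>T. W t v \<in> tangent_space A (\<sigma> 0) \<and>
         (\<forall>c\<in>charts_at A (\<sigma> 0). \<forall>d\<in>charts_at A (\<sigma> t).
           let M = - (poisson \<omega> c (\<sigma> 0) ** hess_pullback A \<Gamma> H (V t) (\<sigma> 0) (\<sigma> t) c d)
           in ((\<lambda>s. W s v c) has_vector_derivative (M *v W t v c)) (at t within T))))"

end

theory Submission
  imports Defs
begin

text \<open>
  Write \<open>F\<^sup>t\<close> for the symplectic path \<open>[X\<^sup>t(y)]\<close> and \<open>\<sigma>(t) = X\<^sup>t(y)\<close>. The system that defines \<open>F\<close>
  is the Hamiltonian system of the time-dependent function \<open>g\<^sub>t = 1/2 \<sigma>'(t)\<^sup>k \<H>\<^bsub>\<sigma>(t)\<^esub>(\<cdot>)\<^sub>k\<close>, and everything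
  follows from the values of \<open>g\<^sub>t\<close> to second order at the point \<open>\<sigma>(t)\<close>
  (\<open>path_ham_on_trajectory\<close>). The conditions on the diagonal say that \<open>g\<^sub>t\<close> vanishes there, that its
  differential is \<open>\<sigma>'\<^sup>k \<omega>\<^sub>k\<^sub>j\<close>, which is the differential of \<open>H\<close> because \<open>\<sigma>\<close> is a trajectory of \<open>H\<close>,
  and that its second covariant derivatives vanish.

  \<^item> Since the differentials agree, \<open>\<sigma>\<close> solves the system of \<open>g\<close>, and uniqueness gives
    \<open>F\<^sup>t(y) = \<sigma>(t)\<close> (\<open>path_transports\<close>). With \<open>K\<^sub>t = H - g\<^sub>t\<close> one has \<open>H\<^sup>t\<^sub>y = K\<^sub>t \<circ> F\<^sup>t - H(y)\<close>, which is
    therefore stationary at \<open>y\<close>; its value there is \<open>0\<close> by conservation of energy.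
  \<^item> A Hamiltonian flow preserves \<open>\<omega>\<close>, so \<open>dF\<^sup>t\<close> maps the Hamiltonian field of \<open>K\<^sub>t \<circ> F\<^sup>t\<close> to that
    of \<open>K\<^sub>t\<close>. The curve \<open>F\<^sup>t(Z\<^sup>t(x))\<close> hence has the velocity of \<open>g\<^sub>t\<close> plus that of \<open>K\<^sub>t\<close>, which is the
    velocity of \<open>H\<close>, and \<open>X\<^sup>t = F\<^sup>t \<circ> Z\<^sup>t\<close> by uniqueness (\<open>flow_factorization\<close>). As \<open>F\<^sup>t\<close> is
    injective with an invertible differential, \<open>Z\<^sup>t\<close> inherits smoothness and symplecticity from
    \<open>X\<^sup>t\<close>, and it fixes \<open>y\<close>.
  \<^item> Because \<open>\<omega>\<close> is parallel, the linearization of the Hamiltonian system of a function \<open>f\<close> at a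
    point is \<open>- \<Psi> \<nabla>\<^sup>2f\<close> minus the Christoffel term of the field (\<open>ham_field_derivative\<close>). For \<open>g\<^sub>t\<close>
    along \<open>\<sigma>\<close> only the Christoffel term is left: the linearized equation is that of parallel
    translation, and \<open>dF\<^sup>t(y) = V\<^sup>t\<^sub>y\<close> (\<open>parallel_translation_eq_dmap\<close>). The Hessian of
    \<open>H\<^sup>t\<^sub>y\<close> at its stationary point is then the pullback by \<open>V\<^sup>t\<^sub>y\<close> of the Hessian of \<open>K\<^sub>t\<close>, that is, of \<open>\<nabla>\<^sup>2H\<close>.
    For \<open>H\<close> along \<open>\<sigma>\<close> both terms are present, and \<open>V W\<close> solves the linearized equation: the
    derivative of \<open>V\<close> accounts for the Christoffel term, and that of \<open>W\<close> for the Hessian, as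
    \<open>V \<Psi>(y) V\<^sup>* = \<Psi>(\<sigma>(t))\<close>. So \<open>V W = dX\<^sup>t(y)\<close>.

  The analytic input is the smooth dependence of solutions on their initial values. The flows are
  given, so no solution of a nonlinear equation has to be constructed: a family of solutions with
  smooth initial values is differentiable in the parameter by an a priori estimate against the solution of the
  linearized equation (\<open>differentiable_in_parameter\<close>), and its derivatives solve linear equations
  of the same kind, so all higher derivatives exist as well (\<open>smooth_dependence\<close>). These statements are local in time
  and live in one chart; they spread along a trajectory by connectedness of the time interval.
\<close>

section \<open>Families of functions that are smooth in space and continuous in time\<close>

text \<open>Differentiability is only asked for in space, and all derivatives are jointly continuous in time and
  space. So a time interval may contain its end points, and \<open>Ck_on\<close> is the case of a single time.\<close>

primrec Ck_family ::
    "nat \<Rightarrow> real set \<Rightarrow> 'e::euclidean_space set \<Rightarrow> (real \<Rightarrow> 'e \<Rightarrow> 'f::real_normed_vector) \<Rightarrow> bool" where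
  "Ck_family 0 J S f = continuous_on (J \<times> S) (\<lambda>(t, x). f t x)"
| "Ck_family (Suc n) J S f =
    (continuous_on (J \<times> S) (\<lambda>(t, x). f t x) \<and>
     (\<forall>t\<in>J. \<forall>x\<in>S. f t differentiable (at x)) \<and>
     (\<forall>v. Ck_family n J S (\<lambda>t x. frechet_derivative (f t) (at x) v)))"

lemma Ck_family_continuous: "Ck_family n J S f \<Longrightarrow> continuous_on (J \<times> S) (\<lambda>(t, x). f t x)"
  by (cases n) auto

lemma Ck_family_SucD:
  assumes "Ck_family (Suc n) J S f" "t \<in> J" "x \<in> S"
  shows "(f t has_derivative frechet_derivative (f t) (at x)) (at x)"
  using assms by (simp add: frechet_derivative_works)

lemma frechet_derivative_cong_open:
  assumes "open S" "x \<in> S" "\<And>y. y \<in> S \<Longrightarrow> f y = g y"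
  shows "frechet_derivative f (at x) = frechet_derivative g (at x)"
proof -
  have "(f has_derivative D) (at x) \<longleftrightarrow> (g has_derivative D) (at x)" for D
    using has_derivative_transform_within_open[of f D x UNIV S g]
          has_derivative_transform_within_open[of g D x UNIV S f] assms by auto
  then show ?thesis by (simp add: frechet_derivative_def)
qed

lemma differentiable_cong_open:
  assumes "open S" "x \<in> S" "\<And>y. y \<in> S \<Longrightarrow> f y = g y"
  shows "f differentiable (at x) \<longleftrightarrow> g differentiable (at x)"
proof -
  have "(f has_derivative D) (at x) \<longleftrightarrow> (g has_derivative D) (at x)" for D
    using has_derivative_transform_within_open[of f D x UNIV S g]
          has_derivative_transform_within_open[of g D x UNIV S f] assms by auto
  then show ?thesis by (simp add: differentiable_def)
qed

lemma Ck_family_cong: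
  assumes "open S" "\<And>t x. t \<in> J \<Longrightarrow> x \<in> S \<Longrightarrow> f t x = g t x"
  shows "Ck_family n J S f \<longleftrightarrow> Ck_family n J S g"
  using assms(2)
proof (induction n arbitrary: f g)
  case 0
  then show ?case by (auto intro!: continuous_on_cong)
next
  case (Suc n)
  have 1: "continuous_on (J \<times> S) (\<lambda>(t, x). f t x) \<longleftrightarrow> continuous_on (J \<times> S) (\<lambda>(t, x). g t x)"
    using Suc.prems by (auto intro!: continuous_on_cong)
  have 2: "f t differentiable (at x) \<longleftrightarrow> g t differentiable (at x)" if "t \<in> J" "x \<in> S" for t x
    using differentiable_cong_open[OF assms(1) that(2)] Suc.prems[OF that(1)] by blast
  have 3: "Ck_family n J S (\<lambda>t x. frechet_derivative (f t) (at x) v) \<longleftrightarrow>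
    Ck_family n J S (\<lambda>t x. frechet_derivative (g t) (at x) v)" for v
    by (rule Suc.IH)
      (metis frechet_derivative_cong_open[OF assms(1)] Suc.prems)
  show ?case using 1 2 3 by auto
qed

lemma Ck_family_SucI:
  assumes "open S" "continuous_on (J \<times> S) (\<lambda>(t, x). f t x)"
    and D: "\<And>t x. t \<in> J \<Longrightarrow> x \<in> S \<Longrightarrow> (f t has_derivative D t x) (at x)"
    and "\<And>v. Ck_family n J S (\<lambda>t x. D t x v)"
  shows "Ck_family (Suc n) J S f"
proof -
  have "Ck_family n J S (\<lambda>t x. frechet_derivative (f t) (at x) v)" for v
    using assms(4)[of v] D
    by (subst Ck_family_cong[OF assms(1), where g = "\<lambda>t x. D t x v"])
      (metis frechet_derivative_at)+
  then show ?thesis using assms by (auto simp: differentiable_def)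
qed

lemma Ck_family_Suc_imp: "Ck_family (Suc n) J S f \<Longrightarrow> Ck_family n J S f"
proof (induction n arbitrary: f)
  case (Suc n)
  show ?case unfolding Ck_family.simps(2)[of n]
    using Suc.prems Suc.IH unfolding Ck_family.simps(2)[of "Suc n"] by blast
qed auto

lemma Ck_family_subset:
  assumes "Ck_family n J S f" "J' \<subseteq> J" "S' \<subseteq> S"
  shows "Ck_family n J' S' f"
  using assms(1)
proof (induction n arbitrary: f)
  case 0
  then show ?case using assms(2,3) by (auto intro: continuous_on_subset)
next
  case (Suc n)
  have "continuous_on (J' \<times> S') (\<lambda>(t, x). f t x)"
    using Suc.prems assms(2,3) by (auto intro: continuous_on_subset)
  then show ?case using Suc assms(2,3) unfolding Ck_family.simps by blast
qed

lemma Ck_family_time_only: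
  assumes "open S" "continuous_on J h"
  shows "Ck_family n J S (\<lambda>t x. h t)"
  using assms(2)
proof (induction n arbitrary: h)
  case 0
  have "continuous_on (J \<times> S) (\<lambda>p. h (fst p))"
    by (rule continuous_on_compose2[OF 0]) (auto intro!: continuous_intros)
  then show ?case by (simp add: case_prod_unfold)
next
  case (Suc n)
  have "continuous_on (J \<times> S) (\<lambda>p. h (fst p))"
    by (rule continuous_on_compose2[OF Suc.prems]) (auto intro!: continuous_intros)
  then show ?case
    by (intro Ck_family_SucI[where D = "\<lambda>t x v. 0"] assms(1))
      (auto simp: case_prod_unfold intro!: Suc.IH)
qed

lemma Ck_family_bounded_linear:
  assumes "open S" "bounded_linear L" "Ck_family n J S f"
  shows "Ck_family n J S (\<lambda>t x. L (f t x))"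
proof -
  interpret bounded_linear L by fact
  have c: "continuous_on (J \<times> S) (\<lambda>(t, x). L (f t x))"
    if "continuous_on (J \<times> S) (\<lambda>(t, x). f t x)" for f
    using continuous_on[OF that] by (simp add: case_prod_unfold)
  show ?thesis using assms(3)
  proof (induction n arbitrary: f)
    case 0
    then show ?case using c by simp
  next
    case (Suc n)
    show ?case
      by (rule Ck_family_SucI[where D = "\<lambda>t x v. L (frechet_derivative (f t) (at x) v)"])
        (use Suc c assms(1) in \<open>auto intro!: has_derivative Ck_family_SucD[OF Suc.prems]\<close>)
  qed
qed

lemma Ck_family_linear_space:
  assumes "open S" "bounded_linear L"
  shows "Ck_family n J S (\<lambda>t x. L x)"
proof (cases n)
  case 0
  have "continuous_on (J \<times> S) (\<lambda>p. L (snd p))"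
    by (intro bounded_linear.continuous_on[OF assms(2)] continuous_intros)
  then show ?thesis using 0 by (simp add: case_prod_unfold)
next
  case (Suc m)
  have "continuous_on (J \<times> S) (\<lambda>p. L (snd p))"
    by (intro bounded_linear.continuous_on[OF assms(2)] continuous_intros)
  then have "Ck_family (Suc m) J S (\<lambda>t x. L x)"
    by (intro Ck_family_SucI[where D = "\<lambda>t x. L"] Ck_family_time_only assms)
      (auto simp: case_prod_unfold intro: bounded_linear_imp_has_derivative assms)
  then show ?thesis using Suc by simp
qed

lemma Ck_family_add:
  assumes "open S" "Ck_family n J S f" "Ck_family n J S g"
  shows "Ck_family n J S (\<lambda>t x. f t x + g t x)"
  using assms(2,3)
proof (induction n arbitrary: f g)
  case 0
  then show ?case by (auto simp: case_prod_unfold intro!: continuous_intros)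
next
  case (Suc n)
  have "continuous_on (J \<times> S) (\<lambda>(t, x). f t x + g t x)"
    using Suc.prems by (auto simp: case_prod_unfold intro!: continuous_intros)
  then show ?case
    by (intro Ck_family_SucI[where D = "\<lambda>t x v. frechet_derivative (f t) (at x) v + frechet_derivative (g t) (at x) v"])
      (use Suc assms(1) in \<open>auto intro!: has_derivative_add Ck_family_SucD[OF Suc.prems(1)] Ck_family_SucD[OF Suc.prems(2)]\<close>)
qed

lemma Ck_family_sum:
  assumes "open S" "\<And>i. i \<in> I \<Longrightarrow> Ck_family n J S (f i)"
  shows "Ck_family n J S (\<lambda>t x. \<Sum>i\<in>I. f i t x)"
  using assms(2)
proof (induction I rule: infinite_finite_induct)
  case (insert i I)
  then show ?case using assms(1) by (auto intro!: Ck_family_add)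
qed (auto intro!: Ck_family_time_only assms(1))

lemma Ck_family_bilinear:
  assumes "open S" "bounded_bilinear B" "Ck_family n J S f" "Ck_family n J S g"
  shows "Ck_family n J S (\<lambda>t x. B (f t x) (g t x))"
  using assms(3,4)
proof (induction n arbitrary: f g)
  case 0
  then show ?case
    by (auto simp: case_prod_unfold intro!: bounded_bilinear.continuous_on[OF assms(2)])
next
  case (Suc n)
  have "continuous_on (J \<times> S) (\<lambda>(t, x). B (f t x) (g t x))"
    using Suc.prems by (auto simp: case_prod_unfold intro!: bounded_bilinear.continuous_on[OF assms(2)])
  moreover have "Ck_family n J S f" "Ck_family n J S g"
    using Ck_family_Suc_imp Suc.prems by blast+
  ultimately show ?case
    by (intro Ck_family_SucI[where D = "\<lambda>t x v. B (f t x) (frechet_derivative (g t) (at x) v) + B (frechet_derivative (f t) (at x) v) (g t x)"])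
      (use Suc assms(1) in \<open>auto intro!: bounded_bilinear.FDERIV[OF assms(2)] Ck_family_add
          Ck_family_SucD[OF Suc.prems(1)] Ck_family_SucD[OF Suc.prems(2)]\<close>)
qed

text \<open>The chain rule expresses a directional derivative of the composition through the partial
  derivatives of the outer family, which are again such families; so the induction goes through
  for all outer families at once.\<close>

lemma Ck_family_compose:
  fixes g :: "real \<Rightarrow> 'e::euclidean_space \<Rightarrow> 'f::real_normed_vector"
  assumes "open S" "open D" "Ck_family n J D g" "Ck_family n J S \<phi>"
    and in_D: "\<And>t x. t \<in> J \<Longrightarrow> x \<in> S \<Longrightarrow> \<phi> t x \<in> D"
  shows "Ck_family n J S (\<lambda>t x. g t (\<phi> t x))"
proof -
  have c: "continuous_on (J \<times> S) (\<lambda>(t, x). g t (\<phi> t x))"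
    if "continuous_on (J \<times> S) (\<lambda>(t, x). \<phi> t x)" "continuous_on (J \<times> D) (\<lambda>(t, x). g t x)"
    for g :: "real \<Rightarrow> 'e \<Rightarrow> 'f"
  proof -
    have "continuous_on (J \<times> S) (\<lambda>p. (fst p, \<phi> (fst p) (snd p)))"
      using that(1) by (auto simp: case_prod_unfold intro!: continuous_intros)
    then show ?thesis
      using continuous_on_compose2[OF that(2), of "J \<times> S" "\<lambda>p. (fst p, \<phi> (fst p) (snd p))"] in_D
      by (force simp: case_prod_unfold)
  qed
  show ?thesis using assms(3,4)
  proof (induction n arbitrary: g)
    case 0
    then show ?case using c by simp
  next
    case (Suc n)
    have "Ck_family n J S (\<lambda>t x. \<Sum>i\<in>Basis. (frechet_derivative (\<phi> t) (at x) v \<bullet> i) *\<^sub>R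
        frechet_derivative (g t) (at (\<phi> t x)) i)" for v
      using Suc.prems assms(1) Ck_family_Suc_imp[OF Suc.prems(2)]
      by (intro Ck_family_sum Ck_family_bilinear[OF _ bounded_bilinear_scaleR]
          Ck_family_bounded_linear[OF _ bounded_linear_inner_left] Suc.IH) auto
    moreover have "frechet_derivative (g t) (at (\<phi> t x)) (frechet_derivative (\<phi> t) (at x) v) =
        (\<Sum>i\<in>Basis. (frechet_derivative (\<phi> t) (at x) v \<bullet> i) *\<^sub>R frechet_derivative (g t) (at (\<phi> t x)) i)"
      if "t \<in> J" "x \<in> S" for t x v
    proof -
      have "linear (frechet_derivative (g t) (at (\<phi> t x)))"
        using Ck_family_SucD[OF Suc.prems(1) that(1) in_D[OF that]] has_derivative_linear by blast
      from linear_sum[OF this, of "\<lambda>i. (frechet_derivative (\<phi> t) (at x) v \<bullet> i) *\<^sub>R i" Basis]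
      show ?thesis
        by (simp add: linear_scale[OF \<open>linear _\<close>] euclidean_representation)
    qed
    ultimately have "Ck_family n J S (\<lambda>t x. frechet_derivative (g t) (at (\<phi> t x)) (frechet_derivative (\<phi> t) (at x) v))" for v
      by (subst Ck_family_cong[OF assms(1)])
    moreover have "((\<lambda>x. g t (\<phi> t x)) has_derivative
        (\<lambda>v. frechet_derivative (g t) (at (\<phi> t x)) (frechet_derivative (\<phi> t) (at x) v))) (at x)"
      if "t \<in> J" "x \<in> S" for t x
      using diff_chain_at[OF Ck_family_SucD[OF Suc.prems(2) that]
        Ck_family_SucD[OF Suc.prems(1) that(1) in_D[OF that]]]
      by (simp add: o_def)
    ultimately show ?case
      by (intro Ck_family_SucI[where D = "\<lambda>t x v. frechet_derivative (g t) (at (\<phi> t x)) (frechet_derivative (\<phi> t) (at x) v)"])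
        (use Suc.prems c assms(1) in auto)
  qed
qed

lemma Ck_on_imp_Ck_family: "Ck_on n S f \<Longrightarrow> Ck_family n J S (\<lambda>t. f)"
proof (induction n arbitrary: f)
  case 0
  have "continuous_on (J \<times> S) (\<lambda>p. f (snd p))"
    by (rule continuous_on_compose2[of S f]) (use 0 in \<open>auto intro!: continuous_intros\<close>)
  then show ?case by (simp add: case_prod_unfold)
next
  case (Suc n)
  have "continuous_on S f"
    using Suc.prems by (intro differentiable_imp_continuous_on)
      (auto simp: differentiable_on_def intro: differentiable_at_withinI)
  then have "continuous_on (J \<times> S) (\<lambda>p. f (snd p))"
    by (rule continuous_on_compose2) (auto intro!: continuous_intros)
  then show ?case using Suc by (simp add: case_prod_unfold)
qed

lemma Ck_family_imp_Ck_on: "Ck_family n J S f \<Longrightarrow> t \<in> J \<Longrightarrow> Ck_on n S (f t)"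
proof (induction n arbitrary: f)
  case 0
  have "continuous_on S (\<lambda>x. (\<lambda>(t, x). f t x) (t, x))"
    by (rule continuous_on_compose2[where s = S and f = "\<lambda>x. (t, x)"])
      (use 0 in \<open>auto intro!: continuous_intros\<close>)
  then show ?case by simp
qed auto

text \<open>Locality in time serves for families that are written in a chart around a moving point.\<close>

lemma Ck_family_local:
  assumes "\<And>t x. t \<in> J \<Longrightarrow> x \<in> S \<Longrightarrow>
    \<exists>I U. open I \<and> t \<in> I \<and> open U \<and> x \<in> U \<and> Ck_family n (J \<inter> I) (S \<inter> U) f"
  shows "Ck_family n J S f"
proof -
  have c: "continuous_on (J \<times> S) (\<lambda>(t, x). f t x)"
    if "\<And>t x. t \<in> J \<Longrightarrow> x \<in> S \<Longrightarrow>
      \<exists>I U. open I \<and> t \<in> I \<and> open U \<and> x \<in> U \<and> continuous_on ((J \<inter> I) \<times> (S \<inter> U)) (\<lambda>(t, x). f t x)"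
    for f :: "real \<Rightarrow> 'a \<Rightarrow> 'b"
    unfolding continuous_on_eq_continuous_within
  proof clarify
    fix t x assume "t \<in> J" "x \<in> S"
    from that[OF this] obtain I U where *: "open I" "t \<in> I" "open U" "x \<in> U"
      "continuous_on ((J \<inter> I) \<times> (S \<inter> U)) (\<lambda>(t, x). f t x)" by auto
    have "at (t, x) within (J \<inter> I) \<times> (S \<inter> U) = at (t, x) within J \<times> S"
      by (rule at_within_nhd[of _ "I \<times> U"]) (use * in \<open>auto intro: open_Times\<close>)
    then show "continuous (at (t, x) within J \<times> S) (\<lambda>(t, x). f t x)"
      using * \<open>t \<in> J\<close> \<open>x \<in> S\<close>
      by (metis Int_iff mem_Sigma_iff continuous_on_eq_continuous_within)
  qed
  show ?thesis using assms
  proof (induction n arbitrary: f)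
    case 0
    then show ?case using c by simp
  next
    case (Suc n)
    have "continuous_on (J \<times> S) (\<lambda>(t, x). f t x)"
      by (rule c) (use Suc.prems in fastforce)
    moreover have "f t differentiable (at x)" if "t \<in> J" "x \<in> S" for t x
      using Suc.prems[OF that] that by auto
    moreover have "Ck_family n J S (\<lambda>t x. frechet_derivative (f t) (at x) v)" for v
      by (rule Suc.IH) (use Suc.prems in fastforce)
    ultimately show ?case by simp
  qed
qed


lemma Ck_family_mult:
  fixes f g :: "real \<Rightarrow> 'e::euclidean_space \<Rightarrow> real"
  shows "open S \<Longrightarrow> Ck_family n J S f \<Longrightarrow> Ck_family n J S g \<Longrightarrow> Ck_family n J S (\<lambda>t x. f t x * g t x)"
  by (rule Ck_family_bilinear[OF _ bounded_bilinear_mult])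

lemma Ck_family_prod:
  fixes f :: "'i \<Rightarrow> real \<Rightarrow> 'e::euclidean_space \<Rightarrow> real"
  assumes "open S" "\<And>i. i \<in> I \<Longrightarrow> Ck_family n J S (f i)"
  shows "Ck_family n J S (\<lambda>t x. \<Prod>i\<in>I. f i t x)"
  using assms(2)
proof (induction I rule: infinite_finite_induct)
  case (insert i I)
  then show ?case using assms(1) by (auto intro!: Ck_family_mult)
qed (auto intro!: Ck_family_time_only assms(1))

lemma Ck_family_inverse_real:
  fixes f :: "real \<Rightarrow> 'e::euclidean_space \<Rightarrow> real"
  assumes "open S" "Ck_family n J S f" and nz: "\<And>t x. t \<in> J \<Longrightarrow> x \<in> S \<Longrightarrow> f t x \<noteq> 0"
  shows "Ck_family n J S (\<lambda>t x. inverse (f t x))"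
proof -
  have c: "continuous_on (J \<times> S) (\<lambda>(t, x). inverse (f t x))"
    using Ck_family_continuous[OF assms(2)] nz
    by (auto simp: case_prod_unfold intro!: continuous_on_inverse)
  show ?thesis using assms(2)
  proof (induction n)
    case 0
    then show ?case using c by simp
  next
    case (Suc n)
    have 1: "Ck_family n J S (\<lambda>t x. inverse (f t x))"
      using Suc Ck_family_Suc_imp by blast
    have "Ck_family n J S (\<lambda>t x. - (inverse (f t x) * frechet_derivative (f t) (at x) v * inverse (f t x)))" for v
      using Suc.prems 1
      by (intro Ck_family_bounded_linear[OF assms(1), of uminus] Ck_family_mult[OF assms(1)]
          bounded_linear_minus bounded_linear_ident) auto
    then show ?case
      using c assms(1) nz
      by (intro Ck_family_SucI[where D = "\<lambda>t x v. - (inverse (f t x) * frechet_derivative (f t) (at x) v * inverse (f t x))"])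
        (auto intro!: Deriv.has_derivative_inverse Ck_family_SucD[OF Suc.prems])
  qed
qed

lemma Ck_family_nth:
  fixes f :: "real \<Rightarrow> 'e::euclidean_space \<Rightarrow> ('f::real_normed_vector)^'m"
  shows "open S \<Longrightarrow> Ck_family n J S f \<Longrightarrow> Ck_family n J S (\<lambda>t x. f t x $ i)"
  by (rule Ck_family_bounded_linear[OF _ bounded_linear_vec_nth])

lemma Ck_family_vecI:
  fixes f :: "real \<Rightarrow> 'e::euclidean_space \<Rightarrow> ('f::euclidean_space)^'m"
  assumes "open S" "\<And>i. Ck_family n J S (\<lambda>t x. f t x $ i)"
  shows "Ck_family n J S f"
proof -
  have "linear (axis i :: 'f \<Rightarrow> 'f^'m)" for i
    by (rule linearI) (auto simp: axis_def vec_eq_iff)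
  then have "bounded_linear (axis i :: 'f \<Rightarrow> 'f^'m)" for i
    by (simp add: linear_conv_bounded_linear)
  then have "Ck_family n J S (\<lambda>t x. \<Sum>i\<in>UNIV. axis i (f t x $ i))"
    using assms by (intro Ck_family_sum Ck_family_bounded_linear[of _ "axis _"]) auto
  moreover have "(\<Sum>i\<in>UNIV. axis i (v $ i)) = v" for v :: "'f^'m"
    by (simp add: vec_eq_iff axis_def if_distrib[of "\<lambda>x. x $ _"] cong: if_cong)
  ultimately show ?thesis by simp
qed

lemma Ck_family_det:
  fixes f :: "real \<Rightarrow> 'e::euclidean_space \<Rightarrow> real^'m^'m"
  assumes "open S" "\<And>i j. Ck_family n J S (\<lambda>t x. f t x $ i $ j)"
  shows "Ck_family n J S (\<lambda>t x. det (f t x))"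
  unfolding det_def
  by (intro Ck_family_sum Ck_family_mult Ck_family_prod Ck_family_time_only assms) simp

lemma matrix_inv_mult:
  fixes M :: "real^'m^'m"
  assumes "invertible M"
  shows "M ** matrix_inv M = mat 1" "matrix_inv M ** M = mat 1"
  using someI_ex[of "\<lambda>B. M ** B = mat 1 \<and> B ** M = mat 1"] assms
  unfolding matrix_inv_def invertible_def by auto

lemma matrix_inv_cramer:
  fixes M :: "real^'m^'m"
  assumes "invertible M"
  shows "matrix_inv M $ i $ j = det (\<chi> a b. if b = i then axis j 1 $ a else M $ a $ b) / det M"
proof -
  have "M *v (matrix_inv M *v axis j 1) = axis j 1"
    using assms by (simp add: matrix_vector_mul_assoc matrix_inv_mult)
  then have "matrix_inv M *v axis j 1 = (\<chi> k. det (\<chi> a b. if b = k then axis j 1 $ a else M $ a $ b) / det M)"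
    using cramer[of M] assms by (simp add: invertible_det_nz)
  then have "(matrix_inv M *v axis j 1) $ i = det (\<chi> a b. if b = i then axis j 1 $ a else M $ a $ b) / det M"
    by simp
  then show ?thesis
    by (simp add: matrix_vector_mul_component inner_axis)
qed

text \<open>Cramer's rule makes the entries of the inverse rational functions of the entries.\<close>

lemma Ck_family_matrix_inv:
  fixes f :: "real \<Rightarrow> 'e::euclidean_space \<Rightarrow> real^'m^'m"
  assumes "open S" "Ck_family n J S f" "\<And>t x. t \<in> J \<Longrightarrow> x \<in> S \<Longrightarrow> invertible (f t x)"
  shows "Ck_family n J S (\<lambda>t x. matrix_inv (f t x))"
proof -
  have e: "Ck_family n J S (\<lambda>t x. f t x $ i $ j)" for i j
    by (intro Ck_family_nth assms)
  have "Ck_family n J S (\<lambda>t x. det (\<chi> a b. if b = i then axis j 1 $ a else f t x $ a $ b)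
      * inverse (det (f t x)))" for i j
  proof (intro Ck_family_mult Ck_family_det Ck_family_inverse_real assms(1) e)
    show "Ck_family n J S (\<lambda>t x. (\<chi> a b. if b = i then axis j 1 $ a else f t x $ a $ b) $ k $ l)" for k l
      using e assms(1) by (cases "l = i") (auto intro: Ck_family_time_only)
  qed (use assms(3) in \<open>auto simp: invertible_det_nz\<close>)
  then have "Ck_family n J S (\<lambda>t x. matrix_inv (f t x) $ i $ j)" for i j
    using assms(1,3)
    by (subst Ck_family_cong[where g = "\<lambda>t x. det (\<chi> a b. if b = i then axis j 1 $ a else f t x $ a $ b) * inverse (det (f t x))"])
      (auto simp: matrix_inv_cramer divide_inverse)
  then show ?thesis by (intro Ck_family_vecI assms)
qed

lemma Ck_family_blinfunI:
  fixes B :: "real \<Rightarrow> 'e::euclidean_space \<Rightarrow> 'a::euclidean_space \<Rightarrow>\<^sub>L 'b::real_normed_vector"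
  assumes "open S" "\<And>i. i \<in> Basis \<Longrightarrow> Ck_family n J S (\<lambda>t x. blinfun_apply (B t x) i)"
  shows "Ck_family n J S B"
proof -
  have "Ck_family n J S (\<lambda>t x. \<Sum>i\<in>Basis. blinfun_scaleR_left (B t x i) o\<^sub>L blinfun_inner_left i)"
    using assms
    by (intro Ck_family_sum Ck_family_bounded_linear[where L = "\<lambda>y. blinfun_scaleR_left y o\<^sub>L blinfun_inner_left _"]
        bounded_linear_intros) auto
  moreover have "(\<Sum>i\<in>Basis. blinfun_scaleR_left (C i) o\<^sub>L blinfun_inner_left i) = C"
    for C :: "'a \<Rightarrow>\<^sub>L 'b"
    by (rule blinfun_euclidean_eqI)
      (auto simp: blinfun.sum_left blinfun_inner_left.rep_eq inner_Basis if_distrib[of "\<lambda>x. x *\<^sub>R _"] cong: if_cong)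
  ultimately show ?thesis by simp
qed

definition smooth_family ::
    "real set \<Rightarrow> 'e::euclidean_space set \<Rightarrow> (real \<Rightarrow> 'e \<Rightarrow> 'f::real_normed_vector) \<Rightarrow> bool" where
  "smooth_family J S f \<longleftrightarrow> (\<forall>n. Ck_family n J S f)"

lemma smooth_family_derivative:
  "smooth_family J S f \<Longrightarrow> smooth_family J S (\<lambda>t x. frechet_derivative (f t) (at x) v)"
  unfolding smooth_family_def by (metis Ck_family.simps(2))

lemma smooth_on_iff_smooth_family: "smooth_on S f \<longleftrightarrow> smooth_family {0} S (\<lambda>t. f)"
  unfolding smooth_on_def smooth_family_def
  using Ck_on_imp_Ck_family Ck_family_imp_Ck_on[where f = "\<lambda>t. f" and t = 0] by blast

section \<open>Linear differential equations and an a priori estimate\<close>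

lemma continuous_on_vector_derivative:
  assumes "\<And>t. t \<in> S \<Longrightarrow> (f has_vector_derivative f' t) (at t within S)"
  shows "continuous_on S f"
  by (meson assms continuous_on_eq_continuous_within has_vector_derivative_continuous)

text \<open>Let \<open>M\<close> be the maximum of \<open>exp (- 2 L (t - a)) |r(t)|\<close>. Integrating the bound on \<open>r'\<close> against the
  weight gives \<open>M \<le> |r(a)| + M / 2 + \<epsilon> (b - a)\<close>, and the term \<open>M / 2\<close> is absorbed on the left.\<close>

lemma growth_estimate_forward:
  fixes r :: "real \<Rightarrow> 'f::real_normed_vector"
  assumes "a \<le> b" "0 < L" "0 \<le> \<epsilon>"
    and der: "\<And>t. t \<in> {a..b} \<Longrightarrow> (r has_vector_derivative r' t) (at t within {a..b})"
    and bnd: "\<And>t. t \<in> {a..b} \<Longrightarrow> norm (r' t) \<le> L * norm (r t) + \<epsilon>"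
  shows "norm (r b) \<le> 2 * (norm (r a) + \<epsilon> * (b - a)) * exp (2 * L * (b - a))"
proof -
  have contr: "continuous_on {a..b} r"
    by (rule continuous_on_vector_derivative[OF der])
  have "\<exists>\<tau>\<in>{a..b}. \<forall>t\<in>{a..b}. exp (- 2 * L * (t - a)) * norm (r t) \<le> exp (- 2 * L * (\<tau> - a)) * norm (r \<tau>)"
    using assms(1) by (intro continuous_attains_sup continuous_intros contr) auto
  then obtain \<tau> where \<tau>: "\<tau> \<in> {a..b}"
    "\<And>t. t \<in> {a..b} \<Longrightarrow> exp (- 2 * L * (t - a)) * norm (r t) \<le> exp (- 2 * L * (\<tau> - a)) * norm (r \<tau>)"
    by blast
  define M where "M = exp (- 2 * L * (\<tau> - a)) * norm (r \<tau>)"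
  have "0 \<le> M" by (simp add: M_def)
  have rM: "norm (r t) \<le> M * exp (2 * L * (t - a))" if "t \<in> {a..b}" for t
  proof -
    have "norm (r t) = exp (2 * L * (t - a)) * (exp (- 2 * L * (t - a)) * norm (r t))"
      by (simp add: mult.assoc[symmetric] exp_add[symmetric])
    also have "\<dots> \<le> exp (2 * L * (t - a)) * M"
      using \<tau>(2)[OF that] by (simp add: M_def)
    finally show ?thesis by (simp add: mult.commute)
  qed
  define h where "h = (\<lambda>t. M / 2 * exp (2 * L * (t - a)) + \<epsilon> * t)"
  have hder: "(h has_vector_derivative L * (M * exp (2 * L * (t - a))) + \<epsilon>) (at t)" for t
    unfolding h_def has_real_derivative_iff_has_vector_derivative[symmetric]
    by (auto intro!: derivative_eq_intros)
  have key: "norm (r t - r a) \<le> h t - h a" if t: "t \<in> {a..b}" for t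
  proof (cases "t = a")
    case False
    show ?thesis
    proof (rule differentiable_bound_general[where f' = r' and \<phi>' = "\<lambda>s. L * (M * exp (2 * L * (s - a))) + \<epsilon>"])
      show "a < t" using t False by auto
      show "continuous_on {a..t} r" using contr t by (auto intro: continuous_on_subset)
      show "continuous_on {a..t} h" unfolding h_def by (intro continuous_intros)
      show "(r has_vector_derivative r' s) (at s)" if "a < s" "s < t" for s
        using der[of s] that t by (auto simp: at_within_Icc_at)
      show "(h has_vector_derivative L * (M * exp (2 * L * (s - a))) + \<epsilon>) (at s)" for s
        by (rule hder)
      show "norm (r' s) \<le> L * (M * exp (2 * L * (s - a))) + \<epsilon>" if "a < s" "s < t" for s
        using order_trans[OF bnd[of s] add_right_mono[OF mult_left_mono[OF rM[of s]]]] that t assms(2)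
          by (auto simp: mult_ac)
    qed
  qed simp
  have hb: "norm (r t) \<le> norm (r a) + M / 2 * exp (2 * L * (t - a)) + \<epsilon> * (b - a)" if t: "t \<in> {a..b}" for t
  proof -
    have "norm (r t) \<le> norm (r a) + norm (r t - r a)"
      by (metis add.commute diff_add_cancel norm_triangle_ineq)
    also have "\<dots> \<le> norm (r a) + (h t - h a)" using key[OF t] by simp
    also have "h t - h a \<le> M / 2 * exp (2 * L * (t - a)) + \<epsilon> * (t - a)"
      using \<open>0 \<le> M\<close> by (simp add: h_def algebra_simps)
    also have "\<epsilon> * (t - a) \<le> \<epsilon> * (b - a)" using t assms(3) by (intro mult_left_mono) auto
    finally show ?thesis by simp
  qed
  have "M \<le> exp (- 2 * L * (\<tau> - a)) * (norm (r a) + M / 2 * exp (2 * L * (\<tau> - a)) + \<epsilon> * (b - a))"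
    unfolding M_def[of] using hb[OF \<tau>(1)] by (intro mult_left_mono) (auto simp: M_def)
  also have "\<dots> = exp (- 2 * L * (\<tau> - a)) * (norm (r a) + \<epsilon> * (b - a)) + M / 2"
    by (simp add: algebra_simps exp_add[symmetric])
  also have "exp (- 2 * L * (\<tau> - a)) * (norm (r a) + \<epsilon> * (b - a)) \<le> 1 * (norm (r a) + \<epsilon> * (b - a))"
    using \<tau>(1) assms by (intro mult_right_mono) auto
  finally have "M \<le> 2 * (norm (r a) + \<epsilon> * (b - a))" by simp
  then have "M * exp (2 * L * (b - a)) \<le> 2 * (norm (r a) + \<epsilon> * (b - a)) * exp (2 * L * (b - a))"
    by (intro mult_right_mono) auto
  with rM[of b] assms(1) show ?thesis by (meson order_trans atLeastAtMost_iff order_refl)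
qed

lemma has_vector_derivative_reflect:
  fixes f :: "real \<Rightarrow> 'f::real_normed_vector"
  assumes "(f has_vector_derivative f') (at (- t) within uminus ` S)"
  shows "((\<lambda>s. f (- s)) has_vector_derivative - f') (at t within S)"
proof -
  have "(f has_derivative (\<lambda>x. x *\<^sub>R f')) (at (- t) within uminus ` S)"
    using assms by (simp add: has_vector_derivative_def)
  moreover have "(uminus has_derivative uminus) (at t within S)"
    by (auto intro!: derivative_eq_intros)
  ultimately have "((f \<circ> uminus) has_derivative (\<lambda>x. x *\<^sub>R f') \<circ> uminus) (at t within S)"
    by (intro diff_chain_within) auto
  then show ?thesis by (simp add: has_vector_derivative_def o_def)
qed

text \<open>Gronwall's inequality for vector-valued functions: on the left of the base point \<open>t1\<close> it is the
  forward estimate for the reflected time.\<close>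

lemma growth_estimate:
  fixes r :: "real \<Rightarrow> 'f::real_normed_vector"
  assumes "t1 \<in> {a..b}" "t \<in> {a..b}" "0 < L" "0 \<le> \<epsilon>"
    and der: "\<And>t. t \<in> {a..b} \<Longrightarrow> (r has_vector_derivative r' t) (at t within {a..b})"
    and bnd: "\<And>t. t \<in> {a..b} \<Longrightarrow> norm (r' t) \<le> L * norm (r t) + \<epsilon>"
  shows "norm (r t) \<le> 2 * (norm (r t1) + \<epsilon> * (b - a)) * exp (2 * L * (b - a))"
proof -
  have "norm (r t) \<le> 2 * (norm (r t1) + \<epsilon> * \<bar>t - t1\<bar>) * exp (2 * L * \<bar>t - t1\<bar>)"
  proof (cases "t1 \<le> t")
    case True
    have "(r has_vector_derivative r' s) (at s within {t1..t})" if "s \<in> {t1..t}" for s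
      by (rule has_vector_derivative_within_subset[OF der]) (use that assms(1,2) in auto)
    then show ?thesis
      using growth_estimate_forward[of t1 t L \<epsilon> r r'] True assms by auto
  next
    case False
    have "((\<lambda>s. r (- s)) has_vector_derivative - r' (- s)) (at s within {- t1..- t})"
      if "s \<in> {- t1..- t}" for s
    proof (rule has_vector_derivative_reflect)
      show "(r has_vector_derivative r' (- s)) (at (- s) within uminus ` {- t1..- t})"
        by (rule has_vector_derivative_within_subset[OF der]) (use that assms(1,2) in auto)
    qed
    then show ?thesis
      using growth_estimate_forward[of "- t1" "- t" L \<epsilon> "\<lambda>s. r (- s)" "\<lambda>s. - r' (- s)"] False assms by auto
  qed
  also have "\<dots> \<le> 2 * (norm (r t1) + \<epsilon> * (b - a)) * exp (2 * L * (b - a))"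
    using assms(1-4) by (intro mult_mono mult_left_mono add_left_mono) (auto intro!: mult_nonneg_nonneg add_nonneg_nonneg)
  finally show ?thesis .
qed

lemma continuous_on_Icc_bound:
  fixes f :: "real \<Rightarrow> 'f::real_normed_vector"
  assumes "continuous_on {a..b} f"
  obtains B where "0 < B" "\<And>t. t \<in> {a..b} \<Longrightarrow> norm (f t) \<le> B"
  using compact_imp_bounded[OF compact_continuous_image[OF assms compact_Icc]]
  unfolding bounded_pos by auto

text \<open>In terms of \<open>q(t) = exp (- \<kappa> (t - a)) w(t)\<close> with \<open>\<kappa>\<close> large the integral equation for
  \<open>w\<close> is a contraction on the whole interval.\<close>

lemma linear_ode_exists_forward:
  fixes A :: "real \<Rightarrow> 'f::banach \<Rightarrow>\<^sub>L 'f"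
  assumes "a \<le> b" and contA: "continuous_on {a..b} A" and contc: "continuous_on {a..b} c"
  shows "\<exists>w. w a = w0 \<and> (\<forall>t\<in>{a..b}. (w has_vector_derivative A t (w t) + c t) (at t within {a..b}))"
proof -
  obtain B where B: "0 < B" "\<And>t. t \<in> {a..b} \<Longrightarrow> norm (A t) \<le> B"
    using continuous_on_Icc_bound[OF contA] by blast
  define \<kappa> where "\<kappa> = 2 * B"
  define F where "F = (\<lambda>(q :: real \<Rightarrow>\<^sub>C 'f) s. A s (exp (\<kappa> * (s - a)) *\<^sub>R q s) + c s)"
  define R where "R = (\<lambda>q t. exp (- \<kappa> * (t - a)) *\<^sub>R (w0 + integral {a..t} (F q)))"
  have contF: "continuous_on {a..b} (F q)" for q
    unfolding F_def by (intro continuous_intros blinfun.continuous_on contA contc continuous_on_apply_bcontfun)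
  have derI: "((\<lambda>u. integral {a..u} (F q)) has_vector_derivative F q t) (at t within {a..b})" if "t \<in> {a..b}" for q t
    by (rule integral_has_vector_derivative[OF contF that])
  have contI: "continuous_on {a..b} (\<lambda>t. integral {a..t} (F q))" for q
    by (rule continuous_on_vector_derivative[OF derI])
  have contR: "continuous_on (cbox a b) (R q)" for q
    unfolding R_def using contI by (auto intro!: continuous_intros)
  have "\<exists>g :: real \<Rightarrow>\<^sub>C 'f. \<forall>x. g x = R q (clamp a b x)" for q
    using continuous_on_cbox_bcontfunE[OF contR[of q]] by metis
  then obtain T where T: "\<And>q x. apply_bcontfun (T q) x = R q (clamp a b x)" by metis
  have est: "dist (R p t) (R q t) \<le> 1 / 2 * dist p q" if t: "t \<in> {a..b}" for p q t
  proof -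
    define h where "h = (\<lambda>t. dist p q / 2 * exp (\<kappa> * (t - a)))"
    have "norm ((integral {a..t} (F p) - integral {a..t} (F q)) - (integral {a..a} (F p) - integral {a..a} (F q))) \<le> h t - h a"
    proof (cases "t = a")
      case False
      show ?thesis
      proof (rule differentiable_bound_general[where f' = "\<lambda>s. F p s - F q s" and \<phi>' = "\<lambda>s. B * exp (\<kappa> * (s - a)) * dist p q"])
        show "a < t" using t False by auto
        show "continuous_on {a..t} (\<lambda>u. integral {a..u} (F p) - integral {a..u} (F q))"
          using t by (intro continuous_intros continuous_on_subset[OF contI]) auto
        show "continuous_on {a..t} h" unfolding h_def by (intro continuous_intros)
        show "((\<lambda>u. integral {a..u} (F p) - integral {a..u} (F q)) has_vector_derivative F p s - F q s) (at s)" if "a < s" "s < t" for s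
          using derI[of s p] derI[of s q] that t by (auto simp: at_within_Icc_at intro: has_vector_derivative_diff)
        show "(h has_vector_derivative B * exp (\<kappa> * (s - a)) * dist p q) (at s)" for s
          unfolding h_def has_real_derivative_iff_has_vector_derivative[symmetric]
          by (auto intro!: derivative_eq_intros simp: \<kappa>_def)
        show "norm (F p s - F q s) \<le> B * exp (\<kappa> * (s - a)) * dist p q" if "a < s" "s < t" for s
        proof -
          have "F p s - F q s = A s (exp (\<kappa> * (s - a)) *\<^sub>R (p s - q s))"
            by (simp add: F_def blinfun.bilinear_simps algebra_simps)
          also have "norm \<dots> \<le> norm (A s) * (exp (\<kappa> * (s - a)) * norm (p s - q s))"
            using norm_blinfun[of "A s"] by (metis abs_exp_cancel norm_scaleR)
          also have "\<dots> \<le> B * (exp (\<kappa> * (s - a)) * dist p q)"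
            using B(1) B(2)[of s] that t dist_bounded[of p s q]
            by (intro mult_mono) (auto simp: dist_norm)
          finally show ?thesis by simp
        qed
      qed
    qed simp
    then have "norm (integral {a..t} (F p) - integral {a..t} (F q)) \<le> dist p q / 2 * exp (\<kappa> * (t - a))"
    proof -
      assume "norm ((integral {a..t} (F p) - integral {a..t} (F q)) - (integral {a..a} (F p) - integral {a..a} (F q))) \<le> h t - h a"
      then have "norm (integral {a..t} (F p) - integral {a..t} (F q)) \<le> h t - h a" by simp
      also have "\<dots> \<le> h t" by (simp add: h_def)
      finally show ?thesis by (simp add: h_def)
    qed
    then have "exp (- \<kappa> * (t - a)) * norm (integral {a..t} (F p) - integral {a..t} (F q)) \<le>
        exp (- \<kappa> * (t - a)) * (dist p q / 2 * exp (\<kappa> * (t - a)))"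
      by (intro mult_left_mono) auto
    also have "\<dots> = 1 / 2 * dist p q"
      by (simp add: exp_add[symmetric] algebra_simps)
    finally show ?thesis
      by (simp add: R_def dist_norm scaleR_right_diff_distrib[symmetric])
  qed
  have "\<exists>!q. T q = q"
  proof (rule banach_fix_type[where c = "1 / 2"], safe)
    fix p q
    have "clamp a b x \<in> {a..b}" for x :: real
      using clamp_in_interval[of a b x] assms(1) by simp
    then show "dist (T p) (T q) \<le> 1 / 2 * dist p q"
      by (intro dist_bound) (use est in \<open>auto simp: T\<close>)
  qed auto
  then obtain q where q: "T q = q" by blast
  define w where "w = (\<lambda>t. w0 + integral {a..t} (F q))"
  have "exp (\<kappa> * (t - a)) *\<^sub>R q t = w t" if "t \<in> {a..b}" for t
  proof -
    have "q t = R q t" using T[of q t] that q by (simp add: clamp_cancel_cbox)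
    then show ?thesis by (simp add: R_def w_def exp_add[symmetric])
  qed
  then have "F q t = A t (w t) + c t" if "t \<in> {a..b}" for t using that by (simp add: F_def)
  then have "(w has_vector_derivative A t (w t) + c t) (at t within {a..b})" if "t \<in> {a..b}" for t
    using derI[OF that, of q] that unfolding w_def by (auto intro!: derivative_eq_intros)
  moreover have "w a = w0" by (simp add: w_def)
  ultimately show ?thesis by blast
qed

lemma linear_ode_exists:
  fixes A :: "real \<Rightarrow> 'f::banach \<Rightarrow>\<^sub>L 'f"
  assumes t1: "t1 \<in> {a..b}" and contA: "continuous_on {a..b} A" and contc: "continuous_on {a..b} c"
  shows "\<exists>w. w t1 = w0 \<and> (\<forall>t\<in>{a..b}. (w has_vector_derivative A t (w t) + c t) (at t within {a..b}))"
proof -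
  have "\<exists>w. w t1 = w0 \<and> (\<forall>t\<in>{t1..b}. (w has_vector_derivative A t (w t) + c t) (at t within {t1..b}))"
    using t1 by (intro linear_ode_exists_forward continuous_on_subset[OF contA] continuous_on_subset[OF contc]) auto
  then obtain w2 where w2: "w2 t1 = w0"
    "\<And>t. t \<in> {t1..b} \<Longrightarrow> (w2 has_vector_derivative A t (w2 t) + c t) (at t within {t1..b})" by blast
  have "\<exists>w. w (- t1) = w0 \<and> (\<forall>t\<in>{- t1..- a}. (w has_vector_derivative (- A (- t)) (w t) + - c (- t)) (at t within {- t1..- a}))"
    using t1 by (intro linear_ode_exists_forward continuous_intros
      continuous_on_compose2[OF contA] continuous_on_compose2[OF contc]) auto
  then obtain w1 where w1: "w1 (- t1) = w0"
    "\<And>t. t \<in> {- t1..- a} \<Longrightarrow> (w1 has_vector_derivative - (A (- t) (w1 t) + c (- t))) (at t within {- t1..- a})"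
    by (auto simp: blinfun.bilinear_simps)
  have w1': "((\<lambda>s. w1 (- s)) has_vector_derivative A t (w1 (- t)) + c t) (at t within {a..t1})" if "t \<in> {a..t1}" for t
  proof -
    have "((\<lambda>s. w1 (- s)) has_vector_derivative - (- (A t (w1 (- t)) + c t))) (at t within {a..t1})"
      using w1(2)[of "- t"] that
      by (intro has_vector_derivative_reflect) (simp add: image_uminus_atLeastAtMost)
    then show ?thesis by (simp add: add.commute)
  qed
  define w where "w = (\<lambda>t. if t \<in> {a..t1} then w1 (- t) else w2 t)"
  have "(w has_vector_derivative A t (w t) + c t) (at t within {a..b})" if t: "t \<in> {a..b}" for t
  proof -
    have cl: "closure {a..t1} \<inter> closure {t1..b} = {t1}" using t1 by auto
    have "((\<lambda>x. if x \<in> {a..t1} then w1 (- x) else w2 x) has_vector_derivative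
      (if t \<in> {a..t1} then A t (w1 (- t)) + c t else A t (w2 t) + c t)) (at t within {a..b})"
    proof (rule has_vector_derivative_If_within_closures[where S = "{a..t1}" and T = "{t1..b}"])
      show "t \<in> {a..t1} \<union> {t1..b}" using t by auto
      show "{a..b} = {a..t1} \<union> {t1..b}" using t1 by auto
      have e: "{a..t1} \<union> {t1} = {a..t1}" "{t1..b} \<union> {t1} = {t1..b}" using t1 by auto
      show "((\<lambda>x. w1 (- x)) has_vector_derivative A t (w1 (- t)) + c t) (at t within {a..t1} \<union> (closure {a..t1} \<inter> closure {t1..b}))"
        if "t \<in> {a..t1} \<union> (closure {a..t1} \<inter> closure {t1..b})"
        using that unfolding cl e by (rule w1')
      show "(w2 has_vector_derivative A t (w2 t) + c t) (at t within {t1..b} \<union> (closure {a..t1} \<inter> closure {t1..b}))"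
        if "t \<in> {t1..b} \<union> (closure {a..t1} \<inter> closure {t1..b})"
        using that unfolding cl e by (rule w2(2))
      assume "t \<in> closure {a..t1}" "t \<in> closure {t1..b}"
      then have "t = t1" using cl by auto
      then show "w1 (- t) = w2 t" "A t (w1 (- t)) + c t = A t (w2 t) + c t"
        using w1(1) w2(1) by auto
    qed
    then show ?thesis unfolding w_def by (auto split: if_splits)
  qed
  moreover have "w t1 = w0" using t1 w1(1) by (simp add: w_def)
  ultimately show ?thesis by blast
qed

section \<open>Differentiability of a family of solutions in its parameter\<close>

text \<open>An increment splits into one of the parameter, small uniformly in time, and one of the time at a fixed
  parameter.\<close>

lemma joint_continuityI:
  fixes u :: "real \<Rightarrow> 'p::metric_space \<Rightarrow> 'f::metric_space"
  assumes "\<And>\<xi>. \<xi> \<in> U \<Longrightarrow> continuous_on J (\<lambda>t. u t \<xi>)"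
    and unif: "\<And>\<xi>0 e. \<xi>0 \<in> U \<Longrightarrow> 0 < e \<Longrightarrow> \<exists>d>0. \<forall>\<xi>\<in>U. dist \<xi> \<xi>0 < d \<longrightarrow> (\<forall>t\<in>J. dist (u t \<xi>) (u t \<xi>0) \<le> e)"
  shows "continuous_on (J \<times> U) (\<lambda>(t, \<xi>). u t \<xi>)"
  unfolding continuous_on_iff
proof (intro ballI allI impI)
  fix p :: "real \<times> 'p" and e :: real assume p: "p \<in> J \<times> U" and e: "0 < e"
  obtain t0 \<xi>0 where p': "p = (t0, \<xi>0)" "t0 \<in> J" "\<xi>0 \<in> U" using p by auto
  obtain d1 where d1: "d1 > 0" "\<And>t. t \<in> J \<Longrightarrow> dist t t0 < d1 \<Longrightarrow> dist (u t \<xi>0) (u t0 \<xi>0) < e / 2"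
    using assms(1)[OF p'(3)] p'(2) e unfolding continuous_on_iff by (meson half_gt_zero)
  obtain d2 where d2: "d2 > 0" "\<And>\<xi> t. \<xi> \<in> U \<Longrightarrow> dist \<xi> \<xi>0 < d2 \<Longrightarrow> t \<in> J \<Longrightarrow> dist (u t \<xi>) (u t \<xi>0) \<le> e / 2"
    using unif[OF p'(3), of "e / 2"] e by auto
  show "\<exists>d>0. \<forall>q\<in>J \<times> U. dist q p < d \<longrightarrow> dist (case q of (t, \<xi>) \<Rightarrow> u t \<xi>) (case p of (t, \<xi>) \<Rightarrow> u t \<xi>) < e"
  proof (intro exI conjI ballI impI)
    show "0 < min d1 d2" using d1 d2 by simp
    fix q assume q: "q \<in> J \<times> U" "dist q p < min d1 d2"
    obtain t \<xi> where q': "q = (t, \<xi>)" "t \<in> J" "\<xi> \<in> U" using q by auto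
    have "dist t t0 < d1" "dist \<xi> \<xi>0 < d2"
      using q(2) dist_fst_le[of q p] dist_snd_le[of q p] q' p' by auto
    then have "dist (u t \<xi>) (u t \<xi>0) + dist (u t \<xi>0) (u t0 \<xi>0) < e"
      using d1(2)[OF q'(2)] d2(2)[OF q'(3) _ q'(2)] by force
    then show "dist (case q of (t, \<xi>) \<Rightarrow> u t \<xi>) (case p of (t, \<xi>) \<Rightarrow> u t \<xi>) < e"
      using dist_triangle[of "u t \<xi>" "u t0 \<xi>0" "u t \<xi>0"] q' p' by simp
  qed
qed

lemma joint_continuityD:
  fixes u :: "real \<Rightarrow> 'p::metric_space \<Rightarrow> 'f::metric_space"
  assumes "continuous_on (J \<times> U) (\<lambda>(t, \<xi>). u t \<xi>)" "compact J" "\<xi>0 \<in> U" "0 < e"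
  shows "\<exists>d>0. \<forall>\<xi>\<in>U. dist \<xi> \<xi>0 < d \<longrightarrow> (\<forall>t\<in>J. dist (u t \<xi>) (u t \<xi>0) \<le> e)"
proof -
  have "continuous_on (U \<times> J) ((\<lambda>(t, \<xi>). u t \<xi>) \<circ> prod.swap)"
    by (intro continuous_on_compose continuous_on_swap) (simp add: product_swap assms(1))
  then obtain X0 where X0: "\<xi>0 \<in> X0" "open X0"
    "\<forall>\<xi>\<in>X0 \<inter> U. \<forall>t\<in>J. dist (((\<lambda>(t, \<xi>). u t \<xi>) \<circ> prod.swap) (\<xi>, t)) (((\<lambda>(t, \<xi>). u t \<xi>) \<circ> prod.swap) (\<xi>0, t)) \<le> e"
    using continuous_on_prod_compactE[OF _ assms(2) assms(3) assms(4)] by metis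
  obtain d where "d > 0" "\<And>\<xi>. dist \<xi> \<xi>0 < d \<Longrightarrow> \<xi> \<in> X0"
    using X0(1,2) unfolding open_dist by blast
  then show ?thesis using X0(3) by (intro exI[of _ d]) auto
qed

text \<open>By compactness, a neighbourhood of fixed size around the whole curve lies in the domain, and \<open>G\<close>
  varies little on it.\<close>

lemma uniform_continuity_near_curve:
  fixes G :: "real \<Rightarrow> 'q::{real_normed_vector, heine_borel} \<Rightarrow> 'f::metric_space"
  assumes "compact J" "continuous_on J p" "open D" "\<And>t. t \<in> J \<Longrightarrow> p t \<in> D"
    and contG: "continuous_on (J \<times> D) (\<lambda>(t, x). G t x)" and "0 < e"
  shows "\<exists>d>0. \<forall>t\<in>J. \<forall>x. dist x (p t) < d \<longrightarrow> x \<in> D \<and> dist (G t x) (G t (p t)) \<le> e"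
proof -
  have "compact (p ` J)" using assms by (intro compact_continuous_image)
  then obtain d0 where d0: "d0 > 0" "(\<Union>x\<in>p ` J. ball x d0) \<subseteq> D"
    using compact_subset_open_imp_ball_epsilon_subset[of "p ` J" D] assms by blast
  have inD: "p t + x \<in> D" if "t \<in> J" "x \<in> ball 0 d0" for t x
    using d0(2) that by (force simp: dist_norm)
  have "continuous_on (J \<times> ball 0 d0) (\<lambda>q. (fst q, p (fst q) + snd q))"
    by (intro continuous_intros continuous_on_compose2[OF assms(2)]) auto
  then have "continuous_on (J \<times> ball 0 d0) (\<lambda>q. (\<lambda>(t, x). G t x) (fst q, p (fst q) + snd q))"
    by (rule continuous_on_compose2[OF contG]) (use inD in auto)
  then have "continuous_on (J \<times> ball 0 d0) (\<lambda>(t, x). G t (p t + x))"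
    by (simp add: case_prod_unfold)
  from joint_continuityD[OF this assms(1) _ assms(6), of 0] d0(1)
  obtain d where d: "d > 0" "\<And>x t. x \<in> ball 0 d0 \<Longrightarrow> norm x < d \<Longrightarrow> t \<in> J \<Longrightarrow> dist (G t (p t + x)) (G t (p t)) \<le> e"
    by auto
  show ?thesis
  proof (intro exI conjI ballI allI impI)
    show "min d d0 > 0" using d d0 by simp
    fix t x assume "t \<in> J" "dist x (p t) < min d d0"
    then show "x \<in> D" "dist (G t x) (G t (p t)) \<le> e"
      using inD[of t "x - p t"] d(2)[of "x - p t" t] by (auto simp: dist_norm norm_minus_commute)
  qed
qed

text \<open>The candidate for the derivative is the solution of the linearized equation; the remainder
  of the first order expansion satisfies the same linear equation up to a small error, so the growth
  estimate makes it small.\<close>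

theorem differentiable_in_parameter:
  fixes \<phi> :: "real \<Rightarrow> 'p::euclidean_space \<Rightarrow> 'e::euclidean_space"
    and g :: "real \<Rightarrow> 'p \<times> 'e \<Rightarrow> 'e" and G :: "real \<Rightarrow> 'p \<times> 'e \<Rightarrow> ('p \<times> 'e) \<Rightarrow>\<^sub>L 'e"
  assumes t1: "t1 \<in> {a..b}" and "open U" "open D"
    and cont\<phi>: "continuous_on ({a..b} \<times> U) (\<lambda>(t, \<xi>). \<phi> t \<xi>)"
    and in_D: "\<And>t \<xi>. t \<in> {a..b} \<Longrightarrow> \<xi> \<in> U \<Longrightarrow> (\<xi>, \<phi> t \<xi>) \<in> D"
    and ode: "\<And>t \<xi>. t \<in> {a..b} \<Longrightarrow> \<xi> \<in> U \<Longrightarrow> ((\<lambda>t. \<phi> t \<xi>) has_vector_derivative g t (\<xi>, \<phi> t \<xi>)) (at t within {a..b})"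
    and G: "\<And>t p. t \<in> {a..b} \<Longrightarrow> p \<in> D \<Longrightarrow> (g t has_derivative G t p) (at p)"
    and contG: "continuous_on ({a..b} \<times> D) (\<lambda>(t, p). G t p)"
    and \<xi>0: "\<xi>0 \<in> U" and init: "\<phi> t1 differentiable (at \<xi>0)"
  shows "\<forall>t\<in>{a..b}. \<phi> t differentiable (at \<xi>0) \<and>
    (\<forall>\<eta>. ((\<lambda>t. frechet_derivative (\<phi> t) (at \<xi>0) \<eta>) has_vector_derivative
       G t (\<xi>0, \<phi> t \<xi>0) (\<eta>, frechet_derivative (\<phi> t) (at \<xi>0) \<eta>)) (at t within {a..b}))"
proof -
  define p0 where "p0 = (\<lambda>t. (\<xi>0, \<phi> t \<xi>0))"
  have contp0: "continuous_on {a..b} p0"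
    unfolding p0_def using continuous_on_vector_derivative[OF ode[OF _ \<xi>0]] by (intro continuous_intros)
  have contG0: "continuous_on {a..b} (\<lambda>t. G t (p0 t))"
  proof -
    have "continuous_on {a..b} (\<lambda>t. (\<lambda>(t, p). G t p) (t, p0 t))"
      by (rule continuous_on_compose2[OF contG]) (use contp0 in_D[OF _ \<xi>0] in \<open>auto simp: p0_def intro!: continuous_intros\<close>)
    then show ?thesis by simp
  qed
  define inl :: "'p \<Rightarrow>\<^sub>L ('p \<times> 'e)" where "inl = Blinfun (\<lambda>x. (x, 0))"
  define inr :: "'e \<Rightarrow>\<^sub>L ('p \<times> 'e)" where "inr = Blinfun (\<lambda>z. (0, z))"
  have inl: "inl x = (x, 0)" for x unfolding inl_def
    by (subst bounded_linear_Blinfun_apply) (auto intro!: bounded_linear_intros bounded_linear_Pair)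
  have inr: "inr z = (0, z)" for z unfolding inr_def
    by (subst bounded_linear_Blinfun_apply) (auto intro!: bounded_linear_intros bounded_linear_Pair)
  \<comment> \<open>The linearized equation \<open>W' = \<partial>\<^sub>zg W + \<partial>\<^sub>\<xi>g\<close> is posed in the space of linear maps, so that its solution
    is linear in the direction.\<close>
  define A where "A = (\<lambda>t. bounded_bilinear.prod_right (o\<^sub>L) (G t (p0 t) o\<^sub>L inr) :: ('p \<Rightarrow>\<^sub>L 'e) \<Rightarrow>\<^sub>L ('p \<Rightarrow>\<^sub>L 'e))"
  have A: "A t w = G t (p0 t) o\<^sub>L inr o\<^sub>L w" for t w
    unfolding A_def by (subst bounded_bilinear.prod_right.rep_eq[OF bounded_bilinear_blinfun_compose]) simp
  have "continuous_on {a..b} A" unfolding A_def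
    by (intro bounded_linear.continuous_on[OF bounded_bilinear.bounded_linear_prod_right[OF bounded_bilinear_blinfun_compose]]
      bounded_bilinear.continuous_on[OF bounded_bilinear_blinfun_compose] continuous_intros contG0)
  moreover have "continuous_on {a..b} (\<lambda>t. G t (p0 t) o\<^sub>L inl)"
    by (intro bounded_bilinear.continuous_on[OF bounded_bilinear_blinfun_compose] continuous_intros contG0)
  ultimately obtain W where W0: "W t1 = Blinfun (frechet_derivative (\<phi> t1) (at \<xi>0))"
    and W: "\<And>t. t \<in> {a..b} \<Longrightarrow> (W has_vector_derivative A t (W t) + (G t (p0 t) o\<^sub>L inl)) (at t within {a..b})"
    using linear_ode_exists[OF t1, of A "\<lambda>t. G t (p0 t) o\<^sub>L inl" "Blinfun (frechet_derivative (\<phi> t1) (at \<xi>0))"] by blast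
  have d1: "(\<phi> t1 has_derivative W t1) (at \<xi>0)"
    using init unfolding W0 by (subst bounded_linear_Blinfun_apply)
      (auto simp: frechet_derivative_works intro: has_derivative_bounded_linear)
  have W\<eta>: "((\<lambda>t. W t \<eta>) has_vector_derivative G t (p0 t) (\<eta>, W t \<eta>)) (at t within {a..b})"
    if "t \<in> {a..b}" for t \<eta>
  proof -
    have "((\<lambda>t. W t \<eta>) has_vector_derivative (A t (W t) + (G t (p0 t) o\<^sub>L inl)) \<eta>) (at t within {a..b})"
      by (rule bounded_linear.has_vector_derivative[OF bounded_linear_apply_blinfun W[OF that]])
    moreover have "(A t (W t) + (G t (p0 t) o\<^sub>L inl)) \<eta> = G t (p0 t) (\<eta>, W t \<eta>)"
      by (simp add: A inl inr blinfun.add_left blinfun.add_right[symmetric])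
    ultimately show ?thesis by simp
  qed
  obtain BK where BK: "0 < BK" "\<And>t. t \<in> {a..b} \<Longrightarrow> norm (G t (p0 t)) \<le> BK"
    using continuous_on_Icc_bound[OF contG0] by blast
  obtain BW where BW: "0 < BW" "\<And>t. t \<in> {a..b} \<Longrightarrow> norm (W t) \<le> BW"
    using continuous_on_Icc_bound[OF continuous_on_vector_derivative[OF W]] by blast
  \<comment> \<open>The remainder \<open>\<rho>\<close> satisfies \<open>|\<rho>'| \<le> (BK + 1) |\<rho>| + \<epsilon> (1 + BW) |h|\<close> and \<open>|\<rho>(t1)| \<le> \<epsilon> |h|\<close>; this is
    the constant that the growth estimate then produces.\<close>
  define C where "C = 2 * (1 + (1 + BW) * (b - a)) * exp (2 * (BK + 1) * (b - a))"
  have ab: "a \<le> b" using t1 by auto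
  have "0 < C" unfolding C_def using ab BW(1) by (intro mult_pos_pos add_pos_nonneg) auto
  have main: "\<exists>d>0. \<forall>\<xi>. norm (\<xi> - \<xi>0) < d \<longrightarrow> (\<forall>t\<in>{a..b}. norm (\<phi> t \<xi> - \<phi> t \<xi>0 - W t (\<xi> - \<xi>0)) \<le> C * \<epsilon> * norm (\<xi> - \<xi>0))"
    if \<epsilon>: "0 < \<epsilon>" "\<epsilon> \<le> 1" for \<epsilon>
  proof -
    obtain d0 where d0: "d0 > 0" "\<And>t p. t \<in> {a..b} \<Longrightarrow> dist p (p0 t) < d0 \<Longrightarrow> p \<in> D \<and> dist (G t p) (G t (p0 t)) \<le> \<epsilon>"
      using uniform_continuity_near_curve[OF compact_Icc contp0 \<open>open D\<close> _ contG \<epsilon>(1)] in_D[OF _ \<xi>0] p0_def by auto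
    obtain d2 where d2: "d2 > 0" "\<And>\<xi> t. \<xi> \<in> U \<Longrightarrow> dist \<xi> \<xi>0 < d2 \<Longrightarrow> t \<in> {a..b} \<Longrightarrow> dist (\<phi> t \<xi>) (\<phi> t \<xi>0) \<le> d0 / 3"
      using joint_continuityD[OF cont\<phi> compact_Icc \<xi>0, of "d0 / 3"] d0(1) by auto
    obtain d3 where d3: "d3 > 0" "\<And>\<xi>. dist \<xi> \<xi>0 < d3 \<Longrightarrow> \<xi> \<in> U"
      using \<open>open U\<close> \<xi>0 unfolding open_dist by blast
    obtain d4 where d4: "d4 > 0" "\<And>\<xi>. norm (\<xi> - \<xi>0) < d4 \<Longrightarrow> norm (\<phi> t1 \<xi> - \<phi> t1 \<xi>0 - W t1 (\<xi> - \<xi>0)) \<le> \<epsilon> * norm (\<xi> - \<xi>0)"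
      using d1 \<epsilon>(1) unfolding has_derivative_at_alt by blast
    define d where "d = min (min d2 d3) (min d4 (d0 / 3))"
    have "d > 0" unfolding d_def using d0 d2 d3 d4 by simp
    moreover have "norm (\<phi> t \<xi> - \<phi> t \<xi>0 - W t (\<xi> - \<xi>0)) \<le> C * \<epsilon> * norm (\<xi> - \<xi>0)"
      if near: "norm (\<xi> - \<xi>0) < d" and t: "t \<in> {a..b}" for \<xi> t
    proof -
      have "\<xi> \<in> U" using near d3(2) by (simp add: d_def dist_norm)
      define h where "h = \<xi> - \<xi>0"
      define r where "r = (\<lambda>t. \<phi> t \<xi> - \<phi> t \<xi>0)"
      define \<rho> where "\<rho> = (\<lambda>t. r t - W t h)"
      have \<rho>der: "(\<rho> has_vector_derivative (g t (\<xi>, \<phi> t \<xi>) - g t (p0 t) - G t (p0 t) (h, W t h))) (at t within {a..b})"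
        if "t \<in> {a..b}" for t
        unfolding \<rho>_def r_def p0_def
        using W\<eta>[OF that, of h] ode[OF that \<open>\<xi> \<in> U\<close>] ode[OF that \<xi>0]
        by (auto intro!: has_vector_derivative_diff simp: p0_def)
      have bnd: "norm (g t (\<xi>, \<phi> t \<xi>) - g t (p0 t) - G t (p0 t) (h, W t h)) \<le> (BK + 1) * norm (\<rho> t) + \<epsilon> * (1 + BW) * norm h"
        if t: "t \<in> {a..b}" for t
      proof -
        have rd: "norm (r t) \<le> d0 / 3" using d2(2)[OF \<open>\<xi> \<in> U\<close> _ t] near by (simp add: r_def dist_norm d_def)
        have hd: "norm h < d0 / 3" using near by (simp add: h_def d_def)
        have pd: "(\<xi>, \<phi> t \<xi>) - p0 t = (h, r t)" by (simp add: p0_def h_def r_def)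
        have nhr: "norm (h, r t) \<le> norm h + norm (r t)" by (rule norm_Pair_le)
        have "norm (g t (\<xi>, \<phi> t \<xi>) - g t (p0 t) - G t (p0 t) ((\<xi>, \<phi> t \<xi>) - p0 t)) \<le> norm ((\<xi>, \<phi> t \<xi>) - p0 t) * \<epsilon>"
        proof (rule differentiable_bound_linearization[where S = "ball (p0 t) d0" and f' = "\<lambda>p. blinfun_apply (G t p)"])
          show "p0 t + s *\<^sub>R ((\<xi>, \<phi> t \<xi>) - p0 t) \<in> ball (p0 t) d0" if "s \<in> {0..1}" for s :: real
          proof -
            have "s * norm (h, r t) \<le> 1 * norm (h, r t)" using that by (intro mult_right_mono) auto
            then have "norm (s *\<^sub>R (h, r t)) < d0" using nhr rd hd that d0(1) by (simp del: scaleR_Pair)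
            then show ?thesis unfolding pd by (simp add: dist_norm norm_minus_commute del: scaleR_Pair)
          qed
          show "(g t has_derivative G t p) (at p within ball (p0 t) d0)" if "p \<in> ball (p0 t) d0" for p
            using d0(2)[OF t, of p] that by (simp add: dist_commute has_derivative_at_withinI[OF G[OF t]])
          show "onorm (blinfun_apply (G t p) - blinfun_apply (G t (p0 t))) \<le> \<epsilon>" if "p \<in> ball (p0 t) d0" for p
          proof -
            have "onorm (blinfun_apply (G t p) - blinfun_apply (G t (p0 t))) = norm (G t p - G t (p0 t))"
              by (simp add: norm_blinfun.rep_eq minus_blinfun.rep_eq fun_diff_def)
            also have "\<dots> \<le> \<epsilon>"
              using d0(2)[OF t, of p] that by (simp add: dist_norm norm_minus_commute)
            finally show ?thesis .
          qed
          show "p0 t \<in> ball (p0 t) d0" using d0(1) by simp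
        qed
        then have e: "norm (g t (\<xi>, \<phi> t \<xi>) - g t (p0 t) - G t (p0 t) (h, r t)) \<le> \<epsilon> * (norm h + norm (r t))"
          unfolding pd using mult_right_mono[OF nhr, of \<epsilon>] \<epsilon>(1)
          unfolding mult.commute[of \<epsilon>] by (meson less_imp_le order_trans)
        have r\<rho>: "norm (r t) \<le> norm (\<rho> t) + BW * norm h"
        proof -
          have "r t = \<rho> t + W t h" by (simp add: \<rho>_def)
          then have "norm (r t) \<le> norm (\<rho> t) + norm (W t h)" by (metis norm_triangle_ineq)
          also have "norm (W t h) \<le> BW * norm h"
            using norm_blinfun[of "W t" h] BW(2)[OF t] by (meson mult_right_mono norm_ge_zero order_trans)
          finally show ?thesis by simp
        qed
        have G\<rho>: "norm (G t (p0 t) (0, \<rho> t)) \<le> BK * norm (\<rho> t)"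
          using norm_blinfun[of "G t (p0 t)" "(0, \<rho> t)"] mult_right_mono[OF BK(2)[OF t], of "norm (\<rho> t)"] by simp
        have "g t (\<xi>, \<phi> t \<xi>) - g t (p0 t) - G t (p0 t) (h, W t h) =
           (g t (\<xi>, \<phi> t \<xi>) - g t (p0 t) - G t (p0 t) (h, r t)) + G t (p0 t) (0, \<rho> t)"
        proof -
          have "(0, \<rho> t) = (h, r t) - (h, W t h)" by (simp add: \<rho>_def)
          then show ?thesis by (simp only: blinfun.diff_right) simp
        qed
        then have "norm (g t (\<xi>, \<phi> t \<xi>) - g t (p0 t) - G t (p0 t) (h, W t h)) \<le>
            \<epsilon> * (norm h + norm (r t)) + BK * norm (\<rho> t)"
          using norm_triangle_le[OF add_mono[OF e G\<rho>]] by (simp only:)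
        also have "\<epsilon> * (norm h + norm (r t)) \<le> \<epsilon> * (norm h + (norm (\<rho> t) + BW * norm h))"
          using r\<rho> \<epsilon>(1) by (intro mult_left_mono) auto
        also have "\<dots> = \<epsilon> * norm (\<rho> t) + \<epsilon> * (1 + BW) * norm h" by (simp add: algebra_simps)
        also have "\<epsilon> * norm (\<rho> t) \<le> 1 * norm (\<rho> t)" using \<epsilon> by (intro mult_right_mono) auto
        finally show ?thesis by (simp add: algebra_simps)
      qed
      have "norm (\<rho> t) \<le> 2 * (norm (\<rho> t1) + (\<epsilon> * (1 + BW) * norm h) * (b - a)) * exp (2 * (BK + 1) * (b - a))"
        by (rule growth_estimate[OF t1 t _ _ \<rho>der bnd]) (use BK BW \<epsilon> in auto)
      also have "norm (\<rho> t1) \<le> \<epsilon> * norm h"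
        using d4(2)[of \<xi>] near by (simp add: \<rho>_def r_def h_def d_def)
      also have "2 * (\<epsilon> * norm h + (\<epsilon> * (1 + BW) * norm h) * (b - a)) * exp (2 * (BK + 1) * (b - a)) = C * \<epsilon> * norm h"
        by (simp add: C_def algebra_simps)
      finally show ?thesis by (simp add: \<rho>_def r_def h_def)
    qed
    ultimately show ?thesis by blast
  qed
  have der: "(\<phi> t has_derivative W t) (at \<xi>0)" if t: "t \<in> {a..b}" for t
    unfolding has_derivative_at_alt
  proof (intro conjI allI impI)
    show "bounded_linear (W t)" by (rule blinfun.bounded_linear_right)
    fix e :: real assume "0 < e"
    define \<epsilon> where "\<epsilon> = min 1 (e / C)"
    have "0 < \<epsilon>" "\<epsilon> \<le> 1" using \<open>0 < e\<close> \<open>0 < C\<close> by (auto simp: \<epsilon>_def)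
    from main[OF this] obtain d where d: "d > 0"
      "\<And>\<xi>. norm (\<xi> - \<xi>0) < d \<Longrightarrow> norm (\<phi> t \<xi> - \<phi> t \<xi>0 - W t (\<xi> - \<xi>0)) \<le> C * \<epsilon> * norm (\<xi> - \<xi>0)"
      using t by blast
    have "C * \<epsilon> \<le> e"
    proof -
      have "C * \<epsilon> \<le> C * (e / C)" using \<open>0 < C\<close> unfolding \<epsilon>_def by (intro mult_left_mono) auto
      then show ?thesis using \<open>0 < C\<close> by simp
    qed
    then show "\<exists>d>0. \<forall>y. norm (y - \<xi>0) < d \<longrightarrow> norm (\<phi> t y - \<phi> t \<xi>0 - W t (y - \<xi>0)) \<le> e * norm (y - \<xi>0)"
      using d by (meson mult_right_mono norm_ge_zero order_trans)
  qed
  have fW: "frechet_derivative (\<phi> t) (at \<xi>0) = W t" if "t \<in> {a..b}" for t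
    using frechet_derivative_at[OF der[OF that]] by simp
  show ?thesis
  proof (intro ballI conjI allI)
    fix t \<eta> assume t: "t \<in> {a..b}"
    show "\<phi> t differentiable (at \<xi>0)" using der[OF t] by (auto simp: differentiable_def)
    show "((\<lambda>t. frechet_derivative (\<phi> t) (at \<xi>0) \<eta>) has_vector_derivative
       G t (\<xi>0, \<phi> t \<xi>0) (\<eta>, frechet_derivative (\<phi> t) (at \<xi>0) \<eta>)) (at t within {a..b})"
      unfolding fW[OF t]
      by (rule has_vector_derivative_transform[OF t _ W\<eta>[OF t, unfolded p0_def]]) (simp add: fW)
  qed
qed

section \<open>Smooth dependence of solutions on parameters\<close>

lemma continuous_on_family_at:
  assumes "continuous_on (J \<times> U) (\<lambda>(t, \<xi>). f t \<xi>)" "continuous_on S p" "continuous_on S q"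
    and "\<And>s. s \<in> S \<Longrightarrow> p s \<in> J \<and> q s \<in> U"
  shows "continuous_on S (\<lambda>s. f (p s) (q s))"
proof -
  have "continuous_on S (\<lambda>s. (\<lambda>(t, \<xi>). f t \<xi>) (p s, q s))"
    by (rule continuous_on_compose2[OF assms(1) continuous_on_Pair[OF assms(2,3)]]) (use assms(4) in auto)
  then show ?thesis by simp
qed

text \<open>The difference of the solutions for two parameters satisfies the same linear equation with an
  inhomogeneity that is uniformly small when the parameters are close.\<close>

lemma linear_solutions_continuous:
  fixes u :: "real \<Rightarrow> 'p::euclidean_space \<Rightarrow> 'e::euclidean_space" and A :: "real \<Rightarrow> 'p \<Rightarrow> 'e \<Rightarrow>\<^sub>L 'e"
  assumes t1: "t1 \<in> {a..b}"
    and contA: "continuous_on ({a..b} \<times> U) (\<lambda>(t, \<xi>). A t \<xi>)"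
    and contc: "continuous_on ({a..b} \<times> U) (\<lambda>(t, \<xi>). c t \<xi>)"
    and init: "continuous_on U (u t1)"
    and ode: "\<And>t \<xi>. t \<in> {a..b} \<Longrightarrow> \<xi> \<in> U \<Longrightarrow> ((\<lambda>t. u t \<xi>) has_vector_derivative A t \<xi> (u t \<xi>) + c t \<xi>) (at t within {a..b})"
  shows "continuous_on ({a..b} \<times> U) (\<lambda>(t, \<xi>). u t \<xi>)"
proof (rule joint_continuityI)
  show "continuous_on {a..b} (\<lambda>t. u t \<xi>)" if "\<xi> \<in> U" for \<xi>
    by (rule continuous_on_vector_derivative[OF ode[OF _ that]])
  fix \<xi>0 and e :: real assume \<xi>0: "\<xi>0 \<in> U" and "0 < e"
  have "continuous_on {a..b} (\<lambda>t. A t \<xi>0)"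
    by (rule continuous_on_family_at[OF contA continuous_on_id continuous_on_const]) (use \<xi>0 in auto)
  from continuous_on_Icc_bound[OF this] obtain BA where BA: "0 < BA" "\<And>t. t \<in> {a..b} \<Longrightarrow> norm (A t \<xi>0) \<le> BA"
    by blast
  obtain BU where BU: "0 < BU" "\<And>t. t \<in> {a..b} \<Longrightarrow> norm (u t \<xi>0) \<le> BU"
    by (rule continuous_on_Icc_bound[OF continuous_on_vector_derivative[OF ode[OF _ \<xi>0]]]) blast+
  define E where "E = 2 * (1 + (BU + 1) * (b - a)) * exp (2 * (BA + 1) * (b - a))"
  have ab: "a \<le> b" using t1 by auto
  have "0 < E" unfolding E_def using ab BU(1) by (intro mult_pos_pos add_pos_nonneg) auto
  define \<epsilon> where "\<epsilon> = min 1 (e / E)"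
  have \<epsilon>: "0 < \<epsilon>" "\<epsilon> \<le> 1"
    using \<open>0 < e\<close> \<open>0 < E\<close> by (auto simp: \<epsilon>_def)
  have E\<epsilon>: "E * \<epsilon> \<le> e"
  proof -
    have "E * \<epsilon> \<le> E * (e / E)" using \<open>0 < E\<close> unfolding \<epsilon>_def by (intro mult_left_mono) auto
    then show ?thesis using \<open>0 < E\<close> by simp
  qed
  obtain d1 where d1: "d1 > 0" "\<And>\<xi> t. \<xi> \<in> U \<Longrightarrow> dist \<xi> \<xi>0 < d1 \<Longrightarrow> t \<in> {a..b} \<Longrightarrow> dist (A t \<xi>) (A t \<xi>0) \<le> \<epsilon>"
    using joint_continuityD[OF contA compact_Icc \<xi>0 \<epsilon>(1)] by blast
  obtain d2 where d2: "d2 > 0" "\<And>\<xi> t. \<xi> \<in> U \<Longrightarrow> dist \<xi> \<xi>0 < d2 \<Longrightarrow> t \<in> {a..b} \<Longrightarrow> dist (c t \<xi>) (c t \<xi>0) \<le> \<epsilon>"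
    using joint_continuityD[OF contc compact_Icc \<xi>0 \<epsilon>(1)] by blast
  obtain d3 where d3: "d3 > 0" "\<And>\<xi>. \<xi> \<in> U \<Longrightarrow> dist \<xi> \<xi>0 < d3 \<Longrightarrow> dist (u t1 \<xi>) (u t1 \<xi>0) < \<epsilon>"
    using init[unfolded continuous_on_iff, rule_format, OF \<xi>0 \<epsilon>(1)] by blast
  show "\<exists>d>0. \<forall>\<xi>\<in>U. dist \<xi> \<xi>0 < d \<longrightarrow> (\<forall>t\<in>{a..b}. dist (u t \<xi>) (u t \<xi>0) \<le> e)"
  proof (intro exI conjI ballI impI)
    show "0 < min d1 (min d2 d3)" using d1 d2 d3 by simp
    fix \<xi> t assume \<xi>: "\<xi> \<in> U" "dist \<xi> \<xi>0 < min d1 (min d2 d3)" and t: "t \<in> {a..b}"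
    define \<delta> where "\<delta> = (\<lambda>t. u t \<xi> - u t \<xi>0)"
    have der: "(\<delta> has_vector_derivative A t \<xi> (u t \<xi>) + c t \<xi> - (A t \<xi>0 (u t \<xi>0) + c t \<xi>0)) (at t within {a..b})"
      if "t \<in> {a..b}" for t
      unfolding \<delta>_def using that \<xi>(1) \<xi>0 by (intro has_vector_derivative_diff ode)
    have bnd: "norm (A t \<xi> (u t \<xi>) + c t \<xi> - (A t \<xi>0 (u t \<xi>0) + c t \<xi>0)) \<le> (BA + 1) * norm (\<delta> t) + \<epsilon> * (BU + 1)"
      if t: "t \<in> {a..b}" for t
    proof -
      have dA: "norm (A t \<xi> - A t \<xi>0) \<le> \<epsilon>" and dc: "norm (c t \<xi> - c t \<xi>0) \<le> \<epsilon>"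
        using d1(2)[OF \<xi>(1) _ t] d2(2)[OF \<xi>(1) _ t] \<xi>(2) by (auto simp: dist_norm)
      have "norm (A t \<xi>) \<le> norm (A t \<xi>0) + norm (A t \<xi> - A t \<xi>0)"
        by (metis add.commute diff_add_cancel norm_triangle_ineq)
      then have "norm (A t \<xi>) \<le> BA + 1" using BA(2)[OF t] dA \<epsilon>(2) by simp
      then have 1: "norm (A t \<xi> (\<delta> t)) \<le> (BA + 1) * norm (\<delta> t)"
        using norm_blinfun by (meson mult_right_mono norm_ge_zero order_trans)
      have 2: "norm ((A t \<xi> - A t \<xi>0) (u t \<xi>0)) \<le> \<epsilon> * BU"
        using norm_blinfun[of "A t \<xi> - A t \<xi>0" "u t \<xi>0"] mult_mono[OF dA BU(2)[OF t]] \<epsilon>(1) by force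
      have "A t \<xi> (u t \<xi>) + c t \<xi> - (A t \<xi>0 (u t \<xi>0) + c t \<xi>0) =
          A t \<xi> (\<delta> t) + ((A t \<xi> - A t \<xi>0) (u t \<xi>0) + (c t \<xi> - c t \<xi>0))"
        by (simp add: \<delta>_def blinfun.bilinear_simps)
      then have "norm (A t \<xi> (u t \<xi>) + c t \<xi> - (A t \<xi>0 (u t \<xi>0) + c t \<xi>0)) \<le> (BA + 1) * norm (\<delta> t) + (\<epsilon> * BU + \<epsilon>)"
        using norm_triangle_le[OF add_mono[OF 1 norm_triangle_le[OF add_mono[OF 2 dc]]]] by (simp only:)
      then show ?thesis by (simp add: algebra_simps)
    qed
    have "norm (\<delta> t) \<le> 2 * (norm (\<delta> t1) + \<epsilon> * (BU + 1) * (b - a)) * exp (2 * (BA + 1) * (b - a))"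
      by (rule growth_estimate[OF t1 t _ _ der bnd]) (use BA BU \<epsilon> in auto)
    also have "norm (\<delta> t1) \<le> \<epsilon>" using d3(2)[OF \<xi>(1)] \<xi>(2) by (simp add: \<delta>_def dist_norm)
    also have "2 * (\<epsilon> + \<epsilon> * (BU + 1) * (b - a)) * exp (2 * (BA + 1) * (b - a)) = E * \<epsilon>"
      by (simp add: E_def algebra_simps)
    also note E\<epsilon>
    finally show "dist (u t \<xi>) (u t \<xi>0) \<le> e" by (simp add: \<delta>_def dist_norm)
  qed
qed

text \<open>The derivative of a solution in the direction \<open>\<eta>\<close> satisfies an equation of the same linear
  kind with the same coefficient \<open>A\<close> and an inhomogeneity that is one order less regular. So the
  spaces stay the same in the induction over the order.\<close>

lemma Ck_family_linear_solutions:
  fixes u :: "real \<Rightarrow> 'p::euclidean_space \<Rightarrow> 'e::euclidean_space" and A :: "real \<Rightarrow> 'p \<Rightarrow> 'e \<Rightarrow>\<^sub>L 'e"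
  assumes t1: "t1 \<in> {a..b}" and U: "open U"
    and "Ck_family n {a..b} U A" "Ck_family n {a..b} U c" "Ck_on n U (u t1)"
    and "\<And>t \<xi>. t \<in> {a..b} \<Longrightarrow> \<xi> \<in> U \<Longrightarrow> ((\<lambda>t. u t \<xi>) has_vector_derivative A t \<xi> (u t \<xi>) + c t \<xi>) (at t within {a..b})"
  shows "Ck_family n {a..b} U u"
  using assms(3-)
proof (induction n arbitrary: u c)
  case 0
  show ?case unfolding Ck_family.simps
    by (rule linear_solutions_continuous[OF t1]) (use 0 in auto)
next
  case (Suc n)
  note ode = Suc.prems(4)
  have An: "Ck_family n {a..b} U A" and cn: "Ck_family n {a..b} U c"
    using Suc.prems Ck_family_Suc_imp by blast+
  have "Ck_on n U (u t1)"
    using Ck_family_imp_Ck_on[OF Ck_family_Suc_imp[OF Ck_on_imp_Ck_family[OF Suc.prems(3), of "{0}"]], of 0] by simp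
  then have un: "Ck_family n {a..b} U u"
    using Suc.IH[OF An cn] ode by blast
  define g where "g = (\<lambda>t p. A t (fst p) (snd p) + c t (fst p))"
  define dg where "dg = (\<lambda>t p q. A t (fst p) (snd q) + frechet_derivative (A t) (at (fst p)) (fst q) (snd p)
     + frechet_derivative (c t) (at (fst p)) (fst q))"
  define G where "G = (\<lambda>t p. Blinfun (dg t p))"
  have dg: "(g t has_derivative dg t p) (at p)" if t: "t \<in> {a..b}" and p: "p \<in> U \<times> UNIV" for t p
  proof -
    have f: "fst p \<in> U" using p by auto
    have fst: "(fst has_derivative fst) (at p)" for p :: "'p \<times> 'e"
      by (rule bounded_linear_imp_has_derivative[OF bounded_linear_fst])
    have snd: "(snd has_derivative snd) (at p)" for p :: "'p \<times> 'e"
      by (rule bounded_linear_imp_has_derivative[OF bounded_linear_snd])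
    have 1: "((\<lambda>p. A t (fst p)) has_derivative (\<lambda>q. frechet_derivative (A t) (at (fst p)) (fst q))) (at p)"
      using diff_chain_at[OF fst Ck_family_SucD[OF Suc.prems(1) t f]] by (simp add: o_def)
    have 2: "((\<lambda>p. c t (fst p)) has_derivative (\<lambda>q. frechet_derivative (c t) (at (fst p)) (fst q))) (at p)"
      using diff_chain_at[OF fst Ck_family_SucD[OF Suc.prems(2) t f]] by (simp add: o_def)
    show ?thesis unfolding g_def dg_def
      by (intro has_derivative_add 2 bounded_bilinear.FDERIV[OF bounded_bilinear_blinfun_apply 1 snd])
  qed
  have Gdg: "blinfun_apply (G t p) = dg t p" if "t \<in> {a..b}" "p \<in> U \<times> UNIV" for t p
    unfolding G_def using has_derivative_bounded_linear[OF dg[OF that]] by (rule bounded_linear_Blinfun_apply)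
  have contG: "continuous_on ({a..b} \<times> (U \<times> UNIV)) (\<lambda>(t, p). G t p)"
  proof (rule continuous_on_blinfun_componentwise)
    fix q :: "'p \<times> 'e"
    have *: "continuous_on ({a..b} \<times> (U \<times> (UNIV :: 'e set))) (\<lambda>s. f (fst s) (fst (snd s)))"
      if "continuous_on ({a..b} \<times> U) (\<lambda>(t, \<xi>). f t \<xi>)" for f :: "real \<Rightarrow> 'p \<Rightarrow> 'h::topological_space"
      by (rule continuous_on_family_at[OF that]) (auto intro!: continuous_intros)
    have "continuous_on ({a..b} \<times> (U \<times> UNIV)) (\<lambda>s. dg (fst s) (snd s) q)"
      unfolding dg_def using Suc.prems(1,2)
      by (intro continuous_intros blinfun.continuous_on *) (auto intro: Ck_family_continuous)
    then show "continuous_on ({a..b} \<times> (U \<times> UNIV)) (\<lambda>s. blinfun_apply (case s of (t, p) \<Rightarrow> G t p) q)"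
      by (rule continuous_on_eq) (auto simp: Gdg)
  qed
  have D: "u t differentiable (at \<xi>)"
    and Dode: "((\<lambda>t. frechet_derivative (u t) (at \<xi>) \<eta>) has_vector_derivative
       dg t (\<xi>, u t \<xi>) (\<eta>, frechet_derivative (u t) (at \<xi>) \<eta>)) (at t within {a..b})"
    if t: "t \<in> {a..b}" and \<xi>: "\<xi> \<in> U" for t \<xi> \<eta>
  proof -
    have "\<forall>t\<in>{a..b}. u t differentiable (at \<xi>) \<and>
      (\<forall>\<eta>. ((\<lambda>t. frechet_derivative (u t) (at \<xi>) \<eta>) has_vector_derivative
       G t (\<xi>, u t \<xi>) (\<eta>, frechet_derivative (u t) (at \<xi>) \<eta>)) (at t within {a..b}))"
    proof (rule differentiable_in_parameter[OF t1 U _ _ _ _ _ contG \<xi>])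
      show "open (U \<times> (UNIV :: 'e set))" using U by (simp add: open_Times)
      show "continuous_on ({a..b} \<times> U) (\<lambda>(t, \<xi>). u t \<xi>)" by (rule Ck_family_continuous[OF un])
      show "((\<lambda>t. u t \<xi>) has_vector_derivative g t (\<xi>, u t \<xi>)) (at t within {a..b})" if "t \<in> {a..b}" "\<xi> \<in> U" for t \<xi>
        using ode[OF that] by (simp add: g_def)
      show "(g t has_derivative G t p) (at p)" if "t \<in> {a..b}" "p \<in> U \<times> UNIV" for t p
        using dg[OF that] by (simp add: Gdg[OF that])
      show "u t1 differentiable (at \<xi>)" using Suc.prems(3) \<xi> by simp
    qed auto
    then show "u t differentiable (at \<xi>)"
      "((\<lambda>t. frechet_derivative (u t) (at \<xi>) \<eta>) has_vector_derivative
       dg t (\<xi>, u t \<xi>) (\<eta>, frechet_derivative (u t) (at \<xi>) \<eta>)) (at t within {a..b})"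
      using t \<xi> by (auto simp: Gdg)
  qed
  have "Ck_family n {a..b} U (\<lambda>t \<xi>. frechet_derivative (u t) (at \<xi>) \<eta>)" for \<eta>
  proof (rule Suc.IH[OF An, where c = "\<lambda>t \<xi>. frechet_derivative (A t) (at \<xi>) \<eta> (u t \<xi>) + frechet_derivative (c t) (at \<xi>) \<eta>"])
    show "Ck_family n {a..b} U (\<lambda>t \<xi>. frechet_derivative (A t) (at \<xi>) \<eta> (u t \<xi>) + frechet_derivative (c t) (at \<xi>) \<eta>)"
      using Suc.prems(1,2) un
      by (intro Ck_family_add[OF U] Ck_family_bilinear[OF U bounded_bilinear_blinfun_apply]) auto
    show "Ck_on n U (\<lambda>\<xi>. frechet_derivative (u t1) (at \<xi>) \<eta>)" using Suc.prems(3) by simp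
    show "((\<lambda>t. frechet_derivative (u t) (at \<xi>) \<eta>) has_vector_derivative
        A t \<xi> (frechet_derivative (u t) (at \<xi>) \<eta>) + (frechet_derivative (A t) (at \<xi>) \<eta> (u t \<xi>) + frechet_derivative (c t) (at \<xi>) \<eta>))
        (at t within {a..b})" if "t \<in> {a..b}" "\<xi> \<in> U" for t \<xi>
      using Dode[OF that, of \<eta>] by (simp add: dg_def add.assoc)
  qed
  then show ?case using D Ck_family_continuous[OF un] by simp
qed

text \<open>The derivatives of the family in its parameter solve the linear equation with coefficient
  \<open>Dv(t, \<phi>)\<close>, which is as regular as \<open>\<phi>\<close>; so every order of regularity yields the next one. The
  Lipschitz bound on \<open>K\<close> starts the induction with the continuity of \<open>\<phi>\<close>.\<close>

theorem smooth_dependence: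
  fixes \<phi> :: "real \<Rightarrow> 'p::euclidean_space \<Rightarrow> 'e::euclidean_space" and v :: "real \<Rightarrow> 'e \<Rightarrow> 'e"
  assumes t1: "t1 \<in> {a..b}" and U: "open U" and D: "open D" and v: "smooth_family {a..b} D v"
    and "0 < L" and lip: "\<And>t z z'. t \<in> {a..b} \<Longrightarrow> z \<in> K \<Longrightarrow> z' \<in> K \<Longrightarrow> norm (v t z - v t z') \<le> L * norm (z - z')"
    and "K \<subseteq> D" and \<phi>K: "\<And>t \<xi>. t \<in> {a..b} \<Longrightarrow> \<xi> \<in> U \<Longrightarrow> \<phi> t \<xi> \<in> K"
    and ode: "\<And>t \<xi>. t \<in> {a..b} \<Longrightarrow> \<xi> \<in> U \<Longrightarrow> ((\<lambda>t. \<phi> t \<xi>) has_vector_derivative v t (\<phi> t \<xi>)) (at t within {a..b})"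
    and init: "smooth_on U (\<phi> t1)"
  shows "smooth_family {a..b} U \<phi>"
    and "\<And>t \<xi> \<eta>. t \<in> {a..b} \<Longrightarrow> \<xi> \<in> U \<Longrightarrow> ((\<lambda>t. frechet_derivative (\<phi> t) (at \<xi>) \<eta>) has_vector_derivative
       frechet_derivative (v t) (at (\<phi> t \<xi>)) (frechet_derivative (\<phi> t) (at \<xi>) \<eta>)) (at t within {a..b})"
proof -
  have \<phi>D: "\<phi> t \<xi> \<in> D" if "t \<in> {a..b}" "\<xi> \<in> U" for t \<xi> using \<phi>K that \<open>K \<subseteq> D\<close> by blast
  have ab: "a \<le> b" using t1 by auto
  have vC: "Ck_family n {a..b} D v" for n using v by (simp add: smooth_family_def)
  have Dv: "(v t has_derivative frechet_derivative (v t) (at z)) (at z)" if "t \<in> {a..b}" "z \<in> D" for t z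
    using Ck_family_SucD[OF vC that] .
  have cont: "continuous_on ({a..b} \<times> U) (\<lambda>(t, \<xi>). \<phi> t \<xi>)"
  proof (rule joint_continuityI)
    show "continuous_on {a..b} (\<lambda>t. \<phi> t \<xi>)" if "\<xi> \<in> U" for \<xi>
      by (rule continuous_on_vector_derivative[OF ode[OF _ that]])
    fix \<xi>0 and e :: real assume \<xi>0: "\<xi>0 \<in> U" and "0 < e"
    define E where "E = 2 * exp (2 * L * (b - a))"
    have "0 < E" by (simp add: E_def)
    have "continuous_on U (\<phi> t1)" using init unfolding smooth_on_def using Ck_on.simps(1) by blast
    from this[unfolded continuous_on_iff, rule_format, OF \<xi>0 divide_pos_pos[OF \<open>0 < e\<close> \<open>0 < E\<close>]]
    obtain d where d: "d > 0" "\<And>\<xi>. \<xi> \<in> U \<Longrightarrow> dist \<xi> \<xi>0 < d \<Longrightarrow> dist (\<phi> t1 \<xi>) (\<phi> t1 \<xi>0) < e / E"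
      by blast
    have "dist (\<phi> t \<xi>) (\<phi> t \<xi>0) \<le> e" if "\<xi> \<in> U" "dist \<xi> \<xi>0 < d" "t \<in> {a..b}" for \<xi> t
    proof -
      have "norm (\<phi> t \<xi> - \<phi> t \<xi>0) \<le> 2 * (norm (\<phi> t1 \<xi> - \<phi> t1 \<xi>0) + 0 * (b - a)) * exp (2 * L * (b - a))"
      proof (rule growth_estimate[OF t1 that(3) \<open>0 < L\<close>])
        show "((\<lambda>t. \<phi> t \<xi> - \<phi> t \<xi>0) has_vector_derivative v t (\<phi> t \<xi>) - v t (\<phi> t \<xi>0)) (at t within {a..b})"
          if "t \<in> {a..b}" for t
          using \<open>\<xi> \<in> U\<close> \<xi>0 that by (intro has_vector_derivative_diff ode)
        show "norm (v t (\<phi> t \<xi>) - v t (\<phi> t \<xi>0)) \<le> L * norm (\<phi> t \<xi> - \<phi> t \<xi>0) + 0" if "t \<in> {a..b}" for t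
          using lip[OF that] \<phi>K[OF that] \<open>\<xi> \<in> U\<close> \<xi>0 by simp
      qed simp
      also have "\<dots> = E * norm (\<phi> t1 \<xi> - \<phi> t1 \<xi>0)" by (simp add: E_def)
      also have "\<dots> \<le> E * (e / E)"
        using d(2)[OF that(1,2)] \<open>0 < E\<close> by (intro mult_left_mono) (auto simp: dist_norm)
      finally show ?thesis using \<open>0 < E\<close> by (simp add: dist_norm)
    qed
    then show "\<exists>d>0. \<forall>\<xi>\<in>U. dist \<xi> \<xi>0 < d \<longrightarrow> (\<forall>t\<in>{a..b}. dist (\<phi> t \<xi>) (\<phi> t \<xi>0) \<le> e)"
      using d(1) by blast
  qed
  define A where "A = (\<lambda>t z. Blinfun (frechet_derivative (v t) (at z)))"
  have A: "blinfun_apply (A t z) = frechet_derivative (v t) (at z)" if "t \<in> {a..b}" "z \<in> D" for t z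
    unfolding A_def using has_derivative_bounded_linear[OF Dv[OF that]] by (rule bounded_linear_Blinfun_apply)
  have AC: "Ck_family n {a..b} D A" for n
  proof (rule Ck_family_blinfunI[OF D])
    fix i :: 'e
    have "Ck_family n {a..b} D (\<lambda>t z. frechet_derivative (v t) (at z) i)"
      using vC[of "Suc n"] by simp
    then show "Ck_family n {a..b} D (\<lambda>t z. A t z i)"
      using A by (subst Ck_family_cong[OF D]) auto
  qed
  have Dc: "open (U \<times> D)" using U D by (rule open_Times)
  define dg where "dg = (\<lambda>t (p :: 'p \<times> 'e). A t (snd p) o\<^sub>L snd_blinfun :: ('p \<times> 'e) \<Rightarrow>\<^sub>L 'e)"
  have main: "\<phi> t differentiable (at \<xi>)"
    and var: "((\<lambda>t. frechet_derivative (\<phi> t) (at \<xi>) \<eta>) has_vector_derivative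
       A t (\<phi> t \<xi>) (frechet_derivative (\<phi> t) (at \<xi>) \<eta>)) (at t within {a..b})"
    if t: "t \<in> {a..b}" and \<xi>: "\<xi> \<in> U" for t \<xi> \<eta>
  proof -
    have "\<forall>t\<in>{a..b}. \<phi> t differentiable (at \<xi>) \<and>
      (\<forall>\<eta>. ((\<lambda>t. frechet_derivative (\<phi> t) (at \<xi>) \<eta>) has_vector_derivative
       dg t (\<xi>, \<phi> t \<xi>) (\<eta>, frechet_derivative (\<phi> t) (at \<xi>) \<eta>)) (at t within {a..b}))"
    proof (rule differentiable_in_parameter[OF t1 U Dc cont _ _ _ _ \<xi>, where g = "\<lambda>t p. v t (snd p)"])
      show "((\<lambda>p. v t (snd p)) has_derivative dg t p) (at p)" if "t \<in> {a..b}" "p \<in> U \<times> D" for t p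
        using diff_chain_at[OF bounded_linear_imp_has_derivative[OF bounded_linear_snd] Dv[of t "snd p"]] that
        by (auto simp: dg_def o_def A blinfun_compose.rep_eq)
      show "continuous_on ({a..b} \<times> (U \<times> D)) (\<lambda>(t, p). dg t p)"
      proof -
        have "continuous_on ({a..b} \<times> (U \<times> D)) (\<lambda>s. A (fst s) (snd (snd s)))"
          by (rule continuous_on_family_at[OF Ck_family_continuous[OF AC[of 0]]]) (auto intro!: continuous_intros)
        then show ?thesis unfolding dg_def case_prod_unfold
          by (intro bounded_bilinear.continuous_on[OF bounded_bilinear_blinfun_compose] continuous_intros)
      qed
      show "\<phi> t1 differentiable (at \<xi>)"
        using init \<xi> unfolding smooth_on_def by (metis Ck_on.simps(2))
    qed (use \<phi>D ode in auto)
    then show "\<phi> t differentiable (at \<xi>)" "((\<lambda>t. frechet_derivative (\<phi> t) (at \<xi>) \<eta>) has_vector_derivative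
       A t (\<phi> t \<xi>) (frechet_derivative (\<phi> t) (at \<xi>) \<eta>)) (at t within {a..b})"
      using t by (auto simp: dg_def)
  qed
  show "((\<lambda>t. frechet_derivative (\<phi> t) (at \<xi>) \<eta>) has_vector_derivative
       frechet_derivative (v t) (at (\<phi> t \<xi>)) (frechet_derivative (\<phi> t) (at \<xi>) \<eta>)) (at t within {a..b})"
    if "t \<in> {a..b}" "\<xi> \<in> U" for t \<xi> \<eta>
    using var[OF that] A[OF that(1) \<phi>D[OF that]] by simp
  have "Ck_family n {a..b} U \<phi>" for n
  proof (induction n)
    case 0
    then show ?case using cont by simp
  next
    case (Suc n)
    have "Ck_family n {a..b} U (\<lambda>t \<xi>. frechet_derivative (\<phi> t) (at \<xi>) \<eta>)" for \<eta>
    proof (rule Ck_family_linear_solutions[OF t1 U, where A = "\<lambda>t \<xi>. A t (\<phi> t \<xi>)" and c = "\<lambda>_ _. 0"])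
      show "Ck_family n {a..b} U (\<lambda>t \<xi>. A t (\<phi> t \<xi>))"
        by (rule Ck_family_compose[OF U D AC Suc \<phi>D])
      show "Ck_on n U (\<lambda>\<xi>. frechet_derivative (\<phi> t1) (at \<xi>) \<eta>)"
        using init unfolding smooth_on_def by (metis Ck_on.simps(2))
    qed (use var U in \<open>auto intro: Ck_family_time_only\<close>)
    then show ?case using main cont by simp
  qed
  then show "smooth_family {a..b} U \<phi>" by (simp add: smooth_family_def)
qed

section \<open>Smooth functions on open sets\<close>

lemma smooth_on_subset: "smooth_on S f \<Longrightarrow> S' \<subseteq> S \<Longrightarrow> smooth_on S' f"
  unfolding smooth_on_iff_smooth_family smooth_family_def by (blast intro: Ck_family_subset)

lemma smooth_on_cong: "open S \<Longrightarrow> (\<And>x. x \<in> S \<Longrightarrow> f x = g x) \<Longrightarrow> smooth_on S f \<longleftrightarrow> smooth_on S g"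
  unfolding smooth_on_iff_smooth_family smooth_family_def using Ck_family_cong[of S "{0}" "\<lambda>_. f" "\<lambda>_. g"] by auto

lemma smooth_on_compose:
  assumes "open S" "open D" "smooth_on D g" "smooth_on S f" "\<And>x. x \<in> S \<Longrightarrow> f x \<in> D"
  shows "smooth_on S (g \<circ> f)"
  using Ck_family_compose[OF assms(1,2), of _ "{0}" "\<lambda>_. g" "\<lambda>_. f"] assms(3-)
  unfolding smooth_on_iff_smooth_family smooth_family_def by (simp add: o_def)

lemma smooth_on_local:
  assumes "\<And>x. x \<in> S \<Longrightarrow> \<exists>U. open U \<and> x \<in> U \<and> smooth_on (S \<inter> U) f"
  shows "smooth_on S f"
  unfolding smooth_on_iff_smooth_family smooth_family_def
proof
  fix n
  show "Ck_family n {0} S (\<lambda>t. f)"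
  proof (rule Ck_family_local)
    fix t x assume "t \<in> {0 :: real}" "x \<in> S"
    with assms[of x] obtain U where "open U" "x \<in> U" "smooth_on (S \<inter> U) f" by blast
    then show "\<exists>I U. open I \<and> t \<in> I \<and> open U \<and> x \<in> U \<and> Ck_family n ({0} \<inter> I) (S \<inter> U) (\<lambda>t. f)"
      unfolding smooth_on_iff_smooth_family smooth_family_def by (intro exI[of _ UNIV] exI[of _ U]) auto
  qed
qed

lemma smooth_on_has_derivative:
  "smooth_on S f \<Longrightarrow> x \<in> S \<Longrightarrow> (f has_derivative frechet_derivative f (at x)) (at x)"
  unfolding smooth_on_def frechet_derivative_works[symmetric] by (metis Ck_on.simps(2))

lemma smooth_on_frechet_derivative: "smooth_on S f \<Longrightarrow> smooth_on S (\<lambda>x. frechet_derivative f (at x) v)"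
  unfolding smooth_on_def by (metis Ck_on.simps(2))

lemma smooth_on_continuous: "smooth_on S f \<Longrightarrow> continuous_on S f"
  unfolding smooth_on_def by (metis Ck_on.simps(1))

text \<open>The mean value theorem is applied once in each of the two directions.\<close>

lemma second_difference_mean_value:
  fixes f :: "'e::euclidean_space \<Rightarrow> real"
  assumes "smooth_on S f" "0 < h" and S: "\<And>s t. s \<in> {0..h} \<Longrightarrow> t \<in> {0..h} \<Longrightarrow> x + s *\<^sub>R u + t *\<^sub>R v \<in> S"
  shows "\<exists>s\<in>{0..h}. \<exists>t\<in>{0..h}. f (x + h *\<^sub>R u + h *\<^sub>R v) - f (x + h *\<^sub>R u) - f (x + h *\<^sub>R v) + f x =
    h * (h * frechet_derivative (\<lambda>y. frechet_derivative f (at y) u) (at (x + s *\<^sub>R u + t *\<^sub>R v)) v)"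
proof -
  define fu where "fu = (\<lambda>y. frechet_derivative f (at y) u)"
  have line: "((\<lambda>s. x + s *\<^sub>R w + z) has_derivative (\<lambda>r. r *\<^sub>R w)) (at s)" for s :: real and w z
    by (auto intro!: derivative_eq_intros)
  have der: "((\<lambda>s. g (x + s *\<^sub>R w + z)) has_real_derivative frechet_derivative g (at (x + s *\<^sub>R w + z)) w) (at s)"
    if "smooth_on S g" "x + s *\<^sub>R w + z \<in> S" for g :: "'e \<Rightarrow> real" and w z s
  proof -
    have gd: "(g has_derivative frechet_derivative g (at (x + s *\<^sub>R w + z))) (at (x + s *\<^sub>R w + z))"
      by (rule smooth_on_has_derivative[OF that])
    from diff_chain_at[OF line gd]
    show ?thesis
      by (simp add: has_field_derivative_def o_def linear_scale[OF has_derivative_linear[OF gd]] mult_commute_abs)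
  qed
  have g1: "((\<lambda>s. f (x + s *\<^sub>R u + h *\<^sub>R v) - f (x + s *\<^sub>R u)) has_real_derivative
      fu (x + s *\<^sub>R u + h *\<^sub>R v) - fu (x + s *\<^sub>R u)) (at s)" if "0 \<le> s" "s \<le> h" for s
    unfolding fu_def
    using der[OF assms(1), of s u "h *\<^sub>R v"] der[OF assms(1), of s u 0] S[of s h] S[of s 0] that assms(2)
    by (auto intro: DERIV_diff)
  obtain s where s: "0 < s" "s < h" "f (x + h *\<^sub>R u + h *\<^sub>R v) - f (x + h *\<^sub>R u) - (f (x + 0 *\<^sub>R u + h *\<^sub>R v) - f (x + 0 *\<^sub>R u)) =
      (h - 0) * (fu (x + s *\<^sub>R u + h *\<^sub>R v) - fu (x + s *\<^sub>R u))"
    using MVT2[OF assms(2) g1] by blast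
  have fus: "smooth_on S fu" unfolding fu_def by (rule smooth_on_frechet_derivative[OF assms(1)])
  have g2: "((\<lambda>t. fu (x + s *\<^sub>R u + t *\<^sub>R v)) has_real_derivative frechet_derivative fu (at (x + s *\<^sub>R u + t *\<^sub>R v)) v) (at t)"
    if "0 \<le> t" "t \<le> h" for t
    using der[OF fus, of t v "s *\<^sub>R u"] S[of s t] s that by (simp add: add.commute add.left_commute)
  obtain t where t: "0 < t" "t < h" "fu (x + s *\<^sub>R u + h *\<^sub>R v) - fu (x + s *\<^sub>R u + 0 *\<^sub>R v) =
      (h - 0) * frechet_derivative fu (at (x + s *\<^sub>R u + t *\<^sub>R v)) v"
    using MVT2[OF assms(2) g2] by blast
  have "f (x + h *\<^sub>R u + h *\<^sub>R v) - f (x + h *\<^sub>R u) - f (x + h *\<^sub>R v) + f x =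
      h * (h * frechet_derivative fu (at (x + s *\<^sub>R u + t *\<^sub>R v)) v)"
    using s(3) t(3) by (simp add: algebra_simps)
  then show ?thesis using s t unfolding fu_def by (intro bexI[of _ s] bexI[of _ t]) auto
qed

text \<open>Symmetry of second derivatives: both orders of differentiation approximate the same
  second difference.\<close>

lemma second_derivative_symmetric:
  fixes f :: "'e::euclidean_space \<Rightarrow> real"
  assumes "open S" "smooth_on S f" "x \<in> S"
  shows "frechet_derivative (\<lambda>y. frechet_derivative f (at y) u) (at x) v =
    frechet_derivative (\<lambda>y. frechet_derivative f (at y) v) (at x) u"
proof -
  define p where "p = (\<lambda>y. frechet_derivative (\<lambda>y. frechet_derivative f (at y) u) (at y) v)"
  define q where "q = (\<lambda>y. frechet_derivative (\<lambda>y. frechet_derivative f (at y) v) (at y) u)"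
  have cp: "continuous_on S p" and cq: "continuous_on S q"
    unfolding p_def q_def by (intro smooth_on_continuous smooth_on_frechet_derivative assms)+
  have "\<bar>p x - q x\<bar> \<le> e" if "0 < e" for e
  proof -
    have e2: "0 < e / 2" using that by simp
    obtain d1 where d1: "d1 > 0" "\<And>y. y \<in> S \<Longrightarrow> dist y x < d1 \<Longrightarrow> dist (p y) (p x) < e / 2"
      using cp[unfolded continuous_on_iff, rule_format, OF assms(3) e2] by blast
    obtain d2 where d2: "d2 > 0" "\<And>y. y \<in> S \<Longrightarrow> dist y x < d2 \<Longrightarrow> dist (q y) (q x) < e / 2"
      using cq[unfolded continuous_on_iff, rule_format, OF assms(3) e2] by blast
    obtain d3 where d3: "d3 > 0" "\<And>y. dist y x < d3 \<Longrightarrow> y \<in> S"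
      using assms(1,3) unfolding open_dist by blast
    define d where "d = min d1 (min d2 d3)"
    define h where "h = d / (norm u + norm v + 1)"
    have d: "d > 0" using d1 d2 d3 by (simp add: d_def)
    then have h: "0 < h" by (simp add: h_def add_nonneg_pos)
    have near: "norm (s *\<^sub>R u + t *\<^sub>R v) < d" if "s \<in> {0..h}" "t \<in> {0..h}" for s t
    proof -
      have "norm (s *\<^sub>R u + t *\<^sub>R v) \<le> s * norm u + t * norm v"
        using norm_triangle_ineq[of "s *\<^sub>R u" "t *\<^sub>R v"] that by simp
      also have "\<dots> \<le> h * norm u + h * norm v" using that by (intro add_mono mult_right_mono) auto
      also have "\<dots> < h * (norm u + norm v + 1)" using h by (simp add: algebra_simps)
      also have "\<dots> = d" unfolding h_def using norm_ge_zero[of u] norm_ge_zero[of v]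
        by (simp add: add_nonneg_eq_0_iff)
      finally show ?thesis .
    qed
    have nd: "dist (x + s *\<^sub>R u + t *\<^sub>R v) x < d" if "s \<in> {0..h}" "t \<in> {0..h}" for s t
      using near[OF that] by (simp add: dist_norm add.assoc)
    have inS: "x + s *\<^sub>R u + t *\<^sub>R v \<in> S" if "s \<in> {0..h}" "t \<in> {0..h}" for s t
      using nd[OF that] d3(2) by (simp add: d_def)
    have inS': "x + s *\<^sub>R v + t *\<^sub>R u \<in> S" if "s \<in> {0..h}" "t \<in> {0..h}" for s t
      using inS[OF that(2,1)] by (simp add: add.commute add.left_commute)
    obtain s t where st: "s \<in> {0..h}" "t \<in> {0..h}"
      "f (x + h *\<^sub>R u + h *\<^sub>R v) - f (x + h *\<^sub>R u) - f (x + h *\<^sub>R v) + f x = h * (h * p (x + s *\<^sub>R u + t *\<^sub>R v))"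
      using second_difference_mean_value[OF assms(2) h inS] unfolding p_def by blast
    obtain s' t' where st': "s' \<in> {0..h}" "t' \<in> {0..h}"
      "f (x + h *\<^sub>R v + h *\<^sub>R u) - f (x + h *\<^sub>R v) - f (x + h *\<^sub>R u) + f x = h * (h * q (x + s' *\<^sub>R v + t' *\<^sub>R u))"
      using second_difference_mean_value[OF assms(2) h inS'] unfolding q_def by blast
    have sym: "x + h *\<^sub>R v + h *\<^sub>R u = x + h *\<^sub>R u + h *\<^sub>R v" by simp
    have "h * (h * p (x + s *\<^sub>R u + t *\<^sub>R v)) = h * (h * q (x + s' *\<^sub>R v + t' *\<^sub>R u))"
      using st(3) st'(3)[unfolded sym] by linarith
    then have eq: "p (x + s *\<^sub>R u + t *\<^sub>R v) = q (x + s' *\<^sub>R v + t' *\<^sub>R u)" using h by simp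
    have "x + s' *\<^sub>R v + t' *\<^sub>R u = x + t' *\<^sub>R u + s' *\<^sub>R v" by simp
    then have "dist (x + s' *\<^sub>R v + t' *\<^sub>R u) x < d"
      using nd[OF st'(2,1)] by metis
    then have "dist (q (x + s' *\<^sub>R v + t' *\<^sub>R u)) (q x) < e / 2"
      using d2(2)[OF inS'[OF st'(1,2)]] by (simp add: d_def)
    moreover have "dist (p (x + s *\<^sub>R u + t *\<^sub>R v)) (p x) < e / 2"
      using d1(2)[OF inS[OF st(1,2)]] nd[OF st(1,2)] by (simp add: d_def)
    ultimately show ?thesis using eq unfolding dist_real_def by arith
  qed
  then have "p x = q x" using field_le_epsilon[of "\<bar>p x - q x\<bar>" 0] by auto
  then show ?thesis by (simp add: p_def q_def)
qed

section \<open>Charts and differentials\<close>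

locale manifold =
  fixes A :: "('a::{t2_space, second_countable_topology}, 'd::finite) chart set"
  assumes manifold: "smooth_manifold A"
begin

lemma charts_atD: "c \<in> charts_at A p \<Longrightarrow> c \<in> A" "c \<in> charts_at A p \<Longrightarrow> p \<in> dom_of c"
  by (auto simp: charts_at_def)

lemma charts_atI: "c \<in> A \<Longrightarrow> p \<in> dom_of c \<Longrightarrow> c \<in> charts_at A p"
  by (auto simp: charts_at_def)

lemma ex_chart: "\<exists>c. c \<in> charts_at A p"
  using manifold unfolding smooth_manifold_def charts_at_def by blast

lemma chart_at: "chart_at A p \<in> charts_at A p"
  unfolding chart_at_def using ex_chart by (rule someI_ex)

lemma is_chart: "c \<in> A \<Longrightarrow> is_chart c"
  using manifold unfolding smooth_manifold_def by blast

lemma chart_homeomorphism: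
  "c \<in> A \<Longrightarrow> homeomorphism (dom_of c) (crd c ` dom_of c) (crd c) (crd_inv c)"
  using is_chart unfolding is_chart_def by blast

lemma open_dom: "c \<in> A \<Longrightarrow> open (dom_of c)" and open_img: "c \<in> A \<Longrightarrow> open (crd c ` dom_of c)"
  using is_chart unfolding is_chart_def by blast+

lemma crd_inv_crd [simp]: "c \<in> A \<Longrightarrow> p \<in> dom_of c \<Longrightarrow> crd_inv c (crd c p) = p"
  using chart_homeomorphism homeomorphism_apply1 by blast

lemma crd_crd_inv [simp]: "c \<in> A \<Longrightarrow> \<zeta> \<in> crd c ` dom_of c \<Longrightarrow> crd c (crd_inv c \<zeta>) = \<zeta>"
  using chart_homeomorphism homeomorphism_apply2 by blast

lemma crd_inv_in: "c \<in> A \<Longrightarrow> \<zeta> \<in> crd c ` dom_of c \<Longrightarrow> crd_inv c \<zeta> \<in> dom_of c"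
  by auto

lemma continuous_on_crd: "c \<in> A \<Longrightarrow> continuous_on (dom_of c) (crd c)"
  using chart_homeomorphism homeomorphism_cont1 by blast

lemma continuous_on_crd_inv: "c \<in> A \<Longrightarrow> continuous_on (crd c ` dom_of c) (crd_inv c)"
  using chart_homeomorphism homeomorphism_cont2 by blast

lemma crd_image_eq: "c \<in> A \<Longrightarrow> V \<subseteq> dom_of c \<Longrightarrow> crd c ` V = crd c ` dom_of c \<inter> crd_inv c -` V"
  by force

lemma open_crd_image: "c \<in> A \<Longrightarrow> open V \<Longrightarrow> V \<subseteq> dom_of c \<Longrightarrow> open (crd c ` V)"
  by (subst crd_image_eq) (auto intro: continuous_open_preimage continuous_on_crd_inv open_img)

lemma open_crd_preimage: "c \<in> A \<Longrightarrow> open W \<Longrightarrow> open (dom_of c \<inter> crd c -` W)"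
  by (rule continuous_open_preimage[OF continuous_on_crd open_dom])

lemma smooth_transition:
  "c \<in> A \<Longrightarrow> d \<in> A \<Longrightarrow> smooth_on (crd c ` (dom_of c \<inter> dom_of d)) (crd d \<circ> crd_inv c)"
  using manifold unfolding smooth_manifold_def by blast

text \<open>The matrix of the differential of \<open>F\<close> with the chart \<open>a\<close> around \<open>x\<close> in the source and the
  chart \<open>c\<close> around \<open>F x\<close> in the target.\<close>

definition has_dmap :: "('a, 'd) chart \<Rightarrow> ('a, 'd) chart \<Rightarrow> ('a \<Rightarrow> 'a) \<Rightarrow> 'a \<Rightarrow> real^'d^'d \<Rightarrow> bool" where
  "has_dmap a c F x M \<longleftrightarrow> ((crd c \<circ> F \<circ> crd_inv a) has_derivative (*v) M) (at (crd a x))"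

definition dmap :: "('a, 'd) chart \<Rightarrow> ('a, 'd) chart \<Rightarrow> ('a \<Rightarrow> 'a) \<Rightarrow> 'a \<Rightarrow> real^'d^'d" where
  "dmap a c F x = matrix (frechet_derivative (crd c \<circ> F \<circ> crd_inv a) (at (crd a x)))"

lemma has_dmap_imp_dmap: "has_dmap a c F x M \<Longrightarrow> dmap a c F x = M"
  unfolding has_dmap_def dmap_def
  by (metis frechet_derivative_at matrix_of_matrix_vector_mul)

lemma differentiable_imp_has_dmap:
  "(crd c \<circ> F \<circ> crd_inv a) differentiable (at (crd a x)) \<Longrightarrow> has_dmap a c F x (dmap a c F x)"
  unfolding has_dmap_def dmap_def frechet_derivative_works
  by (simp add: matrix_vector_mul has_derivative_bounded_linear bounded_linear.linear)

lemma has_dmap_compose: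
  assumes a: "a \<in> charts_at A x" and b: "b \<in> charts_at A (F x)" and "isCont F x"
    and F: "has_dmap a b F x M" and G: "has_dmap b c G (F x) N"
  shows "has_dmap a c (G \<circ> F) x (N ** M)"
proof -
  have a': "a \<in> A" "x \<in> dom_of a" and b': "b \<in> A" "F x \<in> dom_of b" using a b charts_atD by auto
  have "((crd c \<circ> G \<circ> crd_inv b) \<circ> (crd b \<circ> F \<circ> crd_inv a) has_derivative (*v) N \<circ> (*v) M) (at (crd a x))"
    using F G a' unfolding has_dmap_def by (intro diff_chain_at) auto
  moreover obtain U where U: "open U" "x \<in> U" "\<And>z. z \<in> U \<Longrightarrow> F z \<in> dom_of b"
    using assms(3) open_dom[OF b'(1)] b'(2) unfolding continuous_at_open by metis
  moreover have "open (crd a ` (U \<inter> dom_of a))" by (intro open_crd_image open_Int open_dom U a') auto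
  ultimately have "(crd c \<circ> (G \<circ> F) \<circ> crd_inv a has_derivative (*v) N \<circ> (*v) M) (at (crd a x))"
    by (elim has_derivative_transform_within_open) (use U a' b' in auto)
  then show ?thesis unfolding has_dmap_def by (simp add: o_def matrix_vector_mul_assoc)
qed

lemma jac_eq_dmap: "jac c d p = dmap c d id p"
  by (simp add: jac_def dmap_def)

lemma has_dmap_jac:
  assumes "c \<in> charts_at A p" "d \<in> charts_at A p"
  shows "has_dmap c d id p (jac c d p)"
  unfolding jac_eq_dmap
proof (rule differentiable_imp_has_dmap)
  have *: "c \<in> A" "d \<in> A" "p \<in> dom_of c" "p \<in> dom_of d" using assms charts_atD by auto
  show "(crd d \<circ> id \<circ> crd_inv c) differentiable (at (crd c p))"
    using smooth_on_has_derivative[OF smooth_transition[OF *(1,2)], of "crd c p"] *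
    by (auto simp: differentiable_def)
qed

lemma jac_mult:
  assumes "c \<in> charts_at A p" "d \<in> charts_at A p" "e \<in> charts_at A p"
  shows "jac d e p ** jac c d p = jac c e p"
  using has_dmap_imp_dmap[OF has_dmap_compose[OF assms(1) _ _ has_dmap_jac[OF assms(1,2)], of e id "jac d e p"]]
    has_dmap_jac[OF assms(2,3)] assms
  by (simp add: jac_eq_dmap[of c e])

lemma jac_self:
  assumes "c \<in> charts_at A p"
  shows "jac c c p = mat 1"
proof -
  have c: "c \<in> A" "p \<in> dom_of c" using assms charts_atD by auto
  have "((\<lambda>\<zeta>. \<zeta>) has_derivative (\<lambda>\<zeta>. \<zeta>)) (at (crd c p))" by simp
  then have "((crd c \<circ> id \<circ> crd_inv c) has_derivative (\<lambda>\<zeta>. \<zeta>)) (at (crd c p))"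
    by (rule has_derivative_transform_within_open[OF _ open_img[OF c(1)]]) (use c in auto)
  then have "has_dmap c c id p (mat 1)" unfolding has_dmap_def by (simp add: matrix_vector_mul_lid[abs_def])
  then show ?thesis by (simp add: jac_eq_dmap has_dmap_imp_dmap)
qed

lemma tangent_ofI:
  assumes "c \<in> charts_at A p"
  shows "tangent_of A p c \<xi> \<in> tangent_space A p" "tangent_of A p c \<xi> c = \<xi>"
  using assms by (auto simp: tangent_space_def tangent_of_def matrix_vector_mul_assoc jac_mult jac_self)

text \<open>The set \<open>U\<close> is so small that \<open>F\<close> can be written in a single pair of charts on it.\<close>

definition smooth_rep :: "('a, 'd) chart \<Rightarrow> ('a, 'd) chart \<Rightarrow> ('a \<Rightarrow> 'a) \<Rightarrow> 'a set \<Rightarrow> bool" where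
  "smooth_rep a c F U \<longleftrightarrow> open U \<and> U \<subseteq> dom_of a \<and> F ` U \<subseteq> dom_of c \<and> smooth_on (crd a ` U) (crd c \<circ> F \<circ> crd_inv a)"

definition smooth_at :: "('a \<Rightarrow> 'a) \<Rightarrow> 'a \<Rightarrow> bool" where
  "smooth_at F x \<longleftrightarrow> (\<exists>a\<in>charts_at A x. \<exists>c\<in>charts_at A (F x). \<exists>U. x \<in> U \<and> smooth_rep a c F U)"

lemma smooth_rep_continuous:
  assumes "a \<in> A" "c \<in> A" "smooth_rep a c F U"
  shows "continuous_on U F"
proof -
  have U: "open U" "U \<subseteq> dom_of a" "F ` U \<subseteq> dom_of c" "smooth_on (crd a ` U) (crd c \<circ> F \<circ> crd_inv a)"
    using assms(3) by (auto simp: smooth_rep_def)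
  have "continuous_on U (\<lambda>x. (crd c \<circ> F \<circ> crd_inv a) (crd a x))"
    by (rule continuous_on_compose2[OF smooth_on_continuous[OF U(4)]
        continuous_on_subset[OF continuous_on_crd[OF assms(1)] U(2)]]) auto
  then have "continuous_on U (\<lambda>x. crd_inv c ((crd c \<circ> F \<circ> crd_inv a) (crd a x)))"
    by (rule continuous_on_compose2[OF continuous_on_crd_inv[OF assms(2)]])
      (use U assms in \<open>auto simp: subset_iff\<close>)
  then show ?thesis
    by (rule continuous_on_eq) (use U assms in \<open>auto simp: subset_iff\<close>)
qed

lemma smooth_rep_subset:
  "smooth_rep a c F U \<Longrightarrow> open V \<Longrightarrow> V \<subseteq> U \<Longrightarrow> smooth_rep a c F V"
  unfolding smooth_rep_def by (meson image_mono order_trans smooth_on_subset)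

lemma smooth_rep_change_charts:
  assumes "a \<in> A" "c \<in> A" "a' \<in> A" "c' \<in> A" "smooth_rep a c F U"
  shows "smooth_rep a' c' F (U \<inter> dom_of a' \<inter> F -` dom_of c')"
proof -
  define V where "V = U \<inter> dom_of a' \<inter> F -` dom_of c'"
  have U: "open U" "U \<subseteq> dom_of a" "F ` U \<subseteq> dom_of c" "smooth_on (crd a ` U) (crd c \<circ> F \<circ> crd_inv a)"
    using assms(5) by (auto simp: smooth_rep_def)
  have "V = (U \<inter> F -` dom_of c') \<inter> dom_of a'" unfolding V_def by auto
  then have "open V"
    using continuous_open_preimage[OF smooth_rep_continuous[OF assms(1,2,5)] U(1) open_dom[OF assms(4)]]
      open_dom[OF assms(3)] by auto
  have VU: "V \<subseteq> U" "V \<subseteq> dom_of a" "V \<subseteq> dom_of a'" "F ` V \<subseteq> dom_of c \<inter> dom_of c'"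
    using U by (auto simp: V_def)
  have oV: "open (crd a' ` V)" "open (crd a ` V)" using open_crd_image \<open>open V\<close> VU assms by auto
  have 1: "smooth_on (crd a' ` V) (crd a \<circ> crd_inv a')"
    by (rule smooth_on_subset[OF smooth_transition[OF assms(3,1)]]) (use VU in auto)
  have 2: "smooth_on (crd a ` V) (crd c \<circ> F \<circ> crd_inv a)"
    by (rule smooth_on_subset[OF U(4)]) (use VU in auto)
  have 3: "smooth_on (crd c ` (dom_of c \<inter> dom_of c')) (crd c' \<circ> crd_inv c)"
    by (rule smooth_transition) fact+
  have o3: "open (crd c ` (dom_of c \<inter> dom_of c'))" by (intro open_crd_image open_Int open_dom assms) auto
  have 4: "smooth_on (crd a' ` V) ((crd c \<circ> F \<circ> crd_inv a) \<circ> (crd a \<circ> crd_inv a'))"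
    by (rule smooth_on_compose[OF oV 2 1]) (use VU assms in \<open>auto simp: subset_iff\<close>)
  have "smooth_on (crd a' ` V) ((crd c' \<circ> crd_inv c) \<circ> ((crd c \<circ> F \<circ> crd_inv a) \<circ> (crd a \<circ> crd_inv a')))"
    by (rule smooth_on_compose[OF oV(1) o3 3 4]) (use VU assms in \<open>auto simp: subset_iff\<close>)
  then have "smooth_on (crd a' ` V) (crd c' \<circ> F \<circ> crd_inv a')"
    by (subst smooth_on_cong[OF oV(1)]) (use VU assms in \<open>auto simp: subset_iff\<close>)
  then show ?thesis using \<open>open V\<close> VU unfolding smooth_rep_def V_def by auto
qed

lemma smooth_at_rep:
  assumes "smooth_at F x" "a \<in> charts_at A x" "c \<in> charts_at A (F x)"
  obtains U where "x \<in> U" "smooth_rep a c F U"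
proof -
  obtain a' c' U where *: "a' \<in> charts_at A x" "c' \<in> charts_at A (F x)" "x \<in> U" "smooth_rep a' c' F U"
    using assms(1) unfolding smooth_at_def by blast
  show thesis
    by (rule that[OF _ smooth_rep_change_charts[OF _ _ _ _ *(4), of a c]])
      (use * assms charts_atD in blast)+
qed

lemma smooth_at_continuous:
  assumes "smooth_at F x"
  shows "isCont F x"
proof -
  obtain a c U where *: "a \<in> charts_at A x" "c \<in> charts_at A (F x)" "x \<in> U" "smooth_rep a c F U"
    using assms(1) unfolding smooth_at_def by blast
  then have "continuous_on U F" "open U"
    using smooth_rep_continuous[OF charts_atD(1) charts_atD(1), of a x c "F x" F U] by (auto simp: smooth_rep_def)
  then show ?thesis using * by (simp add: continuous_on_eq_continuous_at)
qed

lemma smooth_at_has_dmap: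
  assumes "smooth_at F x" "a \<in> charts_at A x" "c \<in> charts_at A (F x)"
  shows "has_dmap a c F x (dmap a c F x)"
proof (rule differentiable_imp_has_dmap)
  obtain U where "x \<in> U" "smooth_rep a c F U" using smooth_at_rep[OF assms] by blast
  then show "(crd c \<circ> F \<circ> crd_inv a) differentiable (at (crd a x))"
    using smooth_on_has_derivative[of "crd a ` U" _ "crd a x"] unfolding smooth_rep_def differentiable_def by blast
qed

lemma smooth_at_imp_smooth_map:
  assumes "\<And>x. smooth_at F x"
  shows "smooth_map A F"
  unfolding smooth_map_def
proof (intro conjI ballI)
  show "continuous_on UNIV F" using smooth_at_continuous[OF assms] by (simp add: continuous_at_imp_continuous_on)
  fix c d assume cd: "c \<in> A" "d \<in> A"
  show "smooth_on (crd c ` (dom_of c \<inter> F -` dom_of d)) (crd d \<circ> F \<circ> crd_inv c)"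
  proof (rule smooth_on_local)
    fix \<zeta> assume "\<zeta> \<in> crd c ` (dom_of c \<inter> F -` dom_of d)"
    then obtain x where x: "\<zeta> = crd c x" "x \<in> dom_of c" "F x \<in> dom_of d" by auto
    obtain U where U: "x \<in> U" "smooth_rep c d F U"
      using smooth_at_rep[OF assms, of c x d] x cd charts_atI by metis
    show "\<exists>U. open U \<and> \<zeta> \<in> U \<and> smooth_on (crd c ` (dom_of c \<inter> F -` dom_of d) \<inter> U) (crd d \<circ> F \<circ> crd_inv c)"
      by (rule exI[of _ "crd c ` U"])
        (use U x cd open_crd_image in \<open>auto simp: smooth_rep_def intro: smooth_on_subset\<close>)
  qed
qed

end

section \<open>Flows on manifolds\<close>

text \<open>At an end point of \<open>T\<close> the compact neighbourhood is one-sided.\<close>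

lemma interval_neighbourhood:
  fixes T :: "real set"
  assumes "is_interval T" "t0 \<in> T" "0 < e"
  obtains \<alpha> \<beta> I where "t0 \<in> {\<alpha>..\<beta>}" "{\<alpha>..\<beta>} \<subseteq> T" "\<beta> - \<alpha> < e" "open I" "t0 \<in> I" "T \<inter> I \<subseteq> {\<alpha>..\<beta>}"
proof -
  have "\<exists>\<beta> h. \<beta> \<in> T \<and> t0 \<le> \<beta> \<and> \<beta> \<le> t0 + e / 4 \<and> t0 < h \<and> (\<forall>t\<in>T. t < h \<longrightarrow> t \<le> \<beta>)"
  proof (cases "\<exists>t\<in>T. t0 < t")
    case True
    then obtain t where t: "t \<in> T" "t0 < t" by blast
    have "min t (t0 + e / 4) \<in> T"
      by (rule mem_is_interval_1_I[OF assms(1,2) t(1)]) (use t assms(3) in auto)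
    then show ?thesis using t assms(3)
      by (intro exI[of _ "min t (t0 + e / 4)"]) auto
  next
    case False
    then show ?thesis using assms(2,3) by (intro exI[of _ t0] exI[of _ "t0 + 1"]) force
  qed
  then obtain \<beta> h where \<beta>: "\<beta> \<in> T" "t0 \<le> \<beta>" "\<beta> \<le> t0 + e / 4" "t0 < h" "\<And>t. t \<in> T \<Longrightarrow> t < h \<Longrightarrow> t \<le> \<beta>"
    by blast
  have "\<exists>\<alpha> l. \<alpha> \<in> T \<and> \<alpha> \<le> t0 \<and> t0 - e / 4 \<le> \<alpha> \<and> l < t0 \<and> (\<forall>t\<in>T. l < t \<longrightarrow> \<alpha> \<le> t)"
  proof (cases "\<exists>t\<in>T. t < t0")
    case True
    then obtain t where t: "t \<in> T" "t < t0" by blast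
    have "max t (t0 - e / 4) \<in> T"
      by (rule mem_is_interval_1_I[OF assms(1) t(1) assms(2)]) (use t assms(3) in auto)
    then show ?thesis using t assms(3)
      by (intro exI[of _ "max t (t0 - e / 4)"]) auto
  next
    case False
    then show ?thesis using assms(2,3) by (intro exI[of _ t0] exI[of _ "t0 - 1"]) force
  qed
  then obtain \<alpha> l where \<alpha>: "\<alpha> \<in> T" "\<alpha> \<le> t0" "t0 - e / 4 \<le> \<alpha>" "l < t0" "\<And>t. t \<in> T \<Longrightarrow> l < t \<Longrightarrow> \<alpha> \<le> t"
    by blast
  show thesis
  proof (rule that[of \<alpha> \<beta> "{l<..<h}"])
    show "{\<alpha>..\<beta>} \<subseteq> T" using mem_is_interval_1_I[OF assms(1) \<alpha>(1) \<beta>(1)] by auto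
  qed (use \<alpha> \<beta> assms(3) in auto)
qed

lemma smooth_family_bounds:
  fixes f :: "real \<Rightarrow> 'e::euclidean_space \<Rightarrow> 'f::real_normed_vector"
  assumes f: "smooth_family {\<alpha>..\<beta>} S f" and "open S" "compact K" "K \<subseteq> S"
  obtains M L where "0 < M" "0 < L" "\<And>t z. t \<in> {\<alpha>..\<beta>} \<Longrightarrow> z \<in> K \<Longrightarrow> norm (f t z) \<le> M"
    "\<And>t z x. t \<in> {\<alpha>..\<beta>} \<Longrightarrow> z \<in> K \<Longrightarrow> norm (frechet_derivative (f t) (at z) x) \<le> L * norm x"
proof -
  have bd: "\<exists>B>0. \<forall>t\<in>{\<alpha>..\<beta>}. \<forall>z\<in>K. norm (g t z) \<le> B" if "smooth_family {\<alpha>..\<beta>} S g" for g :: "real \<Rightarrow> 'e \<Rightarrow> 'f"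
  proof -
    have "continuous_on ({\<alpha>..\<beta>} \<times> K) (\<lambda>(t, z). g t z)"
      using that assms(4) unfolding smooth_family_def
      by (intro continuous_on_subset[OF Ck_family_continuous[of 0 "{\<alpha>..\<beta>}" S]]) auto
    then have "bounded ((\<lambda>(t, z). g t z) ` ({\<alpha>..\<beta>} \<times> K))"
      using assms(3) by (intro compact_imp_bounded compact_continuous_image compact_Times) auto
    then show ?thesis unfolding bounded_pos by auto
  qed
  obtain M where M: "M > 0" "\<And>t z. t \<in> {\<alpha>..\<beta>} \<Longrightarrow> z \<in> K \<Longrightarrow> norm (f t z) \<le> M"
    using bd[OF f] by blast
  have "\<exists>B. B > 0 \<and> (\<forall>t\<in>{\<alpha>..\<beta>}. \<forall>z\<in>K. norm (frechet_derivative (f t) (at z) i) \<le> B)" for i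
    using bd[OF smooth_family_derivative[OF f]] by blast
  then obtain B where B: "\<And>i. B i > 0" "\<And>i t z. t \<in> {\<alpha>..\<beta>} \<Longrightarrow> z \<in> K \<Longrightarrow> norm (frechet_derivative (f t) (at z) i) \<le> B i"
    by metis
  define L where "L = (\<Sum>i\<in>Basis. B i)"
  have "L > 0" unfolding L_def by (intro sum_pos B) auto
  moreover have "norm (frechet_derivative (f t) (at z) x) \<le> L * norm x" if "t \<in> {\<alpha>..\<beta>}" "z \<in> K" for t z x
  proof -
    have bl: "bounded_linear (frechet_derivative (f t) (at z))"
      using f that assms(4) Ck_family_SucD[of 0 "{\<alpha>..\<beta>}" S f t z] unfolding smooth_family_def
      by (intro has_derivative_bounded_linear[of "f t" _ "at z"]) auto
    have "onorm (frechet_derivative (f t) (at z)) \<le> (\<Sum>i\<in>Basis. norm (frechet_derivative (f t) (at z) i))"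
      by (rule onorm_componentwise[OF bl])
    also have "\<dots> \<le> L" unfolding L_def by (intro sum_mono B that)
    finally show ?thesis using onorm[OF bl, of x] by (meson mult_right_mono norm_ge_zero order_trans)
  qed
  ultimately show thesis using that M by blast
qed

lemma smooth_family_lipschitz:
  fixes f :: "real \<Rightarrow> 'e::euclidean_space \<Rightarrow> 'f::real_normed_vector"
  assumes f: "smooth_family J S f" and "convex K" "K \<subseteq> S" "t \<in> J" "z \<in> K" "z' \<in> K"
    and "\<And>z x. z \<in> K \<Longrightarrow> norm (frechet_derivative (f t) (at z) x) \<le> L * norm x"
  shows "norm (f t z - f t z') \<le> L * norm (z - z')"
proof (rule differentiable_bound[OF assms(2) _ _ assms(5,6)])
  fix y assume y: "y \<in> K"
  have "(f t has_derivative frechet_derivative (f t) (at y)) (at y)"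
    using f assms(3,4) y Ck_family_SucD[of 0 J S f t y] unfolding smooth_family_def by blast
  then show "(f t has_derivative frechet_derivative (f t) (at y)) (at y within K)"
    by (rule has_derivative_at_withinI)
  show "onorm (frechet_derivative (f t) (at y)) \<le> L"
    by (rule onorm_le[OF assms(7)[OF y]])
qed

lemma at_within_interval_neighbourhood:
  fixes T :: "real set"
  assumes "{\<alpha>..\<beta>} \<subseteq> T" "open I" "t \<in> I" "T \<inter> I \<subseteq> {\<alpha>..\<beta>}"
  shows "at t within T = at t within {\<alpha>..\<beta>}"
proof -
  have "T \<inter> I = {\<alpha>..\<beta>} \<inter> I" using assms(1,4) by blast
  then show ?thesis using at_within_nhd[OF assms(3,2), of T "{\<alpha>..\<beta>}"] by simp
qed

text \<open>Connectedness of \<open>T\<close>, in the form in which statements proved in one chart spread along a trajectory.\<close>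

lemma interval_induction:
  fixes T :: "real set"
  assumes T: "is_interval T" and "t1 \<in> T" "P t1" "t \<in> T"
    and step: "\<And>t0. t0 \<in> T \<Longrightarrow> \<exists>I. open I \<and> t0 \<in> I \<and> (\<forall>x\<in>T \<inter> I. \<forall>y\<in>T \<inter> I. P x \<longrightarrow> P y)"
  shows "P t"
proof (rule connected_induction_simple[where S = T and a = t1 and P = P])
  show "connected T" using T is_interval_connected_1 by blast
  fix t0 assume t0: "t0 \<in> T"
  from step[OF this] obtain I where "open I" "t0 \<in> I" "\<forall>x\<in>T \<inter> I. \<forall>y\<in>T \<inter> I. P x \<longrightarrow> P y" by blast
  then show "\<exists>N. openin (top_of_set T) N \<and> t0 \<in> N \<and> (\<forall>x\<in>N. \<forall>y\<in>N. P x \<longrightarrow> P y)"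
    using t0 openin_open_Int[of I T] by (intro exI[of _ "T \<inter> I"]) simp
qed (use assms in auto)

context manifold
begin

definition fld :: "(real \<Rightarrow> 'a \<Rightarrow> ('a, 'd) tangent) \<Rightarrow> ('a, 'd) chart \<Rightarrow> real \<Rightarrow> real^'d \<Rightarrow> real^'d" where
  "fld v c t \<zeta> = v t (crd_inv c \<zeta>) c"

definition smooth_field :: "real set \<Rightarrow> (real \<Rightarrow> 'a \<Rightarrow> ('a, 'd) tangent) \<Rightarrow> bool" where
  "smooth_field T v \<longleftrightarrow> (\<forall>c\<in>A. smooth_family T (crd c ` dom_of c) (fld v c))"

lemma smooth_fieldD:
  assumes "smooth_field T v" "c \<in> A" "J \<subseteq> T"
  shows "smooth_family J (crd c ` dom_of c) (fld v c)"
proof -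
  have "smooth_family T (crd c ` dom_of c) (fld v c)" using assms(1,2) by (simp add: smooth_field_def)
  then show ?thesis unfolding smooth_family_def using Ck_family_subset[OF _ assms(3) order_refl] by metis
qed

lemma solvesD:
  assumes "solves A T v \<gamma>" "t \<in> T" "c \<in> A" "\<gamma> t \<in> dom_of c"
  shows "((\<lambda>s. crd c (\<gamma> s)) has_vector_derivative fld v c t (crd c (\<gamma> t))) (at t within T)"
  using assms charts_atI[OF assms(3,4)] unfolding solves_def by (simp add: fld_def)

lemma solves_continuous: "solves A T v \<gamma> \<Longrightarrow> continuous_on T \<gamma>"
  by (simp add: solves_def)

lemma continuous_on_near:
  assumes "continuous_on T \<gamma>" "t0 \<in> T" "open W" "\<gamma> t0 \<in> W"
  obtains I where "open I" "t0 \<in> I" "\<And>t. t \<in> T \<inter> I \<Longrightarrow> \<gamma> t \<in> W"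
  using assms(1)[unfolded continuous_on_topological, rule_format, OF assms(2,3,4)] by blast

text \<open>While the solution is in the ball of radius \<open>2 \<rho>\<close> it travels less than \<open>\<rho>\<close>, so it stays away from the
  boundary of that ball; hence the times up to which it has stayed inside form an open and closed set.\<close>

lemma solution_stays:
  assumes c: "c \<in> A" and sol: "solves A T v \<gamma>" and JT: "{\<alpha>..\<beta>} \<subseteq> T" and t1: "t1 \<in> {\<alpha>..\<beta>}"
    and \<rho>: "cball z0 (2 * \<rho>) \<subseteq> crd c ` dom_of c"
    and M: "\<And>t \<zeta>. t \<in> {\<alpha>..\<beta>} \<Longrightarrow> \<zeta> \<in> cball z0 (2 * \<rho>) \<Longrightarrow> norm (fld v c t \<zeta>) \<le> M" "0 < M" "M * (\<beta> - \<alpha>) < \<rho>"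
    and start: "\<gamma> t1 \<in> dom_of c" "dist z0 (crd c (\<gamma> t1)) < \<rho>" and t: "t \<in> {\<alpha>..\<beta>}"
  shows "\<gamma> t \<in> dom_of c \<and> crd c (\<gamma> t) \<in> cball z0 (2 * \<rho>)"
proof -
  define P where "P = (\<lambda>t. \<forall>s\<in>closed_segment t1 t. \<gamma> s \<in> dom_of c \<and> crd c (\<gamma> s) \<in> cball z0 (2 * \<rho>))"
  \<comment> \<open>The radius that the travelled distance allows to reach.\<close>
  define \<rho>' where "\<rho>' = dist z0 (crd c (\<gamma> t1)) + M * (\<beta> - \<alpha>)"
  have \<rho>': "\<rho>' < 2 * \<rho>" using M(3) start(2) by (simp add: \<rho>'_def)
  have cont: "continuous_on {\<alpha>..\<beta>} \<gamma>" using solves_continuous[OF sol] JT continuous_on_subset by blast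
  have seg: "closed_segment t1 t \<subseteq> {\<alpha>..\<beta>}" if "t \<in> {\<alpha>..\<beta>}" for t
    using t1 that by (auto simp: closed_segment_eq_real_ivl)
  have speed: "crd c (\<gamma> t) \<in> cball z0 \<rho>'" if "P t" "t \<in> {\<alpha>..\<beta>}" for t
  proof -
    have "norm (crd c (\<gamma> t) - crd c (\<gamma> t1)) \<le> M * norm (t - t1)"
    proof (rule differentiable_bound[where S = "closed_segment t1 t"])
      fix s assume s: "s \<in> closed_segment t1 t"
      then have *: "s \<in> {\<alpha>..\<beta>}" "\<gamma> s \<in> dom_of c" "crd c (\<gamma> s) \<in> cball z0 (2 * \<rho>)"
        using seg[OF that(2)] that(1) by (auto simp: P_def)
      have "((\<lambda>s. crd c (\<gamma> s)) has_vector_derivative fld v c s (crd c (\<gamma> s))) (at s within closed_segment t1 t)"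
        by (rule has_vector_derivative_within_subset[OF solvesD[OF sol _ c]]) (use * seg[OF that(2)] JT in auto)
      then show "((\<lambda>s. crd c (\<gamma> s)) has_derivative (\<lambda>r. r *\<^sub>R fld v c s (crd c (\<gamma> s)))) (at s within closed_segment t1 t)"
        by (simp add: has_vector_derivative_def)
      have "norm (r *\<^sub>R fld v c s (crd c (\<gamma> s))) \<le> M * norm r" for r :: real
        using mult_left_mono[OF M(1)[OF *(1,3)], of "\<bar>r\<bar>"] by (simp add: mult.commute)
      then show "onorm (\<lambda>r. r *\<^sub>R fld v c s (crd c (\<gamma> s))) \<le> M" by (rule onorm_le)
    qed auto
    also have "\<dots> \<le> M * (\<beta> - \<alpha>)" using that(2) t1 M(2) by (intro mult_left_mono) auto
    finally show ?thesis
      using dist_triangle[of z0 "crd c (\<gamma> t)" "crd c (\<gamma> t1)"] by (simp add: \<rho>'_def dist_norm norm_minus_commute)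
  qed
  have G: "crd_inv c ` cball z0 \<rho>' = {x \<in> dom_of c. crd c x \<in> cball z0 \<rho>'}"
  proof -
    have img: "cball z0 \<rho>' \<subseteq> crd c ` dom_of c"
      using \<rho> subset_cball[of \<rho>' "2 * \<rho>" z0] \<rho>' by auto
    show ?thesis
    proof (intro equalityI subsetI)
      fix x assume "x \<in> crd_inv c ` cball z0 \<rho>'"
      then obtain \<zeta> where "\<zeta> \<in> cball z0 \<rho>'" "x = crd_inv c \<zeta>" by blast
      then show "x \<in> {x \<in> dom_of c. crd c x \<in> cball z0 \<rho>'}"
        using img crd_crd_inv[OF c, of \<zeta>] crd_inv_in[OF c, of \<zeta>] by auto
    next
      fix x assume "x \<in> {x \<in> dom_of c. crd c x \<in> cball z0 \<rho>'}"
      then show "x \<in> crd_inv c ` cball z0 \<rho>'" using crd_inv_crd[OF c, of x] by (auto intro: rev_image_eqI)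
    qed
  qed
  have "compact (crd_inv c ` cball z0 \<rho>')"
  proof (rule compact_continuous_image[OF continuous_on_subset[OF continuous_on_crd_inv[OF c]]])
    show "cball z0 \<rho>' \<subseteq> crd c ` dom_of c"
      using \<rho> subset_cball[of \<rho>' "2 * \<rho>" z0] \<rho>' by auto
  qed simp
  then have cl: "open (- (crd_inv c ` cball z0 \<rho>'))" by (intro open_Compl compact_imp_closed)
  have op: "open (dom_of c \<inter> crd c -` ball z0 (2 * \<rho>))" by (rule open_crd_preimage[OF c open_ball])
  have "P t"
  proof (rule connected_induction_simple[where S = "{\<alpha>..\<beta>}" and a = t1])
    have "dist z0 (crd c (\<gamma> t1)) \<le> 2 * \<rho>" using start(2) zero_le_dist[of z0 "crd c (\<gamma> t1)"] by linarith
    then show "P t1" using start by (simp add: P_def)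
    fix t0 assume t0: "t0 \<in> {\<alpha>..\<beta>}"
    show "\<exists>N. openin (top_of_set {\<alpha>..\<beta>}) N \<and> t0 \<in> N \<and> (\<forall>x\<in>N. \<forall>y\<in>N. P x \<longrightarrow> P y)"
    proof (cases "\<gamma> t0 \<in> dom_of c \<inter> crd c -` ball z0 (2 * \<rho>)")
      case True
      obtain I where I: "open I" "t0 \<in> I" "\<And>t. t \<in> {\<alpha>..\<beta>} \<inter> I \<Longrightarrow> \<gamma> t \<in> dom_of c \<inter> crd c -` ball z0 (2 * \<rho>)"
        using continuous_on_near[OF cont t0 op True] by metis
      obtain e where e: "e > 0" "ball t0 e \<subseteq> I" using I open_contains_ball by blast
      show ?thesis
      proof (intro exI[of _ "{\<alpha>..\<beta>} \<inter> ball t0 e"] conjI ballI impI)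
        show "openin (top_of_set {\<alpha>..\<beta>}) ({\<alpha>..\<beta>} \<inter> ball t0 e)" by (simp add: openin_open_Int)
        show "t0 \<in> {\<alpha>..\<beta>} \<inter> ball t0 e" using t0 e by simp
        fix x y assume x: "x \<in> {\<alpha>..\<beta>} \<inter> ball t0 e" and y: "y \<in> {\<alpha>..\<beta>} \<inter> ball t0 e" and "P x"
        show "P y" unfolding P_def
        proof
          fix s assume s: "s \<in> closed_segment t1 y"
          show "\<gamma> s \<in> dom_of c \<and> crd c (\<gamma> s) \<in> cball z0 (2 * \<rho>)"
          proof (cases "s \<in> closed_segment t1 x")
            case True
            then show ?thesis using \<open>P x\<close> by (auto simp: P_def)
          next
            case False
            then have "s \<in> {\<alpha>..\<beta>} \<inter> ball t0 e"
              using s x y t1 by (auto simp: closed_segment_eq_real_ivl dist_real_def split: if_splits)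
            then show ?thesis using I(3)[of s] e(2) by auto
          qed
        qed
      qed
    next
      case False
      then have "\<gamma> t0 \<in> - (crd_inv c ` cball z0 \<rho>')" using \<rho>' unfolding G by auto
      from continuous_on_near[OF cont t0 cl this]
      obtain I where I: "open I" "t0 \<in> I" "\<And>t. t \<in> {\<alpha>..\<beta>} \<inter> I \<Longrightarrow> \<gamma> t \<in> - (crd_inv c ` cball z0 \<rho>')" by metis
      have "\<not> P x" if "x \<in> {\<alpha>..\<beta>} \<inter> I" for x
        using I(3)[OF that] speed[of x] that unfolding G by (auto simp: P_def)
      then show ?thesis using I t0 by (intro exI[of _ "{\<alpha>..\<beta>} \<inter> I"]) (auto simp: openin_open_Int)
    qed
  qed (use t1 t in auto)
  then show ?thesis by (simp add: P_def)
qed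

text \<open>A time interval around \<open>t0\<close> and a coordinate ball around \<open>q0\<close> on which the field is bounded and
  Lipschitz, with the interval so short that the solutions starting near \<open>q0\<close> stay in the chart.
  Then the estimates for \<open>real^'d\<close> apply to them.\<close>

lemma local_chart:
  assumes "is_interval T" and v: "smooth_field T v" and "t0 \<in> T" and c: "c \<in> charts_at A q0"
  obtains \<alpha> \<beta> I \<rho> L K where "t0 \<in> {\<alpha>..\<beta>}" "{\<alpha>..\<beta>} \<subseteq> T" "open I" "t0 \<in> I" "T \<inter> I \<subseteq> {\<alpha>..\<beta>}"
    "0 < \<rho>" "0 < L" "K \<subseteq> crd c ` dom_of c" "cball (crd c q0) \<rho> \<subseteq> K"
    "\<And>t z x. t \<in> {\<alpha>..\<beta>} \<Longrightarrow> z \<in> K \<Longrightarrow> norm (frechet_derivative (fld v c t) (at z) x) \<le> L * norm x"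
    "\<And>t z z'. t \<in> {\<alpha>..\<beta>} \<Longrightarrow> z \<in> K \<Longrightarrow> z' \<in> K \<Longrightarrow> norm (fld v c t z - fld v c t z') \<le> L * norm (z - z')"
    "\<And>\<gamma> t1 t. solves A T v \<gamma> \<Longrightarrow> t1 \<in> {\<alpha>..\<beta>} \<Longrightarrow> \<gamma> t1 \<in> dom_of c \<Longrightarrow> dist (crd c q0) (crd c (\<gamma> t1)) < \<rho> \<Longrightarrow>
       t \<in> {\<alpha>..\<beta>} \<Longrightarrow> \<gamma> t \<in> dom_of c \<and> crd c (\<gamma> t) \<in> K"
proof -
  have c': "c \<in> A" "q0 \<in> dom_of c" using c charts_atD by auto
  define z0 where "z0 = crd c q0"
  have "z0 \<in> crd c ` dom_of c" using c' by (simp add: z0_def)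
  then obtain r where r: "r > 0" "cball z0 r \<subseteq> crd c ` dom_of c"
    using open_img[OF c'(1)] open_contains_cball by metis
  define \<rho> where "\<rho> = r / 2"
  have \<rho>: "\<rho> > 0" "cball z0 (2 * \<rho>) \<subseteq> crd c ` dom_of c" using r by (auto simp: \<rho>_def)
  obtain \<alpha>1 \<beta>1 I1 where 1: "t0 \<in> {\<alpha>1..\<beta>1}" "{\<alpha>1..\<beta>1} \<subseteq> T" "open I1" "t0 \<in> I1" "T \<inter> I1 \<subseteq> {\<alpha>1..\<beta>1}"
    using interval_neighbourhood[OF assms(1,3), of 1] by (metis zero_less_one)
  have f1: "smooth_family {\<alpha>1..\<beta>1} (crd c ` dom_of c) (fld v c)" by (rule smooth_fieldD[OF v c'(1) 1(2)])
  obtain M L where bM: "0 < M" "0 < L" "\<And>t z. t \<in> {\<alpha>1..\<beta>1} \<Longrightarrow> z \<in> cball z0 (2 * \<rho>) \<Longrightarrow> norm (fld v c t z) \<le> M"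
    "\<And>t z x. t \<in> {\<alpha>1..\<beta>1} \<Longrightarrow> z \<in> cball z0 (2 * \<rho>) \<Longrightarrow> norm (frechet_derivative (fld v c t) (at z) x) \<le> L * norm x"
    using smooth_family_bounds[OF f1 open_img[OF c'(1)] compact_cball \<rho>(2)] by metis
  obtain \<alpha> \<beta> I where 2: "t0 \<in> {\<alpha>..\<beta>}" "{\<alpha>..\<beta>} \<subseteq> {\<alpha>1..\<beta>1}" "\<beta> - \<alpha> < \<rho> / M" "open I" "t0 \<in> I" "{\<alpha>1..\<beta>1} \<inter> I \<subseteq> {\<alpha>..\<beta>}"
    using interval_neighbourhood[OF is_interval_cc 1(1), of "\<rho> / M"] \<rho>(1) bM(1) by (metis divide_pos_pos)
  show thesis
  proof (rule that[of \<alpha> \<beta> "I1 \<inter> I" \<rho> L "cball z0 (2 * \<rho>)"])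
    show "norm (fld v c t z - fld v c t z') \<le> L * norm (z - z')"
      if "t \<in> {\<alpha>..\<beta>}" "z \<in> cball z0 (2 * \<rho>)" "z' \<in> cball z0 (2 * \<rho>)" for t z z'
      by (rule smooth_family_lipschitz[OF f1 convex_cball \<rho>(2) _ that(2,3)]) (use that 2 bM in auto)
    fix \<gamma> t1 t assume *: "solves A T v \<gamma>" "t1 \<in> {\<alpha>..\<beta>}" "\<gamma> t1 \<in> dom_of c" "dist (crd c q0) (crd c (\<gamma> t1)) < \<rho>" "t \<in> {\<alpha>..\<beta>}"
    show "\<gamma> t \<in> dom_of c \<and> crd c (\<gamma> t) \<in> cball z0 (2 * \<rho>)"
    proof (rule solution_stays[OF c'(1) *(1) _ *(2) \<rho>(2) _ bM(1) _ *(3) _ *(5)])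
      show "M * (\<beta> - \<alpha>) < \<rho>" using 2(3) bM(1) by (simp add: field_simps)
    qed (use 1 2 bM * in \<open>auto simp: z0_def\<close>)
  qed (use 1 2 bM \<rho> in \<open>auto simp: z0_def\<close>)
qed

text \<open>Where two solutions meet, the growth estimate in a chart keeps them together for nearby times; where
  they differ, they do so for nearby times by continuity and the Hausdorff property.\<close>

theorem solutions_unique:
  assumes "is_interval T" and v: "smooth_field T v" and sol: "solves A T v \<gamma>1" "solves A T v \<gamma>2"
    and "t1 \<in> T" "\<gamma>1 t1 = \<gamma>2 t1" "t \<in> T"
  shows "\<gamma>1 t = \<gamma>2 t"
proof (rule interval_induction[where T = T and ?t1.0 = t1 and P = "\<lambda>t. \<gamma>1 t = \<gamma>2 t"])
  fix t0 assume t0: "t0 \<in> T"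
  show "\<exists>I. open I \<and> t0 \<in> I \<and> (\<forall>x\<in>T \<inter> I. \<forall>y\<in>T \<inter> I. \<gamma>1 x = \<gamma>2 x \<longrightarrow> \<gamma>1 y = \<gamma>2 y)"
  proof (cases "\<gamma>1 t0 = \<gamma>2 t0")
    case False
    then obtain V W where VW: "open V" "open W" "\<gamma>1 t0 \<in> V" "\<gamma>2 t0 \<in> W" "V \<inter> W = {}"
      using hausdorff[OF False] by blast
    obtain I where I: "open I" "t0 \<in> I" "\<And>t. t \<in> T \<inter> I \<Longrightarrow> \<gamma>1 t \<in> V"
      using continuous_on_near[OF solves_continuous[OF sol(1)] t0 VW(1,3)] by metis
    obtain I' where I': "open I'" "t0 \<in> I'" "\<And>t. t \<in> T \<inter> I' \<Longrightarrow> \<gamma>2 t \<in> W"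
      using continuous_on_near[OF solves_continuous[OF sol(2)] t0 VW(2,4)] by metis
    have "\<gamma>1 x \<noteq> \<gamma>2 x" if "x \<in> T \<inter> (I \<inter> I')" for x
      using I(3)[of x] I'(3)[of x] that VW(5) by (metis IntD1 IntD2 IntI empty_iff)
    then show ?thesis
      using I(1,2) I'(1,2) open_Int by (intro exI[of _ "I \<inter> I'"]) blast
  next
    case True
    obtain c where c: "c \<in> charts_at A (\<gamma>1 t0)" using ex_chart by blast
    have c': "c \<in> A" "\<gamma>1 t0 \<in> dom_of c" using c charts_atD by auto
    obtain \<alpha> \<beta> I \<rho> L K where l: "t0 \<in> {\<alpha>..\<beta>}" "{\<alpha>..\<beta>} \<subseteq> T" "open I" "t0 \<in> I" "T \<inter> I \<subseteq> {\<alpha>..\<beta>}" "0 < \<rho>" "0 < L"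
      "\<And>t z z'. t \<in> {\<alpha>..\<beta>} \<Longrightarrow> z \<in> K \<Longrightarrow> z' \<in> K \<Longrightarrow> norm (fld v c t z - fld v c t z') \<le> L * norm (z - z')"
      "\<And>\<gamma> t1 t. solves A T v \<gamma> \<Longrightarrow> t1 \<in> {\<alpha>..\<beta>} \<Longrightarrow> \<gamma> t1 \<in> dom_of c \<Longrightarrow> dist (crd c (\<gamma>1 t0)) (crd c (\<gamma> t1)) < \<rho> \<Longrightarrow>
         t \<in> {\<alpha>..\<beta>} \<Longrightarrow> \<gamma> t \<in> dom_of c \<and> crd c (\<gamma> t) \<in> K"
      using local_chart[OF assms(1) v t0 c] by metis
    have K1: "\<gamma>1 t \<in> dom_of c \<and> crd c (\<gamma>1 t) \<in> K" if "t \<in> {\<alpha>..\<beta>}" for t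
      by (rule l(9)[OF sol(1) l(1)]) (use c' l(6) that in auto)
    have K2: "\<gamma>2 t \<in> dom_of c \<and> crd c (\<gamma>2 t) \<in> K" if "t \<in> {\<alpha>..\<beta>}" for t
      by (rule l(9)[OF sol(2) l(1)]) (use c' l(6) that True in auto)
    have "\<gamma>1 y = \<gamma>2 y" if x: "x \<in> {\<alpha>..\<beta>}" and y: "y \<in> {\<alpha>..\<beta>}" and eq: "\<gamma>1 x = \<gamma>2 x" for x y
    proof -
      have "norm (crd c (\<gamma>1 y) - crd c (\<gamma>2 y)) \<le> 2 * (norm (crd c (\<gamma>1 x) - crd c (\<gamma>2 x)) + 0 * (\<beta> - \<alpha>)) * exp (2 * L * (\<beta> - \<alpha>))"
      proof (rule growth_estimate[OF x y l(7)])
        show "((\<lambda>t. crd c (\<gamma>1 t) - crd c (\<gamma>2 t)) has_vector_derivative fld v c t (crd c (\<gamma>1 t)) - fld v c t (crd c (\<gamma>2 t))) (at t within {\<alpha>..\<beta>})"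
          if "t \<in> {\<alpha>..\<beta>}" for t
          using K1[OF that] K2[OF that] that l(2) c'
          by (intro has_vector_derivative_diff has_vector_derivative_within_subset[OF solvesD[OF sol(1)]]
              has_vector_derivative_within_subset[OF solvesD[OF sol(2)]]) auto
        show "norm (fld v c t (crd c (\<gamma>1 t)) - fld v c t (crd c (\<gamma>2 t))) \<le> L * norm (crd c (\<gamma>1 t) - crd c (\<gamma>2 t)) + 0"
          if "t \<in> {\<alpha>..\<beta>}" for t
          using l(8)[OF that] K1[OF that] K2[OF that] by simp
      qed simp
      then have "crd c (\<gamma>1 y) = crd c (\<gamma>2 y)" using eq by simp
      then show ?thesis using K1[OF y] K2[OF y] c'(1) by (metis crd_inv_crd)
    qed
    then show ?thesis using l(3,4,5) by (intro exI[of _ I]) blast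
  qed
qed (use assms in auto)

text \<open>The one-parameter family of solutions in coordinates: \<open>a\<close> around the starting point and \<open>c\<close>
  around the position at time \<open>t0\<close>. Smoothness at one time near \<open>t0\<close> carries over to all of them.\<close>

lemma flow_family:
  assumes "is_interval T" and v: "smooth_field T v" and flow: "\<And>x. solves A T v (\<lambda>t. F t x)" and t0: "t0 \<in> T"
    and a: "a \<in> charts_at A x0" and c: "c \<in> charts_at A (F t0 x0)"
  obtains \<alpha> \<beta> I where "t0 \<in> {\<alpha>..\<beta>}" "{\<alpha>..\<beta>} \<subseteq> T" "open I" "t0 \<in> I" "T \<inter> I \<subseteq> {\<alpha>..\<beta>}"
    "\<And>s. s \<in> T \<inter> I \<Longrightarrow> smooth_at (F s) x0 \<Longrightarrow>
       \<exists>U. open U \<and> x0 \<in> U \<and> U \<subseteq> dom_of a \<and> (\<forall>t\<in>{\<alpha>..\<beta>}. F t ` U \<subseteq> dom_of c) \<and>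
         smooth_family {\<alpha>..\<beta>} (crd a ` U) (\<lambda>t. crd c \<circ> F t \<circ> crd_inv a) \<and>
         (\<forall>t\<in>{\<alpha>..\<beta>}. \<forall>\<xi>\<in>crd a ` U. \<forall>\<eta>. ((\<lambda>t. frechet_derivative (crd c \<circ> F t \<circ> crd_inv a) (at \<xi>) \<eta>) has_vector_derivative
            frechet_derivative (fld v c t) (at ((crd c \<circ> F t \<circ> crd_inv a) \<xi>))
              (frechet_derivative (crd c \<circ> F t \<circ> crd_inv a) (at \<xi>) \<eta>)) (at t within {\<alpha>..\<beta>}))"
proof -
  have a': "a \<in> A" "x0 \<in> dom_of a" and c': "c \<in> A" "F t0 x0 \<in> dom_of c" using a c charts_atD by auto
  obtain \<alpha> \<beta> I1 \<rho> L K where l: "t0 \<in> {\<alpha>..\<beta>}" "{\<alpha>..\<beta>} \<subseteq> T" "open I1" "t0 \<in> I1" "T \<inter> I1 \<subseteq> {\<alpha>..\<beta>}" "0 < \<rho>" "0 < L" "K \<subseteq> crd c ` dom_of c"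
    "\<And>t z z'. t \<in> {\<alpha>..\<beta>} \<Longrightarrow> z \<in> K \<Longrightarrow> z' \<in> K \<Longrightarrow> norm (fld v c t z - fld v c t z') \<le> L * norm (z - z')"
    "\<And>\<gamma> t1 t. solves A T v \<gamma> \<Longrightarrow> t1 \<in> {\<alpha>..\<beta>} \<Longrightarrow> \<gamma> t1 \<in> dom_of c \<Longrightarrow> dist (crd c (F t0 x0)) (crd c (\<gamma> t1)) < \<rho> \<Longrightarrow>
       t \<in> {\<alpha>..\<beta>} \<Longrightarrow> \<gamma> t \<in> dom_of c \<and> crd c (\<gamma> t) \<in> K"
    using local_chart[OF assms(1) v t0 c] by metis
  define W where "W = dom_of c \<inter> crd c -` ball (crd c (F t0 x0)) \<rho>"
  have W: "open W" "F t0 x0 \<in> W" unfolding W_def using open_crd_preimage[OF c'(1)] c' l(6) by auto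
  obtain I2 where I2: "open I2" "t0 \<in> I2" "\<And>t. t \<in> T \<inter> I2 \<Longrightarrow> F t x0 \<in> W"
    using continuous_on_near[OF solves_continuous[OF flow] t0 W] by metis
  show thesis
  proof (rule that[of \<alpha> \<beta> "I1 \<inter> I2"])
    fix s assume s: "s \<in> T \<inter> (I1 \<inter> I2)" and sm: "smooth_at (F s) x0"
    have sW: "F s x0 \<in> W" using I2(3) s by blast
    then have "c \<in> charts_at A (F s x0)" using c' by (auto simp: W_def charts_at_def)
    from smooth_at_rep[OF sm a this] obtain U0 where U0: "x0 \<in> U0" "smooth_rep a c (F s) U0" by blast
    have oU0: "open U0" "U0 \<subseteq> dom_of a" using U0(2) by (auto simp: smooth_rep_def)
    define U where "U = U0 \<inter> F s -` W"
    have U: "open U" "x0 \<in> U" "U \<subseteq> dom_of a" "U \<subseteq> U0"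
      unfolding U_def using continuous_open_preimage[OF smooth_rep_continuous[OF a'(1) c'(1) U0(2)] oU0(1) W(1)]
      U0(1) sW oU0(2) by auto
    have sJ: "s \<in> {\<alpha>..\<beta>}" using s l(5) by blast
    have inK: "F t x \<in> dom_of c \<and> crd c (F t x) \<in> K" if "t \<in> {\<alpha>..\<beta>}" "x \<in> U" for t x
      by (rule l(10)[OF flow sJ]) (use that in \<open>auto simp: U_def W_def\<close>)
    have oU: "open (crd a ` U)" by (rule open_crd_image[OF a'(1) U(1,3)])
    have inK': "(crd c \<circ> F t \<circ> crd_inv a) \<xi> \<in> K" if "t \<in> {\<alpha>..\<beta>}" "\<xi> \<in> crd a ` U" for t \<xi>
      using inK that U(3) a'(1) by (auto simp: subset_iff)
    have ode: "((\<lambda>t. (crd c \<circ> F t \<circ> crd_inv a) \<xi>) has_vector_derivative fld v c t ((crd c \<circ> F t \<circ> crd_inv a) \<xi>)) (at t within {\<alpha>..\<beta>})"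
      if t: "t \<in> {\<alpha>..\<beta>}" and \<xi>: "\<xi> \<in> crd a ` U" for t \<xi>
    proof -
      obtain x where x: "\<xi> = crd a x" "x \<in> U" using \<xi> by blast
      have "((\<lambda>t. crd c (F t x)) has_vector_derivative fld v c t (crd c (F t x))) (at t within {\<alpha>..\<beta>})"
        by (rule has_vector_derivative_within_subset[OF solvesD[OF flow _ c'(1)] l(2)])
          (use t l(2) inK[OF t x(2)] in auto)
      then show ?thesis using x U(3) a'(1) by (auto simp: subset_iff)
    qed
    have init: "smooth_on (crd a ` U) (crd c \<circ> F s \<circ> crd_inv a)"
      using smooth_rep_subset[OF U0(2) U(1,4)] by (simp add: smooth_rep_def)
    note dep = smooth_dependence[OF sJ oU open_img[OF c'(1)] smooth_fieldD[OF v c'(1) l(2)] l(7) l(9) l(8) inK' ode init]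
    show "\<exists>U. open U \<and> x0 \<in> U \<and> U \<subseteq> dom_of a \<and> (\<forall>t\<in>{\<alpha>..\<beta>}. F t ` U \<subseteq> dom_of c) \<and>
         smooth_family {\<alpha>..\<beta>} (crd a ` U) (\<lambda>t. crd c \<circ> F t \<circ> crd_inv a) \<and>
         (\<forall>t\<in>{\<alpha>..\<beta>}. \<forall>\<xi>\<in>crd a ` U. \<forall>\<eta>. ((\<lambda>t. frechet_derivative (crd c \<circ> F t \<circ> crd_inv a) (at \<xi>) \<eta>) has_vector_derivative
            frechet_derivative (fld v c t) (at ((crd c \<circ> F t \<circ> crd_inv a) \<xi>))
              (frechet_derivative (crd c \<circ> F t \<circ> crd_inv a) (at \<xi>) \<eta>)) (at t within {\<alpha>..\<beta>}))"
      by (intro exI[of _ U] conjI ballI allI dep(1) dep(2) U) (use inK in auto)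
  qed (use l I2 in auto)
qed

lemma smooth_family_imp_smooth_on: "smooth_family J S f \<Longrightarrow> t \<in> J \<Longrightarrow> smooth_on S (f t)"
  unfolding smooth_family_def smooth_on_def by (blast intro: Ck_family_imp_Ck_on)

text \<open>By \<open>flow_family\<close>, being smooth at \<open>x0\<close> is a property that nearby times share.\<close>

theorem flow_smooth_at:
  assumes "is_interval T" and v: "smooth_field T v" and flow: "\<And>x. solves A T v (\<lambda>t. F t x)"
    and "t1 \<in> T" "smooth_at (F t1) x0" "t \<in> T"
  shows "smooth_at (F t) x0"
proof (rule interval_induction[where T = T and ?t1.0 = t1 and P = "\<lambda>t. smooth_at (F t) x0"])
  fix t0 assume t0: "t0 \<in> T"
  obtain a c where a: "a \<in> charts_at A x0" and c: "c \<in> charts_at A (F t0 x0)" using ex_chart by blast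
  have c': "c \<in> A" using c charts_atD by blast
  obtain \<alpha> \<beta> I where *: "t0 \<in> {\<alpha>..\<beta>}" "{\<alpha>..\<beta>} \<subseteq> T" "open I" "t0 \<in> I" "T \<inter> I \<subseteq> {\<alpha>..\<beta>}"
    "\<And>s. s \<in> T \<inter> I \<Longrightarrow> smooth_at (F s) x0 \<Longrightarrow>
       \<exists>U. open U \<and> x0 \<in> U \<and> U \<subseteq> dom_of a \<and> (\<forall>t\<in>{\<alpha>..\<beta>}. F t ` U \<subseteq> dom_of c) \<and>
         smooth_family {\<alpha>..\<beta>} (crd a ` U) (\<lambda>t. crd c \<circ> F t \<circ> crd_inv a)"
    using flow_family[where F = F, OF assms(1) v flow t0 a c] by metis
  have "smooth_at (F y) x0" if xy: "x \<in> T \<inter> I" "y \<in> T \<inter> I" and sx: "smooth_at (F x) x0" for x y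
  proof -
    obtain U where U: "open U" "x0 \<in> U" "U \<subseteq> dom_of a" "\<forall>t\<in>{\<alpha>..\<beta>}. F t ` U \<subseteq> dom_of c"
      "smooth_family {\<alpha>..\<beta>} (crd a ` U) (\<lambda>t. crd c \<circ> F t \<circ> crd_inv a)"
      using *(6)[OF xy(1) sx] by blast
    have "y \<in> {\<alpha>..\<beta>}" using *(5) xy by blast
    then have "smooth_rep a c (F y) U" "c \<in> charts_at A (F y x0)"
      using U smooth_family_imp_smooth_on[OF U(5)] c' image_subset_iff[of "F y" U "dom_of c"]
      by (auto simp: smooth_rep_def charts_at_def)
    then show ?thesis unfolding smooth_at_def using a U(2) by blast
  qed
  then show "\<exists>I. open I \<and> t0 \<in> I \<and> (\<forall>x\<in>T \<inter> I. \<forall>y\<in>T \<inter> I. smooth_at (F x) x0 \<longrightarrow> smooth_at (F y) x0)"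
    using *(3,4) by (intro exI[of _ I]) blast
qed (use assms in auto)

end

context manifold
begin

section \<open>The variational equation on a manifold\<close>

text \<open>The coefficient matrix, in the chart \<open>c\<close>, of the equation linearized at \<open>p\<close>.\<close>

definition fmat :: "(real \<Rightarrow> 'a \<Rightarrow> ('a, 'd) tangent) \<Rightarrow> ('a, 'd) chart \<Rightarrow> real \<Rightarrow> 'a \<Rightarrow> real^'d^'d" where
  "fmat v c t p = matrix (frechet_derivative (fld v c t) (at (crd c p)))"

lemma fld_has_derivative:
  assumes "smooth_field T v" "c \<in> A" "t \<in> T" "p \<in> dom_of c"
  shows "(fld v c t has_derivative (*v) (fmat v c t p)) (at (crd c p))"
proof -
  have "(fld v c t has_derivative frechet_derivative (fld v c t) (at (crd c p))) (at (crd c p))"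
    by (rule smooth_on_has_derivative[OF smooth_family_imp_smooth_on[OF smooth_fieldD[OF assms(1,2) order_refl] assms(3)]])
      (use assms(4) in auto)
  then show ?thesis unfolding fmat_def by (simp add: has_derivative_bounded_linear)
qed

lemma smooth_on_frechet_eq_dmap:
  assumes "smooth_on (crd a ` U) (crd c \<circ> F \<circ> crd_inv a)" "x \<in> U"
  shows "frechet_derivative (crd c \<circ> F \<circ> crd_inv a) (at (crd a x)) = (*v) (dmap a c F x)"
proof -
  have "((crd c \<circ> F \<circ> crd_inv a) has_derivative frechet_derivative (crd c \<circ> F \<circ> crd_inv a) (at (crd a x))) (at (crd a x))"
    by (rule smooth_on_has_derivative[OF assms(1)]) (use assms(2) in auto)
  then show ?thesis unfolding dmap_def by (simp add: has_derivative_bounded_linear)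
qed

lemma dmap_ode:
  assumes "is_interval T" and v: "smooth_field T v" and flow: "\<And>x. solves A T v (\<lambda>t. F t x)" and t0: "t0 \<in> T"
    and sm: "smooth_at (F t0) x0" and a: "a \<in> charts_at A x0" and c: "c \<in> charts_at A (F t0 x0)"
  shows "((\<lambda>s. dmap a c (F s) x0 *v \<eta>) has_vector_derivative fmat v c t0 (F t0 x0) *v (dmap a c (F t0) x0 *v \<eta>)) (at t0 within T)"
proof -
  have a': "a \<in> A" "x0 \<in> dom_of a" and c': "c \<in> A" "F t0 x0 \<in> dom_of c" using a c charts_atD by auto
  obtain \<alpha> \<beta> I where l: "t0 \<in> {\<alpha>..\<beta>}" "{\<alpha>..\<beta>} \<subseteq> T" "open I" "t0 \<in> I" "T \<inter> I \<subseteq> {\<alpha>..\<beta>}"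
    "\<And>s. s \<in> T \<inter> I \<Longrightarrow> smooth_at (F s) x0 \<Longrightarrow>
       \<exists>U. open U \<and> x0 \<in> U \<and> U \<subseteq> dom_of a \<and> (\<forall>t\<in>{\<alpha>..\<beta>}. F t ` U \<subseteq> dom_of c) \<and>
         smooth_family {\<alpha>..\<beta>} (crd a ` U) (\<lambda>t. crd c \<circ> F t \<circ> crd_inv a) \<and>
         (\<forall>t\<in>{\<alpha>..\<beta>}. \<forall>\<xi>\<in>crd a ` U. \<forall>\<eta>. ((\<lambda>t. frechet_derivative (crd c \<circ> F t \<circ> crd_inv a) (at \<xi>) \<eta>) has_vector_derivative
            frechet_derivative (fld v c t) (at ((crd c \<circ> F t \<circ> crd_inv a) \<xi>))
              (frechet_derivative (crd c \<circ> F t \<circ> crd_inv a) (at \<xi>) \<eta>)) (at t within {\<alpha>..\<beta>}))"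
    using flow_family[where F = F, OF assms(1) v flow t0 a c] by blast
  obtain U where U: "x0 \<in> U" "smooth_family {\<alpha>..\<beta>} (crd a ` U) (\<lambda>t. crd c \<circ> F t \<circ> crd_inv a)"
    and ode: "\<And>t \<xi> \<eta>. t \<in> {\<alpha>..\<beta>} \<Longrightarrow> \<xi> \<in> crd a ` U \<Longrightarrow> ((\<lambda>t. frechet_derivative (crd c \<circ> F t \<circ> crd_inv a) (at \<xi>) \<eta>) has_vector_derivative
            frechet_derivative (fld v c t) (at ((crd c \<circ> F t \<circ> crd_inv a) \<xi>))
              (frechet_derivative (crd c \<circ> F t \<circ> crd_inv a) (at \<xi>) \<eta>)) (at t within {\<alpha>..\<beta>})"
    using l(6)[OF _ sm] t0 l(4) by blast
  have fr: "frechet_derivative (crd c \<circ> F t \<circ> crd_inv a) (at (crd a x0)) = (*v) (dmap a c (F t) x0)" if "t \<in> {\<alpha>..\<beta>}" for t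
    by (rule smooth_on_frechet_eq_dmap[OF smooth_family_imp_smooth_on[OF U(2) that] U(1)])
  have "((\<lambda>s. frechet_derivative (crd c \<circ> F s \<circ> crd_inv a) (at (crd a x0)) \<eta>) has_vector_derivative
      frechet_derivative (fld v c t0) (at (crd c (F t0 x0))) (dmap a c (F t0) x0 *v \<eta>)) (at t0 within {\<alpha>..\<beta>})"
    using ode[OF l(1), of "crd a x0" \<eta>] U(1) a' fr[OF l(1)] by auto
  then have "((\<lambda>s. dmap a c (F s) x0 *v \<eta>) has_vector_derivative
      frechet_derivative (fld v c t0) (at (crd c (F t0 x0))) (dmap a c (F t0) x0 *v \<eta>)) (at t0 within {\<alpha>..\<beta>})"
    by (rule has_vector_derivative_transform[OF l(1), rotated]) (simp add: fr)
  moreover have "frechet_derivative (fld v c t0) (at (crd c (F t0 x0))) = (*v) (fmat v c t0 (F t0 x0))"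
    using frechet_derivative_at[OF fld_has_derivative[OF v c'(1) t0 c'(2)]] by simp
  ultimately show ?thesis
    by (simp add: at_within_interval_neighbourhood[OF l(2,3,4,5)])
qed

text \<open>The partial derivative in space is jointly continuous, so the partial derivatives in time and in space
  add up to the total derivative.\<close>

lemma family_along_curve:
  fixes \<phi> :: "real \<Rightarrow> 'p::euclidean_space \<Rightarrow> 'e::euclidean_space"
  assumes \<phi>: "smooth_family J S \<phi>" and S: "open S" and t0: "t0 \<in> J" "\<zeta> t0 \<in> S"
    and dt: "((\<lambda>t. \<phi> t (\<zeta> t0)) has_vector_derivative g) (at t0 within J)"
    and d\<zeta>: "(\<zeta> has_vector_derivative w) (at t0 within J)"
  shows "((\<lambda>t. \<phi> t (\<zeta> t)) has_vector_derivative g + frechet_derivative (\<phi> t0) (at (\<zeta> t0)) w) (at t0 within J)"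
proof -
  obtain r where r: "r > 0" "ball (\<zeta> t0) r \<subseteq> S" using S t0(2) open_contains_ball by blast
  define Y where "Y = ball (\<zeta> t0) r"
  have C: "Ck_family (Suc 0) J S \<phi>" using \<phi> by (simp add: smooth_family_def)
  define B where "B = (\<lambda>t y. Blinfun (frechet_derivative (\<phi> t) (at y)))"
  have B: "blinfun_apply (B t y) = frechet_derivative (\<phi> t) (at y)" if "t \<in> J" "y \<in> S" for t y
    unfolding B_def using has_derivative_bounded_linear[OF Ck_family_SucD[OF C that]] by (rule bounded_linear_Blinfun_apply)
  have "Ck_family 0 J S B"
  proof (rule Ck_family_blinfunI[OF S])
    fix i :: 'p
    have "Ck_family 0 J S (\<lambda>t y. frechet_derivative (\<phi> t) (at y) i)" using C by simp
    then show "Ck_family 0 J S (\<lambda>t y. B t y i)" using B by (subst Ck_family_cong[OF S]) auto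
  qed
  then have contB: "continuous_on (J \<times> Y) (\<lambda>(t, y). B t y)"
    using r(2) by (auto simp: Y_def intro: continuous_on_subset)
  have "((\<lambda>(t, y). \<phi> t y) has_derivative (\<lambda>(tx, ty). tx *\<^sub>R g + B t0 (\<zeta> t0) ty)) (at (t0, \<zeta> t0) within J \<times> Y)"
  proof (rule has_derivative_partialsI)
    show "((\<lambda>x. \<phi> x (\<zeta> t0)) has_derivative (\<lambda>tx. tx *\<^sub>R g)) (at t0 within J)"
      using dt by (simp add: has_vector_derivative_def)
    show "(\<phi> x has_derivative blinfun_apply (B x y)) (at y within Y)" if "x \<in> J" "y \<in> Y" for x y
    proof -
      have "y \<in> S" using that r(2) by (auto simp: Y_def)
      then show ?thesis unfolding B[OF that(1) \<open>y \<in> S\<close>]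
        by (intro has_derivative_at_withinI[OF Ck_family_SucD[OF C that(1)]])
    qed
    show "continuous (at (t0, \<zeta> t0) within J \<times> Y) (\<lambda>(x, y). B x y)"
      using contB t0(1) r(1) by (auto simp: continuous_on_eq_continuous_within Y_def)
  qed (use r(1) in \<open>auto simp: Y_def\<close>)
  moreover obtain e where e: "e > 0" "\<And>t. t \<in> J \<Longrightarrow> dist t t0 < e \<Longrightarrow> \<zeta> t \<in> Y"
  proof -
    have "continuous (at t0 within J) \<zeta>" using d\<zeta> by (rule has_vector_derivative_continuous)
    then show thesis using that r(1) unfolding continuous_within_eps_delta Y_def
      by (metis dist_commute mem_ball)
  qed
  define J' where "J' = J \<inter> ball t0 e"
  have "((\<lambda>t. (t, \<zeta> t)) has_derivative (\<lambda>s. (s, s *\<^sub>R w))) (at t0 within J')"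
    using d\<zeta> unfolding has_vector_derivative_def J'_def
    by (intro has_derivative_Pair) (auto intro: has_derivative_subset)
  moreover have "(\<lambda>t. (t, \<zeta> t)) ` J' \<subseteq> J \<times> Y" using e(2) by (auto simp: J'_def dist_commute)
  ultimately have "(((\<lambda>(t, y). \<phi> t y) \<circ> (\<lambda>t. (t, \<zeta> t))) has_derivative (\<lambda>(tx, ty). tx *\<^sub>R g + B t0 (\<zeta> t0) ty) \<circ> (\<lambda>s. (s, s *\<^sub>R w))) (at t0 within J')"
    by (intro diff_chain_within) (auto intro: has_derivative_subset)
  then have "((\<lambda>t. \<phi> t (\<zeta> t)) has_vector_derivative g + B t0 (\<zeta> t0) w) (at t0 within J')"
    by (simp add: o_def has_vector_derivative_def blinfun.scaleR_right scaleR_add_right)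
  moreover have "at t0 within J' = at t0 within J"
    by (rule at_within_nhd[of _ "ball t0 e"]) (use e(1) in \<open>auto simp: J'_def\<close>)
  ultimately show ?thesis using B[OF t0] by simp
qed

text \<open>The velocity of the transported curve has two parts: the field at its position, and the image
  of the velocity of \<open>z\<close> under the differential of the flow map.\<close>

lemma flow_along_curve:
  assumes "is_interval T" and v: "smooth_field T v" and flow: "\<And>x. solves A T v (\<lambda>t. F t x)" and t0: "t0 \<in> T"
    and sm: "smooth_at (F t0) (z t0)" and b: "b \<in> charts_at A (z t0)" and c: "c \<in> charts_at A (F t0 (z t0))"
    and contz: "continuous_on T z" and dz: "((\<lambda>s. crd b (z s)) has_vector_derivative w) (at t0 within T)"
  shows "((\<lambda>s. crd c (F s (z s))) has_vector_derivative
     fld v c t0 (crd c (F t0 (z t0))) + dmap b c (F t0) (z t0) *v w) (at t0 within T)"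
    and "continuous (at t0 within T) (\<lambda>s. F s (z s))"
proof -
  have b': "b \<in> A" "z t0 \<in> dom_of b" and c': "c \<in> A" "F t0 (z t0) \<in> dom_of c" using b c charts_atD by auto
  obtain \<alpha> \<beta> I where l: "t0 \<in> {\<alpha>..\<beta>}" "{\<alpha>..\<beta>} \<subseteq> T" "open I" "t0 \<in> I" "T \<inter> I \<subseteq> {\<alpha>..\<beta>}"
    "\<And>s. s \<in> T \<inter> I \<Longrightarrow> smooth_at (F s) (z t0) \<Longrightarrow>
       \<exists>U. open U \<and> z t0 \<in> U \<and> U \<subseteq> dom_of b \<and> (\<forall>t\<in>{\<alpha>..\<beta>}. F t ` U \<subseteq> dom_of c) \<and>
         smooth_family {\<alpha>..\<beta>} (crd b ` U) (\<lambda>t. crd c \<circ> F t \<circ> crd_inv b)"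
    using flow_family[where F = F, OF assms(1) v flow t0 b c] by metis
  obtain U where U: "open U" "z t0 \<in> U" "U \<subseteq> dom_of b" "\<forall>t\<in>{\<alpha>..\<beta>}. F t ` U \<subseteq> dom_of c"
    "smooth_family {\<alpha>..\<beta>} (crd b ` U) (\<lambda>t. crd c \<circ> F t \<circ> crd_inv b)"
    using l(6)[OF _ sm] t0 l(4) by blast
  obtain I' where I': "open I'" "t0 \<in> I'" "\<And>t. t \<in> T \<inter> I' \<Longrightarrow> z t \<in> U"
    using continuous_on_near[OF contz t0 U(1,2)] by metis
  have atJ: "at t0 within T = at t0 within {\<alpha>..\<beta>}"
    by (rule at_within_interval_neighbourhood[OF l(2,3,4,5)])
  have "((\<lambda>t. crd c (F t (z t0))) has_vector_derivative fld v c t0 (crd c (F t0 (z t0)))) (at t0 within {\<alpha>..\<beta>})"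
    using solvesD[OF flow t0 c'] atJ by simp
  then have "((\<lambda>t. (crd c \<circ> F t \<circ> crd_inv b) (crd b (z t))) has_vector_derivative
     fld v c t0 (crd c (F t0 (z t0))) + frechet_derivative (crd c \<circ> F t0 \<circ> crd_inv b) (at (crd b (z t0))) w) (at t0 within {\<alpha>..\<beta>})"
    using U(2) b' dz atJ
    by (intro family_along_curve[OF U(5) open_crd_image[OF b'(1) U(1,3)] l(1), of "\<lambda>t. crd b (z t)"]) auto
  then have D: "((\<lambda>t. (crd c \<circ> F t \<circ> crd_inv b) (crd b (z t))) has_vector_derivative
     fld v c t0 (crd c (F t0 (z t0))) + dmap b c (F t0) (z t0) *v w) (at t0 within T)"
    using smooth_on_frechet_eq_dmap[OF smooth_family_imp_smooth_on[OF U(5) l(1)] U(2)] atJ by simp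
  have eq: "(crd c \<circ> F t \<circ> crd_inv b) (crd b (z t)) = crd c (F t (z t)) \<and> F t (z t) \<in> dom_of c" if "t \<in> T \<inter> (I \<inter> I')" for t
    using that I'(3)[of t] U(3,4) l(5) b'(1) by (auto simp: subset_iff image_subset_iff)
  obtain e where e: "e > 0" "ball t0 e \<subseteq> I \<inter> I'" using l(3,4) I'(1,2) open_contains_ball[of "I \<inter> I'"] by blast
  show E: "((\<lambda>s. crd c (F s (z s))) has_vector_derivative
     fld v c t0 (crd c (F t0 (z t0))) + dmap b c (F t0) (z t0) *v w) (at t0 within T)"
    by (rule has_vector_derivative_transform_within[OF D e(1) t0])
      (use eq e(2) in \<open>auto simp: dist_commute subset_iff\<close>)
  have "continuous (at t0 within T \<inter> ball t0 e) (\<lambda>s. crd c (F s (z s)))"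
    by (rule continuous_within_subset[OF has_vector_derivative_continuous[OF E]]) auto
  moreover have "continuous (at (crd c (F t0 (z t0))) within crd c ` dom_of c) (crd_inv c)"
    using continuous_on_crd_inv[OF c'(1)] c'(2) by (auto simp: continuous_on_eq_continuous_within)
  moreover have "(\<lambda>s. crd c (F s (z s))) ` (T \<inter> ball t0 e) \<subseteq> crd c ` dom_of c"
    using eq e(2) by blast
  ultimately have "continuous (at t0 within T \<inter> ball t0 e) (crd_inv c \<circ> (\<lambda>s. crd c (F s (z s))))"
    by (intro continuous_within_compose) (auto intro: continuous_within_subset)
  moreover have "at t0 within T \<inter> ball t0 e = at t0 within T"
    by (rule at_within_nhd[of _ "ball t0 e"]) (use e(1) in auto)
  ultimately have c: "continuous (at t0 within T) (crd_inv c \<circ> (\<lambda>s. crd c (F s (z s))))" by simp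
  show "continuous (at t0 within T) (\<lambda>s. F s (z s))"
    by (rule continuous_transform_within[OF c e(1) t0])
      (use eq e(2) c' in \<open>auto simp: dist_commute subset_iff\<close>)
qed

text \<open>In a chart the growth estimate spreads a zero to nearby times. The transformation law makes
  vanishing independent of the chart, so the argument continues when the curve leaves the chart.\<close>

lemma linearized_solutions_unique:
  assumes T: "is_interval T" and v: "smooth_field T v" and \<sigma>: "continuous_on T \<sigma>"
    and trans: "\<And>t c d. t \<in> T \<Longrightarrow> c \<in> charts_at A (\<sigma> t) \<Longrightarrow> d \<in> charts_at A (\<sigma> t) \<Longrightarrow> u t d = jac c d (\<sigma> t) *v u t c"
    and ode: "\<And>t c. t \<in> T \<Longrightarrow> c \<in> charts_at A (\<sigma> t) \<Longrightarrow> ((\<lambda>s. u s c) has_vector_derivative fmat v c t (\<sigma> t) *v u t c) (at t within T)"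
    and t1: "t1 \<in> T" "c1 \<in> charts_at A (\<sigma> t1)" "u t1 c1 = 0"
    and t: "t \<in> T" "c \<in> charts_at A (\<sigma> t)"
  shows "u t c = (0 :: real^'d)"
proof -
  have zero: "u t d = 0" if "t \<in> T" "c \<in> charts_at A (\<sigma> t)" "d \<in> charts_at A (\<sigma> t)" "u t c = 0" for t c d
    using trans[OF that(1,2,3)] that(4) by simp
  have "\<forall>c\<in>charts_at A (\<sigma> t). u t c = 0"
  proof (rule interval_induction[OF T t1(1) _ t(1), where P = "\<lambda>t. \<forall>c\<in>charts_at A (\<sigma> t). u t c = 0"])
    show "\<forall>c\<in>charts_at A (\<sigma> t1). u t1 c = 0" using zero[OF t1(1,2) _ t1(3)] by blast
    fix t0 assume t0: "t0 \<in> T"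
    obtain c where c: "c \<in> charts_at A (\<sigma> t0)" using ex_chart by blast
    have c': "c \<in> A" "\<sigma> t0 \<in> dom_of c" using c charts_atD by auto
    obtain \<alpha>1 \<beta>1 I1 \<rho> L K where l: "t0 \<in> {\<alpha>1..\<beta>1}" "{\<alpha>1..\<beta>1} \<subseteq> T" "open I1" "t0 \<in> I1" "T \<inter> I1 \<subseteq> {\<alpha>1..\<beta>1}" "0 < \<rho>" "0 < L"
      "K \<subseteq> crd c ` dom_of c" "cball (crd c (\<sigma> t0)) \<rho> \<subseteq> K"
      "\<And>t z x. t \<in> {\<alpha>1..\<beta>1} \<Longrightarrow> z \<in> K \<Longrightarrow> norm (frechet_derivative (fld v c t) (at z) x) \<le> L * norm x"
      using local_chart[OF T v t0 c] by metis
    define W where "W = dom_of c \<inter> crd c -` ball (crd c (\<sigma> t0)) \<rho>"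
    have W: "open W" "\<sigma> t0 \<in> W" unfolding W_def using open_crd_preimage[OF c'(1)] c' l(6) by auto
    obtain I2 where I2: "open I2" "t0 \<in> I2" "\<And>t. t \<in> T \<inter> I2 \<Longrightarrow> \<sigma> t \<in> W"
      using continuous_on_near[OF \<sigma> t0 W] by metis
    obtain e where e: "e > 0" "ball t0 e \<subseteq> I2" using I2(1,2) open_contains_ball by blast
    obtain \<alpha> \<beta> I where J: "t0 \<in> {\<alpha>..\<beta>}" "{\<alpha>..\<beta>} \<subseteq> {\<alpha>1..\<beta>1}" "\<beta> - \<alpha> < e" "open I" "t0 \<in> I" "{\<alpha>1..\<beta>1} \<inter> I \<subseteq> {\<alpha>..\<beta>}"
      using interval_neighbourhood[OF is_interval_cc l(1) e(1)] by metis
    have \<sigma>W: "\<sigma> s \<in> W" and cs: "c \<in> charts_at A (\<sigma> s)" and sT: "s \<in> T" if "s \<in> {\<alpha>..\<beta>}" for s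
    proof -
      have "s \<in> ball t0 e" using that J(1,3) by (auto simp: dist_real_def)
      then have "s \<in> I2" using e(2) by blast
      moreover show "s \<in> T" using that J(2) l(2) by blast
      ultimately show "\<sigma> s \<in> W" using I2(3) by blast
      then show "c \<in> charts_at A (\<sigma> s)" using c' by (auto simp: W_def charts_at_def)
    qed
    have bnd: "norm (fmat v c s (\<sigma> s) *v x) \<le> L * norm x" if s: "s \<in> {\<alpha>..\<beta>}" for s x
    proof -
      have "crd c (\<sigma> s) \<in> K" "\<sigma> s \<in> dom_of c" using \<sigma>W[OF s] l(9) by (auto simp: W_def)
      then show ?thesis
        using l(10)[of s "crd c (\<sigma> s)" x] s J(2) frechet_derivative_at[OF fld_has_derivative[OF v c'(1) sT[OF s], of "\<sigma> s"]]
        by (auto simp: subset_iff)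
    qed
    have "u y c = 0" if "x \<in> {\<alpha>..\<beta>}" "y \<in> {\<alpha>..\<beta>}" "u x c = 0" for x y
    proof -
      have "norm (u y c) \<le> 2 * (norm (u x c) + 0 * (\<beta> - \<alpha>)) * exp (2 * L * (\<beta> - \<alpha>))"
      proof (rule growth_estimate[OF that(1,2) l(7)])
        show "((\<lambda>s. u s c) has_vector_derivative fmat v c s (\<sigma> s) *v u s c) (at s within {\<alpha>..\<beta>})" if "s \<in> {\<alpha>..\<beta>}" for s
          using J(2) l(2) by (intro has_vector_derivative_within_subset[OF ode[OF sT[OF that] cs[OF that]]]) auto
      qed (use bnd in auto)
      then show ?thesis using that(3) by simp
    qed
    moreover have "T \<inter> (I1 \<inter> I) \<subseteq> {\<alpha>..\<beta>}" using J(6) l(5) by blast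
    ultimately have "\<forall>x\<in>T \<inter> (I1 \<inter> I). \<forall>y\<in>T \<inter> (I1 \<inter> I). (\<forall>c\<in>charts_at A (\<sigma> x). u x c = 0) \<longrightarrow> (\<forall>c\<in>charts_at A (\<sigma> y). u y c = 0)"
      using cs sT zero by (meson subsetD)
    then show "\<exists>I. open I \<and> t0 \<in> I \<and> (\<forall>x\<in>T \<inter> I. \<forall>y\<in>T \<inter> I. (\<forall>c\<in>charts_at A (\<sigma> x). u x c = 0) \<longrightarrow> (\<forall>c\<in>charts_at A (\<sigma> y). u y c = 0))"
      using l(3,4) J(4,5) by (intro exI[of _ "I1 \<inter> I"]) auto
  qed
  then show ?thesis using t(2) by blast
qed

end

context manifold
begin

section \<open>Partial derivatives in a chart\<close>

definition smooth_in :: "('a, 'd) chart \<Rightarrow> ('a \<Rightarrow> 'f::real_normed_vector) \<Rightarrow> bool" where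
  "smooth_in c g \<longleftrightarrow> smooth_on (crd c ` dom_of c) (g \<circ> crd_inv c)"

lemma smooth_function_smooth_in: "smooth_function A f \<Longrightarrow> c \<in> A \<Longrightarrow> smooth_in c f"
  by (simp add: smooth_function_def smooth_in_def)

lemma smooth_in_has_derivative:
  assumes "smooth_in c g" "p \<in> dom_of c"
  shows "((g \<circ> crd_inv c) has_derivative frechet_derivative (g \<circ> crd_inv c) (at (crd c p))) (at (crd c p))"
  by (rule smooth_on_has_derivative[OF assms(1)[unfolded smooth_in_def]]) (use assms(2) in auto)

lemma smooth_in_family: "smooth_in c g \<longleftrightarrow> (\<forall>n. Ck_family n {0} (crd c ` dom_of c) (\<lambda>t. g \<circ> crd_inv c))"
  unfolding smooth_in_def smooth_on_iff_smooth_family smooth_family_def by (rule refl)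

lemma smooth_in_const: "c \<in> A \<Longrightarrow> smooth_in c (\<lambda>q. k)"
  unfolding smooth_in_family o_def by (rule allI, rule Ck_family_time_only[OF open_img continuous_on_const])

lemma smooth_in_mult:
  fixes f g :: "'a \<Rightarrow> real"
  shows "c \<in> A \<Longrightarrow> smooth_in c f \<Longrightarrow> smooth_in c g \<Longrightarrow> smooth_in c (\<lambda>q. f q * g q)"
  unfolding smooth_in_family o_def by (rule allI, rule Ck_family_mult[OF open_img]) auto

lemma smooth_in_sum:
  "c \<in> A \<Longrightarrow> (\<And>i. i \<in> I \<Longrightarrow> smooth_in c (f i)) \<Longrightarrow> smooth_in c (\<lambda>q. \<Sum>i\<in>I. f i q)"
  unfolding smooth_in_family o_def by (rule allI, rule Ck_family_sum[OF open_img]) auto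

lemma smooth_in_bounded_linear:
  "c \<in> A \<Longrightarrow> bounded_linear L \<Longrightarrow> smooth_in c f \<Longrightarrow> smooth_in c (\<lambda>q. L (f q))"
  unfolding smooth_in_family o_def by (rule allI, rule Ck_family_bounded_linear[OF open_img]) auto

lemma smooth_in_vecI:
  fixes f :: "'a \<Rightarrow> ('f::euclidean_space)^'m"
  assumes "c \<in> A" "\<And>i. smooth_in c (\<lambda>q. f q $ i)"
  shows "smooth_in c f"
  unfolding smooth_in_family o_def
  by (rule allI, rule Ck_family_vecI[OF open_img[OF assms(1)]]) (use assms(2)[unfolded smooth_in_family o_def] in blast)

lemma smooth_in_nth:
  fixes f :: "'a \<Rightarrow> ('f::real_normed_vector)^'m"
  shows "c \<in> A \<Longrightarrow> smooth_in c f \<Longrightarrow> smooth_in c (\<lambda>q. f q $ i)"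
  by (rule smooth_in_bounded_linear[OF _ bounded_linear_vec_nth])

lemma smooth_in_pd:
  assumes "c \<in> A" "smooth_in c f"
  shows "smooth_in c (pd c j f)"
proof -
  have "smooth_on (crd c ` dom_of c) (\<lambda>\<zeta>. frechet_derivative (f \<circ> crd_inv c) (at \<zeta>) (axis j 1))"
    using assms(2) unfolding smooth_in_def by (rule smooth_on_frechet_derivative)
  then show ?thesis unfolding smooth_in_def
    by (subst smooth_on_cong[OF open_img[OF assms(1)]]) (auto simp: pd_def assms(1))
qed

lemma pd_cong:
  assumes "c \<in> A" "open V" "p \<in> V" "p \<in> dom_of c" "\<And>q. q \<in> V \<Longrightarrow> q \<in> dom_of c \<Longrightarrow> f q = g q"
  shows "pd c j f p = pd c j g p"
proof -
  have "open (crd c ` (V \<inter> dom_of c))" by (intro open_crd_image open_Int open_dom assms) auto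
  then have "frechet_derivative (f \<circ> crd_inv c) (at (crd c p)) = frechet_derivative (g \<circ> crd_inv c) (at (crd c p))"
    by (rule frechet_derivative_cong_open) (use assms in auto)
  then show ?thesis by (simp add: pd_def)
qed

lemma pd_eqI:
  assumes "((f \<circ> crd_inv c) has_derivative D) (at (crd c p))"
  shows "pd c j f p = D (axis j 1)"
  unfolding pd_def frechet_derivative_at[OF assms, symmetric] by (rule refl)

lemma pd_mult_at:
  assumes "(f \<circ> crd_inv c) differentiable (at (crd c p))" "(g \<circ> crd_inv c) differentiable (at (crd c p))" "p \<in> dom_of c" "c \<in> A"
  shows "pd c j (\<lambda>q. f q * g q) p = pd c j f p * g p + f p * pd c j g p"
proof -
  have "((\<lambda>\<zeta>. (f \<circ> crd_inv c) \<zeta> * (g \<circ> crd_inv c) \<zeta>) has_derivative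
     (\<lambda>h. (f \<circ> crd_inv c) (crd c p) * frechet_derivative (g \<circ> crd_inv c) (at (crd c p)) h +
       frechet_derivative (f \<circ> crd_inv c) (at (crd c p)) h * (g \<circ> crd_inv c) (crd c p))) (at (crd c p))"
    by (intro has_derivative_mult assms(1,2)[unfolded frechet_derivative_works])
  then have "(((\<lambda>q. f q * g q) \<circ> crd_inv c) has_derivative
     (\<lambda>h. f p * frechet_derivative (g \<circ> crd_inv c) (at (crd c p)) h +
       frechet_derivative (f \<circ> crd_inv c) (at (crd c p)) h * g p)) (at (crd c p))"
    using assms by (simp add: o_def)
  from pd_eqI[OF this] show ?thesis by (simp add: pd_def)
qed

lemma pd_sum_at:
  assumes "\<And>i. i \<in> I \<Longrightarrow> (f i \<circ> crd_inv c) differentiable (at (crd c p))"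
  shows "pd c j (\<lambda>q. \<Sum>i\<in>I. f i q) p = (\<Sum>i\<in>I. pd c j (f i) p)"
proof -
  have "(((\<lambda>q. \<Sum>i\<in>I. f i q) \<circ> crd_inv c) has_derivative
      (\<lambda>h. \<Sum>i\<in>I. frechet_derivative (f i \<circ> crd_inv c) (at (crd c p)) h)) (at (crd c p))"
    using has_derivative_sum[of I "\<lambda>i. f i \<circ> crd_inv c" _ "at (crd c p)"] assms[unfolded frechet_derivative_works]
    by (simp add: o_def)
  from pd_eqI[OF this] show ?thesis by (simp add: pd_def)
qed

lemma smooth_in_differentiable: "smooth_in c g \<Longrightarrow> p \<in> dom_of c \<Longrightarrow> (g \<circ> crd_inv c) differentiable (at (crd c p))"
  unfolding frechet_derivative_works by (rule smooth_in_has_derivative)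

lemma pd_mult:
  "smooth_in c f \<Longrightarrow> smooth_in c g \<Longrightarrow> p \<in> dom_of c \<Longrightarrow> c \<in> A \<Longrightarrow>
    pd c j (\<lambda>q. f q * g q) p = pd c j f p * g p + f p * pd c j g p"
  by (rule pd_mult_at[OF smooth_in_differentiable smooth_in_differentiable])

lemma pd_sum:
  "(\<And>i. i \<in> I \<Longrightarrow> smooth_in c (f i)) \<Longrightarrow> p \<in> dom_of c \<Longrightarrow>
    pd c j (\<lambda>q. \<Sum>i\<in>I. f i q) p = (\<Sum>i\<in>I. pd c j (f i) p)"
  by (rule pd_sum_at[OF smooth_in_differentiable])

lemma pd_const: "pd c j (\<lambda>q. k) p = 0"
  by (rule pd_eqI[where D = "\<lambda>h. 0"]) (simp add: o_def)

lemma pd_cmult: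
  assumes "c \<in> A" "smooth_in c f" "p \<in> dom_of c"
  shows "pd c j (\<lambda>q. k * f q) p = k * pd c j f p"
  using pd_mult[OF smooth_in_const[OF assms(1), of k] assms(2,3,1)] by (simp add: pd_const)

lemma pd_diff:
  assumes "smooth_in c f" "smooth_in c g" "p \<in> dom_of c"
  shows "pd c j (\<lambda>q. f q - g q) p = pd c j f p - pd c j g p"
proof -
  have "(((\<lambda>q. f q - g q) \<circ> crd_inv c) has_derivative
     (\<lambda>h. frechet_derivative (f \<circ> crd_inv c) (at (crd c p)) h -
       frechet_derivative (g \<circ> crd_inv c) (at (crd c p)) h)) (at (crd c p))"
    using has_derivative_diff[OF smooth_in_has_derivative[OF assms(1,3)] smooth_in_has_derivative[OF assms(2,3)]]
    by (simp add: o_def)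
  from pd_eqI[OF this] show ?thesis by (simp add: pd_def)
qed

lemma pd_symmetric:
  assumes "c \<in> A" "smooth_in c f" "p \<in> dom_of c"
  shows "pd c j (pd c k f) p = pd c k (pd c j f) p"
proof -
  have "pd c j (pd c k f) p = frechet_derivative (\<lambda>\<zeta>. frechet_derivative (f \<circ> crd_inv c) (at \<zeta>) (axis k 1)) (at (crd c p)) (axis j 1)" for j k
  proof -
    have "frechet_derivative (pd c k f \<circ> crd_inv c) (at (crd c p)) =
        frechet_derivative (\<lambda>\<zeta>. frechet_derivative (f \<circ> crd_inv c) (at \<zeta>) (axis k 1)) (at (crd c p))"
      by (rule frechet_derivative_cong_open[OF open_img[OF assms(1)]]) (use assms in \<open>auto simp: pd_def\<close>)
    then show ?thesis by (simp add: pd_def[of c j])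
  qed
  then show ?thesis
    using second_derivative_symmetric[OF open_img[OF assms(1)] assms(2)[unfolded smooth_in_def], of "crd c p"] assms(3) by auto
qed

lemma smooth_in_gradient:
  fixes f :: "'a \<Rightarrow> real"
  assumes "smooth_in c f" "p \<in> dom_of c"
  shows "((f \<circ> crd_inv c) has_derivative (\<lambda>h. \<Sum>j\<in>UNIV. h $ j * pd c j f p)) (at (crd c p))"
proof -
  note D = smooth_in_has_derivative[OF assms]
  have "frechet_derivative (f \<circ> crd_inv c) (at (crd c p)) h = (\<Sum>j\<in>UNIV. h $ j * pd c j f p)" for h
  proof -
    have "frechet_derivative (f \<circ> crd_inv c) (at (crd c p)) (\<Sum>j\<in>UNIV. h $ j *\<^sub>R axis j 1) = (\<Sum>j\<in>UNIV. h $ j * pd c j f p)"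
      by (simp add: linear_sum[OF has_derivative_linear[OF D]] linear_scale[OF has_derivative_linear[OF D]] pd_def)
    then show ?thesis using basis_expansion[of h] by (simp add: scalar_mult_eq_scaleR)
  qed
  then have "frechet_derivative (f \<circ> crd_inv c) (at (crd c p)) = (\<lambda>h. \<Sum>j\<in>UNIV. h $ j * pd c j f p)"
    by (rule ext)
  then show ?thesis using D by simp
qed

lemma gradient_compose:
  assumes a: "a \<in> charts_at A x" and c: "c \<in> charts_at A (F x)" and f: "smooth_in c f"
    and "isCont F x" and F: "has_dmap a c F x M"
  shows "((f \<circ> F) \<circ> crd_inv a has_derivative (\<lambda>h. \<Sum>j\<in>UNIV. h $ j * pd c j f (F x)) \<circ> (*v) M) (at (crd a x))"
proof -
  have a': "a \<in> A" "x \<in> dom_of a" and c': "c \<in> A" "F x \<in> dom_of c" using a c charts_atD by auto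
  have "((f \<circ> crd_inv c) \<circ> (crd c \<circ> F \<circ> crd_inv a) has_derivative (\<lambda>h. \<Sum>j\<in>UNIV. h $ j * pd c j f (F x)) \<circ> (*v) M) (at (crd a x))"
    using F smooth_in_gradient[OF f c'(2)] a' unfolding has_dmap_def by (intro diff_chain_at) auto
  moreover obtain U where U: "open U" "x \<in> U" "\<And>z. z \<in> U \<Longrightarrow> F z \<in> dom_of c"
    using assms(4) open_dom[OF c'(1)] c'(2) unfolding continuous_at_open by metis
  moreover have "open (crd a ` (U \<inter> dom_of a))" by (intro open_crd_image open_Int open_dom U a') auto
  ultimately show ?thesis
    by (elim has_derivative_transform_within_open) (use U a' c' in auto)
qed

lemma pd_compose:
  assumes a: "a \<in> charts_at A x" and c: "c \<in> charts_at A (F x)" and f: "smooth_in c f"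
    and "isCont F x" and F: "has_dmap a c F x M"
  shows "pd a j (f \<circ> F) x = (\<Sum>m\<in>UNIV. pd c m f (F x) * M $ m $ j)"
  using pd_eqI[OF gradient_compose[OF assms], of j]
  by (simp add: matrix_vector_mult_basis column_def mult.commute)

lemma pd_along_curve:
  fixes f :: "'a \<Rightarrow> real"
  assumes f: "smooth_in c f" and "c \<in> A" "t \<in> T" "\<gamma> t \<in> dom_of c" and cont: "continuous_on T \<gamma>"
    and d: "((\<lambda>s. crd c (\<gamma> s)) has_vector_derivative w) (at t within T)"
  shows "((\<lambda>s. f (\<gamma> s)) has_vector_derivative (\<Sum>j\<in>UNIV. w $ j * pd c j f (\<gamma> t))) (at t within T)"
proof -
  have "(((f \<circ> crd_inv c) \<circ> (\<lambda>s. crd c (\<gamma> s))) has_derivative (\<lambda>h. \<Sum>j\<in>UNIV. h $ j * pd c j f (\<gamma> t)) \<circ> (\<lambda>x. x *\<^sub>R w)) (at t within T)"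
    using d smooth_in_gradient[OF f assms(4)] unfolding has_vector_derivative_def
    by (intro diff_chain_within) (auto intro: has_derivative_at_withinI)
  then have D: "((\<lambda>s. f (crd_inv c (crd c (\<gamma> s)))) has_vector_derivative (\<Sum>j\<in>UNIV. w $ j * pd c j f (\<gamma> t))) (at t within T)"
    by (simp add: o_def has_vector_derivative_def sum_distrib_left mult.assoc)
  obtain I where I: "open I" "t \<in> I" "\<And>s. s \<in> T \<inter> I \<Longrightarrow> \<gamma> s \<in> dom_of c"
    using continuous_on_near[OF cont assms(3) open_dom[OF assms(2)] assms(4)] by metis
  obtain e where e: "e > 0" "ball t e \<subseteq> I" using I open_contains_ball by blast
  show ?thesis
    by (rule has_vector_derivative_transform_within[OF D e(1) assms(3)])
      (use I(3) e(2) assms(2) in \<open>auto simp: dist_commute subset_iff\<close>)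
qed

lemma fmat_entry:
  assumes "c \<in> A" "smooth_in c (\<lambda>q. v t q c)" "p \<in> dom_of c"
  shows "fmat v c t p $ m $ l = pd c l (\<lambda>q. v t q c $ m) p"
proof -
  have "((\<lambda>\<zeta>. v t (crd_inv c \<zeta>) c $ m) has_derivative (\<lambda>h. frechet_derivative (\<lambda>\<zeta>. v t (crd_inv c \<zeta>) c) (at (crd c p)) h $ m)) (at (crd c p))"
    using smooth_in_has_derivative[OF assms(2,3)]
    by (intro bounded_linear.has_derivative[OF bounded_linear_vec_nth]) (simp add: o_def)
  then have "pd c l (\<lambda>q. v t q c $ m) p = frechet_derivative (\<lambda>\<zeta>. v t (crd_inv c \<zeta>) c) (at (crd c p)) (axis l 1) $ m"
    by (intro pd_eqI) (simp add: o_def)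
  then show ?thesis by (simp add: fmat_def fld_def[abs_def] matrix_def)
qed

end

section \<open>Hamiltonian vector fields\<close>

lemma bounded_bilinear_matrix_vector_mult: "bounded_bilinear ((*v) :: real^'m^'n \<Rightarrow> real^'m \<Rightarrow> real^'n)"
  unfolding bilinear_conv_bounded_bilinear[symmetric] bilinear_def
  by (auto intro!: linearI simp: matrix_vector_mult_add_rdistrib matrix_vector_right_distrib
      matrix_vector_mult_scaleR scaleR_matrix_vector_assoc)

lemma inner_matrix_vector: "(M *v u) \<bullet> w = u \<bullet> (transpose M *v w)" for M :: "real^'m^'n"
  by (metis dot_lmul_matrix inner_commute transpose_matrix_vector transpose_transpose)

locale symplectic_manifold = manifold A
  for A :: "('a::{t2_space, second_countable_topology}, 'd::finite) chart set" +
  fixes \<omega> :: "('a, 'd) two_form"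
  assumes symplectic: "symplectic_form A \<omega>"
begin

lemma smooth_omega: "c \<in> A \<Longrightarrow> smooth_in c (\<omega> c)"
  unfolding smooth_in_def by (rule bspec[OF conjunct1[OF symplectic[unfolded symplectic_form_def]]])

lemma omega_transform:
  "c \<in> charts_at A p \<Longrightarrow> d \<in> charts_at A p \<Longrightarrow> \<omega> c p = transpose (jac c d p) ** \<omega> d p ** jac c d p"
  by (rule bspec[OF bspec[OF spec[OF conjunct1[OF conjunct2[OF symplectic[unfolded symplectic_form_def]]]]]])

lemma omega_at:
  assumes "c \<in> A" "p \<in> dom_of c"
  shows "transpose (\<omega> c p) = - \<omega> c p \<and> invertible (\<omega> c p) \<and>
    (\<forall>i j k. pd c i (\<lambda>q. \<omega> c q $ j $ k) p + pd c j (\<lambda>q. \<omega> c q $ k $ i) p + pd c k (\<lambda>q. \<omega> c q $ i $ j) p = 0)"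
  by (rule bspec[OF spec[OF conjunct2[OF conjunct2[OF symplectic[unfolded symplectic_form_def]]]] charts_atI[OF assms]])

lemma omega_skew:
  assumes "c \<in> A" "p \<in> dom_of c"
  shows "\<omega> c p $ j $ k = - \<omega> c p $ k $ j"
proof -
  have "transpose (\<omega> c p) $ k $ j = (- \<omega> c p) $ k $ j" by (simp only: conjunct1[OF omega_at[OF assms]])
  then show ?thesis by (simp add: transpose_def)
qed

lemma omega_invertible: "c \<in> A \<Longrightarrow> p \<in> dom_of c \<Longrightarrow> invertible (\<omega> c p)"
  by (rule conjunct1[OF conjunct2[OF omega_at]])

lemma omega_closed: "c \<in> A \<Longrightarrow> p \<in> dom_of c \<Longrightarrow>
    pd c i (\<lambda>q. \<omega> c q $ j $ k) p + pd c j (\<lambda>q. \<omega> c q $ k $ i) p + pd c k (\<lambda>q. \<omega> c q $ i $ j) p = 0"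
  by (rule conjunct2[OF conjunct2[OF omega_at], rule_format])

lemma smooth_omega_entry: "c \<in> A \<Longrightarrow> smooth_in c (\<lambda>q. \<omega> c q $ j $ k)"
  by (rule smooth_in_nth[OF _ smooth_in_nth[OF _ smooth_omega]])

lemma omega_poisson:
  assumes "c \<in> A" "p \<in> dom_of c"
  shows "\<omega> c p ** poisson \<omega> c p = mat 1" "poisson \<omega> c p ** \<omega> c p = mat 1"
  using matrix_inv_mult[OF omega_invertible[OF assms]] by (auto simp: poisson_def)

lemma poisson_skew:
  assumes "c \<in> A" "p \<in> dom_of c"
  shows "transpose (poisson \<omega> c p) = - poisson \<omega> c p"
proof -
  let ?W = "\<omega> c p" and ?P = "poisson \<omega> c p"
  have tW: "transpose ?W = - ?W" by (rule conjunct1[OF omega_at[OF assms]])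
  have "?W ** transpose ?P = - (transpose ?W ** transpose ?P)"
    by (simp add: tW matrix_matrix_mult_def vec_eq_iff sum_negf)
  also have "\<dots> = - mat 1"
    by (simp add: matrix_transpose_mul[symmetric] omega_poisson[OF assms] transpose_mat)
  finally have "?P ** (?W ** transpose ?P) = ?P ** (- mat 1)" by simp
  then have "transpose ?P = ?P ** (- mat 1)"
    by (simp add: matrix_mul_assoc omega_poisson[OF assms])
  also have "\<dots> = - (?P ** mat 1)" by (simp add: matrix_matrix_mult_def vec_eq_iff sum_negf)
  finally show ?thesis by simp
qed

lemma smooth_poisson:
  assumes "c \<in> A"
  shows "smooth_in c (poisson \<omega> c)"
proof -
  have "Ck_family n {0} (crd c ` dom_of c) (\<lambda>t. poisson \<omega> c \<circ> crd_inv c)" for n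
    unfolding poisson_def[abs_def] o_def
    using smooth_omega[OF assms] omega_invertible[OF assms]
    by (intro Ck_family_matrix_inv[OF open_img[OF assms]]) (auto simp: smooth_in_family o_def assms)
  then show ?thesis by (simp add: smooth_in_family)
qed

lemma ham_field_omega:
  assumes "c \<in> A" "p \<in> dom_of c"
  shows "(\<Sum>m\<in>UNIV. ham_field \<omega> f p c $ m * \<omega> c p $ m $ i) = pd c i f p"
proof -
  have "(\<Sum>m\<in>UNIV. ham_field \<omega> f p c $ m * \<omega> c p $ m $ i) =
    (\<Sum>m\<in>UNIV. \<Sum>j\<in>UNIV. pd c j f p * (poisson \<omega> c p $ j $ m * \<omega> c p $ m $ i))"
    by (simp add: ham_field_def sum_distrib_right mult.assoc)
  also have "\<dots> = (\<Sum>j\<in>UNIV. pd c j f p * (poisson \<omega> c p ** \<omega> c p) $ j $ i)"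
    by (subst sum.swap) (simp add: matrix_matrix_mult_def sum_distrib_left)
  also have "\<dots> = pd c i f p"
    by (simp add: omega_poisson[OF assms] mat_def if_distrib[of "\<lambda>x. _ * x"] cong: if_cong)
  finally show ?thesis .
qed

lemma smooth_ham_field:
  assumes "c \<in> A" "smooth_in c f"
  shows "smooth_in c (\<lambda>q. ham_field \<omega> f q c)"
proof (rule smooth_in_vecI[OF assms(1)])
  fix m
  have "smooth_in c (\<lambda>q. poisson \<omega> c q $ j $ m)" for j
    by (rule smooth_in_nth[OF assms(1) smooth_in_nth[OF assms(1) smooth_poisson[OF assms(1)]]])
  then show "smooth_in c (\<lambda>q. ham_field \<omega> f q c $ m)"
    using assms by (auto simp: ham_field_def intro!: smooth_in_sum smooth_in_mult smooth_in_pd)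
qed

lemma smooth_ham_field_entry: "c \<in> A \<Longrightarrow> smooth_in c f \<Longrightarrow> smooth_in c (\<lambda>q. ham_field \<omega> f q c $ m)"
  by (rule smooth_in_nth[OF _ smooth_ham_field])

lemma pd_ham_field_omega:
  assumes "c \<in> A" "p \<in> dom_of c" "smooth_in c f"
  shows "(\<Sum>m\<in>UNIV. pd c l (\<lambda>q. ham_field \<omega> f q c $ m) p * \<omega> c p $ m $ i +
      ham_field \<omega> f p c $ m * pd c l (\<lambda>q. \<omega> c q $ m $ i) p) = pd c l (pd c i f) p"
proof -
  have "pd c l (pd c i f) p = pd c l (\<lambda>q. \<Sum>m\<in>UNIV. ham_field \<omega> f q c $ m * \<omega> c q $ m $ i) p"
    by (rule pd_cong[OF assms(1) open_dom[OF assms(1)] assms(2,2)]) (simp add: ham_field_omega[OF assms(1)])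
  also have "\<dots> = (\<Sum>m\<in>UNIV. pd c l (\<lambda>q. ham_field \<omega> f q c $ m * \<omega> c q $ m $ i) p)"
    using assms by (intro pd_sum smooth_in_mult smooth_ham_field_entry smooth_omega_entry)
  also have "\<dots> = (\<Sum>m\<in>UNIV. pd c l (\<lambda>q. ham_field \<omega> f q c $ m) p * \<omega> c p $ m $ i +
      ham_field \<omega> f p c $ m * pd c l (\<lambda>q. \<omega> c q $ m $ i) p)"
    using assms by (intro sum.cong refl pd_mult smooth_ham_field_entry smooth_omega_entry)
  finally show ?thesis ..
qed

text \<open>Cartan's formula: by closedness of \<open>\<omega>\<close> the components of the Lie derivative are those of the exterior
  derivative of \<open>h \<omega> = df\<close>, and they vanish by the symmetry of second derivatives.\<close>

lemma lie_derivative_omega: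
  assumes "c \<in> A" "p \<in> dom_of c" "smooth_in c (f t)"
  shows "transpose (fmat (\<lambda>t. ham_field \<omega> (f t)) c t p) ** \<omega> c p
     + (\<chi> l i. \<Sum>m\<in>UNIV. ham_field \<omega> (f t) p c $ m * pd c m (\<lambda>q. \<omega> c q $ l $ i) p)
     + \<omega> c p ** fmat (\<lambda>t. ham_field \<omega> (f t)) c t p = 0"
proof -
  define N where "N = fmat (\<lambda>t. ham_field \<omega> (f t)) c t p"
  define h where "h = ham_field \<omega> (f t) p c"
  have N: "N $ m $ l = pd c l (\<lambda>q. ham_field \<omega> (f t) q c $ m) p" for m l
    unfolding N_def by (rule fmat_entry[where v = "\<lambda>t. ham_field \<omega> (f t)", OF assms(1) smooth_ham_field[OF assms(1,3)] assms(2)])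
  have key: "(\<Sum>m\<in>UNIV. N $ m $ l * \<omega> c p $ m $ i) = pd c l (pd c i (f t)) p - (\<Sum>m\<in>UNIV. h $ m * pd c l (\<lambda>q. \<omega> c q $ m $ i) p)" for l i
    using pd_ham_field_omega[OF assms, of l i] by (simp add: N h_def sum.distrib)
  have skew_pd: "pd c i (\<lambda>q. \<omega> c q $ j $ k) p = - pd c i (\<lambda>q. \<omega> c q $ k $ j) p" for i j k
  proof -
    have "pd c i (\<lambda>q. \<omega> c q $ j $ k) p = pd c i (\<lambda>q. - 1 * \<omega> c q $ k $ j) p"
      by (rule pd_cong[OF assms(1) open_dom[OF assms(1)] assms(2,2)]) (simp add: omega_skew[OF assms(1), of _ j k])
    then show ?thesis using pd_cmult[OF assms(1) smooth_omega_entry[OF assms(1)] assms(2), of i "- 1"] by simp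
  qed
  have "(transpose N ** \<omega> c p + (\<chi> l i. \<Sum>m\<in>UNIV. h $ m * pd c m (\<lambda>q. \<omega> c q $ l $ i) p) + \<omega> c p ** N) $ l $ i = 0" for l i
  proof -
    have 1: "(transpose N ** \<omega> c p) $ l $ i = (\<Sum>m\<in>UNIV. N $ m $ l * \<omega> c p $ m $ i)"
      by (simp add: matrix_matrix_mult_def transpose_def)
    have 2: "(\<omega> c p ** N) $ l $ i = - (\<Sum>m\<in>UNIV. N $ m $ i * \<omega> c p $ m $ l)"
    proof -
      have "(\<omega> c p ** N) $ l $ i = (\<Sum>m\<in>UNIV. \<omega> c p $ l $ m * N $ m $ i)" by (simp add: matrix_matrix_mult_def)
      also have "\<dots> = (\<Sum>m\<in>UNIV. - (N $ m $ i * \<omega> c p $ m $ l))"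
        by (rule sum.cong[OF refl]) (subst omega_skew[OF assms(1,2), of l], simp add: mult.commute)
      finally show ?thesis by (simp add: sum_negf)
    qed
    have "(\<Sum>m\<in>UNIV. h $ m * pd c m (\<lambda>q. \<omega> c q $ l $ i) p) - (\<Sum>m\<in>UNIV. h $ m * pd c l (\<lambda>q. \<omega> c q $ m $ i) p)
       + (\<Sum>m\<in>UNIV. h $ m * pd c i (\<lambda>q. \<omega> c q $ m $ l) p) =
      (\<Sum>m\<in>UNIV. h $ m * (pd c m (\<lambda>q. \<omega> c q $ l $ i) p - pd c l (\<lambda>q. \<omega> c q $ m $ i) p + pd c i (\<lambda>q. \<omega> c q $ m $ l) p))"
      by (simp add: sum_subtractf sum.distrib algebra_simps)
    also have "\<dots> = 0"
    proof (rule sum.neutral, intro ballI)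
      fix m
      have "pd c m (\<lambda>q. \<omega> c q $ l $ i) p - pd c l (\<lambda>q. \<omega> c q $ m $ i) p + pd c i (\<lambda>q. \<omega> c q $ m $ l) p = 0"
        using omega_closed[OF assms(1,2), of m l i] skew_pd[of l m i] by simp
      then show "h $ m * (pd c m (\<lambda>q. \<omega> c q $ l $ i) p - pd c l (\<lambda>q. \<omega> c q $ m $ i) p + pd c i (\<lambda>q. \<omega> c q $ m $ l) p) = 0"
        by simp
    qed
    finally show ?thesis
      using pd_symmetric[OF assms(1,3,2), of l i] by (simp add: 1 2 key)
  qed
  then show ?thesis unfolding N_def h_def by (simp add: vec_eq_iff)
qed

definition smooth_time :: "real set \<Rightarrow> (real \<Rightarrow> 'a \<Rightarrow> real) \<Rightarrow> bool" where
  "smooth_time T f \<longleftrightarrow> (\<forall>c\<in>A. smooth_family T (crd c ` dom_of c) (\<lambda>t. f t \<circ> crd_inv c))"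

lemma smooth_time_smooth_in: "smooth_time T f \<Longrightarrow> t \<in> T \<Longrightarrow> c \<in> A \<Longrightarrow> smooth_in c (f t)"
  unfolding smooth_time_def smooth_in_def using smooth_family_imp_smooth_on by blast

lemma smooth_field_ham:
  assumes "smooth_time T f"
  shows "smooth_field T (\<lambda>t. ham_field \<omega> (f t))"
  unfolding smooth_field_def smooth_family_def
proof (intro ballI allI)
  fix c n assume c: "c \<in> A"
  let ?S = "crd c ` dom_of c"
  note S = open_img[OF c]
  have "Ck_family n T ?S (\<lambda>t. poisson \<omega> c \<circ> crd_inv c)"
    using smooth_poisson[OF c] unfolding smooth_in_def smooth_on_def by (blast intro: Ck_on_imp_Ck_family)
  then have P: "Ck_family n T ?S (\<lambda>t \<zeta>. poisson \<omega> c (crd_inv c \<zeta>) $ j $ m)" for j m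
    by (intro Ck_family_nth[OF S]) (simp add: o_def)
  have "Ck_family n T ?S (\<lambda>t \<zeta>. frechet_derivative (f t \<circ> crd_inv c) (at \<zeta>) (axis j 1))" for j
    using smooth_family_derivative[of T ?S "\<lambda>t. f t \<circ> crd_inv c"] assms c unfolding smooth_time_def smooth_family_def by blast
  then have "Ck_family n T ?S (\<lambda>t \<zeta>. pd c j (f t) (crd_inv c \<zeta>))" for j
    by (subst Ck_family_cong[OF S]) (auto simp: pd_def c)
  then have "Ck_family n T ?S (\<lambda>t \<zeta>. ham_field \<omega> (f t) (crd_inv c \<zeta>) c $ m)" for m
    using P by (auto simp: ham_field_def intro!: Ck_family_sum[OF S] Ck_family_mult[OF S])
  then show "Ck_family n T ?S (fld (\<lambda>t. ham_field \<omega> (f t)) c)"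
    unfolding fld_def[abs_def] by (rule Ck_family_vecI[OF S])
qed

section \<open>Hamiltonian flows preserve the symplectic form\<close>

definition preserves_omega_at :: "('a \<Rightarrow> 'a) \<Rightarrow> 'a \<Rightarrow> bool" where
  "preserves_omega_at F x \<longleftrightarrow> (\<forall>a\<in>charts_at A x. \<forall>c\<in>charts_at A (F x).
     transpose (dmap a c F x) ** \<omega> c (F x) ** dmap a c F x = \<omega> a x)"

lemma dmap_change_target:
  assumes "smooth_at F x" "a \<in> charts_at A x" "c \<in> charts_at A (F x)" "d \<in> charts_at A (F x)"
  shows "dmap a d F x = jac c d (F x) ** dmap a c F x"
  using has_dmap_imp_dmap[OF has_dmap_compose[OF assms(2,3) smooth_at_continuous[OF assms(1)]
    smooth_at_has_dmap[OF assms(1-3)] has_dmap_jac[OF assms(3,4)]]] by (simp add: o_def)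

lemma dmap_change_source:
  assumes "smooth_at F x" "a \<in> charts_at A x" "b \<in> charts_at A x" "c \<in> charts_at A (F x)"
  shows "dmap a c F x = dmap b c F x ** jac a b x"
proof -
  have "has_dmap a c (F \<circ> id) x (dmap b c F x ** jac a b x)"
    by (rule has_dmap_compose[where b = b]) (use assms smooth_at_has_dmap has_dmap_jac in \<open>auto simp: continuous_ident[unfolded id_def[symmetric]]\<close>)
  then show ?thesis by (simp add: has_dmap_imp_dmap)
qed

text \<open>One pair of charts suffices, by the transformation laws of \<open>\<omega>\<close> and of the differential.\<close>

lemma preserves_omega_atI:
  assumes "smooth_at F x" "a \<in> charts_at A x" "c \<in> charts_at A (F x)"
    "transpose (dmap a c F x) ** \<omega> c (F x) ** dmap a c F x = \<omega> a x"
  shows "preserves_omega_at F x"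
  unfolding preserves_omega_at_def
proof (intro ballI)
  fix b d assume b: "b \<in> charts_at A x" and d: "d \<in> charts_at A (F x)"
  have 1: "dmap b c F x = dmap a c F x ** jac b a x" by (rule dmap_change_source[OF assms(1) b assms(2,3)])
  have 2: "dmap b c F x = jac d c (F x) ** dmap b d F x" by (rule dmap_change_target[OF assms(1) b d assms(3)])
  have "transpose (dmap b d F x) ** \<omega> d (F x) ** dmap b d F x =
      transpose (jac d c (F x) ** dmap b d F x) ** \<omega> c (F x) ** (jac d c (F x) ** dmap b d F x)"
    by (simp add: omega_transform[OF d assms(3)] matrix_transpose_mul matrix_mul_assoc)
  also have "\<dots> = transpose (jac b a x) ** (transpose (dmap a c F x) ** \<omega> c (F x) ** dmap a c F x) ** jac b a x"
    by (simp add: 2[symmetric] 1 matrix_transpose_mul matrix_mul_assoc)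
  also have "\<dots> = \<omega> b x" by (simp add: assms(4) omega_transform[OF b assms(2)])
  finally show "transpose (dmap b d F x) ** \<omega> d (F x) ** dmap b d F x = \<omega> b x" .
qed

lemma symplectic_mapI:
  assumes "\<And>x. smooth_at F x" "\<And>x. preserves_omega_at F x"
  shows "symplectic_map A \<omega> F"
  unfolding symplectic_map_def Let_def
  using smooth_at_imp_smooth_map[OF assms(1)] assms(2)[unfolded preserves_omega_at_def dmap_def] by simp

text \<open>The derivative of the pulled back form is the pullback of the Lie derivative of \<open>\<omega>\<close>.\<close>

lemma ham_flow_omega_constant:
  assumes T: "is_interval T" and f: "smooth_time T f" and flow: "\<And>x. solves A T (\<lambda>t. ham_field \<omega> (f t)) (\<lambda>t. F t x)"
    and sm: "\<And>t. t \<in> T \<Longrightarrow> smooth_at (F t) x" and a: "a \<in> charts_at A x" and t: "t \<in> T" and c: "c \<in> charts_at A (F t x)"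
  shows "((\<lambda>s. (dmap a c (F s) x *v \<eta>) \<bullet> (\<omega> c (F s x) *v (dmap a c (F s) x *v \<theta>))) has_vector_derivative 0) (at t within T)"
proof -
  let ?v = "\<lambda>t. ham_field \<omega> (f t)"
  have c': "c \<in> A" "F t x \<in> dom_of c" using c charts_atD by auto
  define N where "N = fmat ?v c t (F t x)"
  define h where "h = ham_field \<omega> (f t) (F t x) c"
  define O' where "O' = (\<chi> l i. \<Sum>m\<in>UNIV. h $ m * pd c m (\<lambda>q. \<omega> c q $ l $ i) (F t x))"
  have v: "smooth_field T ?v" by (rule smooth_field_ham[OF f])
  have J: "((\<lambda>s. dmap a c (F s) x *v \<eta>) has_vector_derivative N *v (dmap a c (F t) x *v \<eta>)) (at t within T)" for \<eta>
    unfolding N_def by (rule dmap_ode[OF T v flow t sm[OF t] a c])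
  have hd: "((\<lambda>s. crd c (F s x)) has_vector_derivative h) (at t within T)"
    using solvesD[OF flow t c'] c' by (simp add: fld_def h_def)
  have "((\<lambda>s. \<omega> c (F s x) $ l $ i) has_vector_derivative O' $ l $ i) (at t within T)" for l i
    unfolding O'_def using pd_along_curve[OF smooth_omega_entry[OF c'(1)] c'(1) t c'(2) solves_continuous[OF flow] hd]
    by simp
  then have O: "((\<lambda>s. \<omega> c (F s x)) has_vector_derivative O') (at t within T)"
    unfolding has_vector_derivative_def has_derivative_componentwise_within[of "\<lambda>s. \<omega> c (F s x)"]
    by (auto simp: Basis_vec_def inner_axis)
  define u where "u = dmap a c (F t) x *v \<eta>"
  define w where "w = dmap a c (F t) x *v \<theta>"
  have "((\<lambda>s. (dmap a c (F s) x *v \<eta>) \<bullet> (\<omega> c (F s x) *v (dmap a c (F s) x *v \<theta>))) has_vector_derivative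
      (u \<bullet> (\<omega> c (F t x) *v (N *v w) + O' *v w) + (N *v u) \<bullet> (\<omega> c (F t x) *v w))) (at t within T)"
    unfolding u_def w_def
    by (intro bounded_bilinear.has_vector_derivative[OF bounded_bilinear_inner]
        bounded_bilinear.has_vector_derivative[OF bounded_bilinear_matrix_vector_mult] J O)
  moreover have "u \<bullet> (\<omega> c (F t x) *v (N *v w) + O' *v w) + (N *v u) \<bullet> (\<omega> c (F t x) *v w) =
      u \<bullet> ((transpose N ** \<omega> c (F t x) + O' + \<omega> c (F t x) ** N) *v w)"
    by (simp add: inner_matrix_vector matrix_vector_mult_add_rdistrib inner_add_right matrix_vector_mul_assoc)
  moreover have "transpose N ** \<omega> c (F t x) + O' + \<omega> c (F t x) ** N = 0"
    unfolding N_def O'_def h_def by (rule lie_derivative_omega[where f = f, OF c' smooth_time_smooth_in[OF f t c'(1)]])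
  ultimately show ?thesis by simp
qed

lemma ham_flow_preserves_omega:
  assumes T: "is_interval T" and f: "smooth_time T f" and flow: "\<And>x. solves A T (\<lambda>t. ham_field \<omega> (f t)) (\<lambda>t. F t x)"
    and sm: "\<And>t. t \<in> T \<Longrightarrow> smooth_at (F t) x" and t1: "t1 \<in> T" "preserves_omega_at (F t1) x" and t: "t \<in> T"
  shows "preserves_omega_at (F t) x"
proof (rule interval_induction[where T = T and ?t1.0 = t1 and P = "\<lambda>t. preserves_omega_at (F t) x"])
  fix t0 assume t0: "t0 \<in> T"
  obtain a c where a: "a \<in> charts_at A x" and c: "c \<in> charts_at A (F t0 x)" using ex_chart by blast
  have c': "c \<in> A" "F t0 x \<in> dom_of c" using c charts_atD by auto
  obtain I0 where I0: "open I0" "t0 \<in> I0" "\<And>t. t \<in> T \<inter> I0 \<Longrightarrow> F t x \<in> dom_of c"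
    using continuous_on_near[OF solves_continuous[OF flow] t0 open_dom[OF c'(1)] c'(2)] by metis
  obtain e where e: "e > 0" "ball t0 e \<subseteq> I0" using I0 open_contains_ball by blast
  obtain \<alpha> \<beta> I where J: "t0 \<in> {\<alpha>..\<beta>}" "{\<alpha>..\<beta>} \<subseteq> T" "\<beta> - \<alpha> < e" "open I" "t0 \<in> I" "T \<inter> I \<subseteq> {\<alpha>..\<beta>}"
    using interval_neighbourhood[OF T t0 e(1)] by metis
  have cs: "c \<in> charts_at A (F s x)" if "s \<in> {\<alpha>..\<beta>}" for s
  proof -
    have "s \<in> ball t0 e" using that J(1,3) by (auto simp: dist_real_def)
    then show ?thesis using that J(2) e(2) I0(3)[of s] c' by (auto simp: charts_at_def subset_iff)
  qed
  have const: "transpose (dmap a c (F s) x) ** \<omega> c (F s x) ** dmap a c (F s) x =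
      transpose (dmap a c (F s') x) ** \<omega> c (F s' x) ** dmap a c (F s') x" if ss: "s \<in> {\<alpha>..\<beta>}" "s' \<in> {\<alpha>..\<beta>}" for s s'
  proof -
    have eq: "(dmap a c (F s) x *v \<eta>) \<bullet> (\<omega> c (F s x) *v (dmap a c (F s) x *v \<theta>)) =
       (dmap a c (F s') x *v \<eta>) \<bullet> (\<omega> c (F s' x) *v (dmap a c (F s') x *v \<theta>))" for \<eta> \<theta>
    proof -
      have "\<exists>k. \<forall>s\<in>{\<alpha>..\<beta>}. (dmap a c (F s) x *v \<eta>) \<bullet> (\<omega> c (F s x) *v (dmap a c (F s) x *v \<theta>)) = k"
      proof (rule has_derivative_zero_constant[OF convex_real_interval(5)])
        fix s assume s: "s \<in> {\<alpha>..\<beta>}"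
        then have "s \<in> T" using J(2) by blast
        from has_vector_derivative_within_subset[OF ham_flow_omega_constant[OF T f flow sm a this cs[OF s]] J(2)]
        show "((\<lambda>s. (dmap a c (F s) x *v \<eta>) \<bullet> (\<omega> c (F s x) *v (dmap a c (F s) x *v \<theta>))) has_derivative (\<lambda>h. 0)) (at s within {\<alpha>..\<beta>})"
          by (simp add: has_vector_derivative_def)
      qed
      then show ?thesis using ss by metis
    qed
    have "\<eta> \<bullet> ((transpose (dmap a c (F s) x) ** \<omega> c (F s x) ** dmap a c (F s) x) *v \<theta>) =
       \<eta> \<bullet> ((transpose (dmap a c (F s') x) ** \<omega> c (F s' x) ** dmap a c (F s') x) *v \<theta>)" for \<eta> \<theta>
      using eq[of \<eta> \<theta>] by (simp add: inner_matrix_vector matrix_vector_mul_assoc matrix_mul_assoc)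
    then show ?thesis by (metis matrix_eq vector_eq_ldot)
  qed
  have "preserves_omega_at (F y) x" if "x' \<in> T \<inter> I" "y \<in> T \<inter> I" "preserves_omega_at (F x') x" for x' y
  proof (rule preserves_omega_atI[OF sm a])
    have xy: "x' \<in> {\<alpha>..\<beta>}" "y \<in> {\<alpha>..\<beta>}" using that J(6) by auto
    show "y \<in> T" "c \<in> charts_at A (F y x)" using that cs[OF xy(2)] by auto
    show "transpose (dmap a c (F y) x) ** \<omega> c (F y x) ** dmap a c (F y) x = \<omega> a x"
      using const[OF xy] that(3) a cs[OF xy(1)] unfolding preserves_omega_at_def by simp
  qed
  then show "\<exists>I. open I \<and> t0 \<in> I \<and> (\<forall>x'\<in>T \<inter> I. \<forall>y\<in>T \<inter> I. preserves_omega_at (F x') x \<longrightarrow> preserves_omega_at (F y) x)"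
    using J(4,5) by (intro exI[of _ I]) blast
qed (use T t1 t in auto)

lemma identity_at:
  assumes "\<And>z. F z = z"
  shows "smooth_at F x" "preserves_omega_at F x" "c \<in> charts_at A x \<Longrightarrow> d \<in> charts_at A x \<Longrightarrow> dmap c d F x = jac c d x"
proof -
  have F: "F = id" using assms by auto
  show "dmap c d F x = jac c d x" for c d by (simp add: F jac_eq_dmap)
  obtain c where c: "c \<in> charts_at A x" using ex_chart by blast
  have c': "c \<in> A" "x \<in> dom_of c" using c charts_atD by auto
  have "smooth_rep c c id (dom_of c)"
    using smooth_transition[OF c'(1,1)] open_dom[OF c'(1)] by (simp add: smooth_rep_def)
  then show "smooth_at F x" unfolding smooth_at_def F using c c'(2) by auto
  then show "preserves_omega_at F x"
    by (rule preserves_omega_atI[where a = c and c = c]) (use c jac_self[OF c] in \<open>auto simp: F jac_eq_dmap[symmetric] transpose_mat\<close>)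
qed

theorem ham_flow_symplectic:
  assumes T: "is_interval T" "0 \<in> T" and f: "smooth_time T f" and flow: "is_flow A T (\<lambda>t. ham_field \<omega> (f t)) F" and t: "t \<in> T"
  shows "smooth_at (F t) x" "preserves_omega_at (F t) x"
proof -
  have sol: "solves A T (\<lambda>t. ham_field \<omega> (f t)) (\<lambda>t. F t x)" and F0: "F 0 x = x" for x
    using flow by (auto simp: is_flow_def)
  have sm: "smooth_at (F t) x" if "t \<in> T" for t
    by (rule flow_smooth_at[where F = F, OF T(1) smooth_field_ham[OF f] sol T(2) identity_at(1)[OF F0] that])
  then show "smooth_at (F t) x" using t by blast
  show "preserves_omega_at (F t) x"
    by (rule ham_flow_preserves_omega[where F = F, OF T(1) f sol sm T(2) identity_at(2)[OF F0] t])
qed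

end

section \<open>Covariant derivatives of Hamiltonian fields\<close>

locale symplectic_connection = symplectic_manifold A \<omega>
  for A :: "('a::{t2_space, second_countable_topology}, 'd::finite) chart set" and \<omega> :: "('a, 'd) two_form" +
  fixes \<Gamma> :: "('a, 'd) christoffel"
  assumes torsion: "torsion_free A \<Gamma>" and parallel: "preserves_form A \<omega> \<Gamma>"
begin

lemma Gamma_symmetric: "c \<in> A \<Longrightarrow> p \<in> dom_of c \<Longrightarrow> \<Gamma> c p m j k = \<Gamma> c p m k j"
  by (rule bspec[OF spec[OF torsion[unfolded torsion_free_def]] charts_atI, rule_format])

lemma pd_omega:
  assumes "c \<in> A" "p \<in> dom_of c"
  shows "pd c i (\<lambda>q. \<omega> c q $ j $ k) p =
    (\<Sum>m\<in>UNIV. \<Gamma> c p m i j * \<omega> c p $ m $ k) + (\<Sum>m\<in>UNIV. \<Gamma> c p m i k * \<omega> c p $ j $ m)"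
  using bspec[OF spec[OF parallel[unfolded preserves_form_def]] charts_atI[OF assms], THEN spec, THEN spec, THEN spec, of i j k]
  by simp

lemma cov_hess_symmetric:
  assumes "c \<in> A" "p \<in> dom_of c" "smooth_in c f"
  shows "transpose (cov_hess \<Gamma> c f p) = cov_hess \<Gamma> c f p"
  using pd_symmetric[OF assms(1,3,2)] Gamma_symmetric[OF assms(1,2)]
  by (simp add: vec_eq_iff transpose_def cov_hess_def)

text \<open>The matrix of the linear map \<open>u \<mapsto> \<Gamma>(u, h)\<close>.\<close>

definition gamma_mat :: "('a, 'd) chart \<Rightarrow> 'a \<Rightarrow> real^'d \<Rightarrow> real^'d^'d" where
  "gamma_mat c p h = (\<chi> m l. \<Sum>a\<in>UNIV. \<Gamma> c p m l a * h $ a)"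

text \<open>In the derivative of \<open>h \<omega> = df\<close> the terms with Christoffel symbols are those of the covariant
  derivatives of \<open>h\<close> and of \<open>df\<close>, because \<open>\<omega>\<close> is parallel.\<close>

lemma ham_field_derivative:
  assumes "c \<in> A" "p \<in> dom_of c" "smooth_in c (f t)"
  shows "fmat (\<lambda>t. ham_field \<omega> (f t)) c t p =
    - (poisson \<omega> c p ** cov_hess \<Gamma> c (f t) p) - gamma_mat c p (ham_field \<omega> (f t) p c)"
proof -
  define N where "N = fmat (\<lambda>t. ham_field \<omega> (f t)) c t p"
  define h where "h = ham_field \<omega> (f t) p c"
  define C where "C = cov_hess \<Gamma> c (f t) p"
  define G where "G = gamma_mat c p h"
  have N: "N $ m $ l = pd c l (\<lambda>q. ham_field \<omega> (f t) q c $ m) p" for m l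
    unfolding N_def by (rule fmat_entry[where v = "\<lambda>t. ham_field \<omega> (f t)", OF assms(1) smooth_ham_field[OF assms(1,3)] assms(2)])
  have "(transpose (N + G) ** \<omega> c p) $ l $ i = C $ l $ i" for l i
  proof -
    have 1: "(\<Sum>m\<in>UNIV. N $ m $ l * \<omega> c p $ m $ i) + (\<Sum>m\<in>UNIV. h $ m * pd c l (\<lambda>q. \<omega> c q $ m $ i) p) = pd c l (pd c i (f t)) p"
      using pd_ham_field_omega[OF assms, of l i] by (simp add: N h_def sum.distrib)
    have "(\<Sum>m\<in>UNIV. h $ m * pd c l (\<lambda>q. \<omega> c q $ m $ i) p) =
       (\<Sum>m\<in>UNIV. \<Sum>a\<in>UNIV. h $ m * (\<Gamma> c p a l m * \<omega> c p $ a $ i)) + (\<Sum>m\<in>UNIV. \<Sum>a\<in>UNIV. h $ m * (\<Gamma> c p a l i * \<omega> c p $ m $ a))"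
      by (simp add: pd_omega[OF assms(1,2)] distrib_left sum.distrib sum_distrib_left)
    also have "(\<Sum>m\<in>UNIV. \<Sum>a\<in>UNIV. h $ m * (\<Gamma> c p a l m * \<omega> c p $ a $ i)) = (\<Sum>a\<in>UNIV. G $ a $ l * \<omega> c p $ a $ i)"
      by (subst sum.swap) (simp add: G_def gamma_mat_def sum_distrib_right sum_distrib_left mult_ac)
    also have "(\<Sum>m\<in>UNIV. \<Sum>a\<in>UNIV. h $ m * (\<Gamma> c p a l i * \<omega> c p $ m $ a)) = (\<Sum>a\<in>UNIV. \<Gamma> c p a l i * (\<Sum>m\<in>UNIV. h $ m * \<omega> c p $ m $ a))"
      by (subst sum.swap) (simp add: sum_distrib_left mult_ac)
    also have "\<dots> = (\<Sum>a\<in>UNIV. pd c a (f t) p * \<Gamma> c p a l i)"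
      unfolding h_def ham_field_omega[OF assms(1,2)] by (simp add: mult.commute)
    finally have "(\<Sum>m\<in>UNIV. N $ m $ l * \<omega> c p $ m $ i) + (\<Sum>a\<in>UNIV. G $ a $ l * \<omega> c p $ a $ i) = C $ l $ i"
      using 1 by (simp add: C_def cov_hess_def)
    then show ?thesis
      by (simp add: matrix_matrix_mult_def transpose_def sum.distrib distrib_right)
  qed
  then have "transpose (N + G) ** \<omega> c p = C" by (simp add: vec_eq_iff)
  then have "transpose (N + G) ** \<omega> c p ** poisson \<omega> c p = C ** poisson \<omega> c p" by simp
  then have "transpose (N + G) = C ** poisson \<omega> c p"
    by (simp add: matrix_mul_assoc[symmetric] omega_poisson[OF assms(1,2)])
  then have "transpose (transpose (N + G)) = transpose (poisson \<omega> c p) ** transpose C"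
    by (simp add: matrix_transpose_mul)
  then have "N + G = (- poisson \<omega> c p) ** C"
    by (simp add: poisson_skew[OF assms(1,2)] C_def cov_hess_symmetric[OF assms])
  also have "\<dots> = - (poisson \<omega> c p ** C)" by (simp add: matrix_matrix_mult_def vec_eq_iff sum_negf)
  finally have "N = - (poisson \<omega> c p ** C) - G" by (simp add: algebra_simps)
  then show ?thesis by (simp add: N_def C_def G_def h_def)
qed

lemma cov_hess_linear_combination:
  assumes "c \<in> A" "p \<in> dom_of c" "\<And>k. smooth_in c (f k)"
  shows "cov_hess \<Gamma> c (\<lambda>q. \<Sum>k\<in>(UNIV :: 'k::finite set). a k * f k q) p $ i $ j = (\<Sum>k\<in>UNIV. a k * cov_hess \<Gamma> c (f k) p $ i $ j)"
    and "pd c i (\<lambda>q. \<Sum>k\<in>UNIV. a k * f k q) p = (\<Sum>k\<in>UNIV. a k * pd c i (f k) p)"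
proof -
  have sm: "smooth_in c (\<lambda>q. a k * f k q)" for k by (intro smooth_in_mult smooth_in_const assms)
  have pdq: "pd c i (\<lambda>q. \<Sum>k\<in>UNIV. a k * f k q) q = (\<Sum>k\<in>UNIV. a k * pd c i (f k) q)" if "q \<in> dom_of c" for i q
    by (simp add: pd_sum[OF sm that] pd_cmult[OF assms(1,3) that])
  then show "pd c i (\<lambda>q. \<Sum>k\<in>UNIV. a k * f k q) p = (\<Sum>k\<in>UNIV. a k * pd c i (f k) p)" using assms(2) .
  have "pd c i (pd c j (\<lambda>q. \<Sum>k\<in>UNIV. a k * f k q)) p = pd c i (\<lambda>q. \<Sum>k\<in>UNIV. a k * pd c j (f k) q) p"
    by (rule pd_cong[OF assms(1) open_dom[OF assms(1)] assms(2,2)]) (rule pdq)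
  also have "\<dots> = (\<Sum>k\<in>UNIV. a k * pd c i (pd c j (f k)) p)"
    by (simp add: pd_sum[OF smooth_in_mult[OF assms(1) smooth_in_const[OF assms(1)] smooth_in_pd[OF assms(1,3)]] assms(2)]
        pd_cmult[OF assms(1) smooth_in_pd[OF assms(1,3)] assms(2)])
  finally have 1: "pd c i (pd c j (\<lambda>q. \<Sum>k\<in>UNIV. a k * f k q)) p = (\<Sum>k\<in>UNIV. a k * pd c i (pd c j (f k)) p)" .
  have 2: "(\<Sum>m\<in>UNIV. (\<Sum>k\<in>UNIV. a k * pd c m (f k) p) * \<Gamma> c p m i j) = (\<Sum>k\<in>UNIV. a k * (\<Sum>m\<in>UNIV. pd c m (f k) p * \<Gamma> c p m i j))"
    by (simp add: sum_distrib_right sum_distrib_left mult.assoc) (rule sum.swap)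
  show "cov_hess \<Gamma> c (\<lambda>q. \<Sum>k\<in>UNIV. a k * f k q) p $ i $ j = (\<Sum>k\<in>UNIV. a k * cov_hess \<Gamma> c (f k) p $ i $ j)"
    by (simp add: cov_hess_def 1 pdq[OF assms(2)] 2 right_diff_distrib sum_subtractf)
qed

end

section \<open>The Ether Hamiltonian along a trajectory\<close>

lemma at_within_interval_nontrivial:
  fixes T :: "real set"
  assumes "is_interval T" "0 \<in> T" "T \<noteq> {0}" "t \<in> T"
  shows "at t within T \<noteq> bot"
proof -
  have "connected T" using assms(1) is_interval_connected_1 by blast
  moreover have "\<nexists>x. T = {x}" using assms(2,3) by auto
  ultimately have "t islimpt T" using connected_imp_perfect[of T t] assms(4) by blast
  then show ?thesis by (simp add: trivial_limit_within)
qed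

context manifold
begin

lemma curve_change_chart:
  assumes "continuous_on T \<gamma>" "t \<in> T" "c \<in> charts_at A (\<gamma> t)" "d \<in> charts_at A (\<gamma> t)"
    and D: "((\<lambda>s. crd c (\<gamma> s)) has_vector_derivative w) (at t within T)"
  shows "((\<lambda>s. crd d (\<gamma> s)) has_vector_derivative jac c d (\<gamma> t) *v w) (at t within T)"
proof -
  have c: "c \<in> A" "\<gamma> t \<in> dom_of c" using assms(3) charts_atD by auto
  have "((crd d \<circ> id \<circ> crd_inv c) has_derivative (*v) (jac c d (\<gamma> t))) (at (crd c (\<gamma> t)))"
    using has_dmap_jac[OF assms(3,4)] by (simp add: has_dmap_def)
  then have "((crd d \<circ> id \<circ> crd_inv c) \<circ> (\<lambda>s. crd c (\<gamma> s)) has_derivative (*v) (jac c d (\<gamma> t)) \<circ> (\<lambda>x. x *\<^sub>R w)) (at t within T)"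
    using D unfolding has_vector_derivative_def by (intro diff_chain_within) (auto intro: has_derivative_at_withinI)
  then have E: "((\<lambda>s. crd d (crd_inv c (crd c (\<gamma> s)))) has_vector_derivative jac c d (\<gamma> t) *v w) (at t within T)"
    by (simp add: o_def has_vector_derivative_def matrix_vector_mult_scaleR)
  obtain I where I: "open I" "t \<in> I" "\<And>s. s \<in> T \<inter> I \<Longrightarrow> \<gamma> s \<in> dom_of c"
    using continuous_on_near[OF assms(1,2) open_dom[OF c(1)] c(2)] by metis
  obtain e where e: "e > 0" "ball t e \<subseteq> I" using I open_contains_ball by blast
  show ?thesis
    by (rule has_vector_derivative_transform_within[OF E e(1) assms(2)])
      (use I(3) e(2) c(1) in \<open>auto simp: dist_commute subset_iff\<close>)
qed

lemma solves_cong: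
  assumes "\<And>t c. t \<in> T \<Longrightarrow> c \<in> charts_at A (\<gamma> t) \<Longrightarrow> v t (\<gamma> t) c = w t (\<gamma> t) c"
  shows "solves A T v \<gamma> \<longleftrightarrow> solves A T w \<gamma>"
  using assms unfolding solves_def by simp

end

locale ether_trajectory = symplectic_connection A \<omega> \<Gamma>
  for A :: "('a::{t2_space, second_countable_topology}, 'd::finite) chart set" and \<omega> :: "('a, 'd) two_form"
    and \<Gamma> :: "('a, 'd) christoffel" +
  fixes \<H> :: "('a, 'd) fun_one_form" and H :: "'a \<Rightarrow> real" and T :: "real set"
    and \<sigma> :: "real \<Rightarrow> 'a" and F :: "real \<Rightarrow> 'a \<Rightarrow> 'a"
  assumes one_form: "fun_one_form A \<H>" and diagonal: "diagonal_conditions A \<omega> \<Gamma> \<H>"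
    and smooth_H: "smooth_function A H"
    and interval: "is_interval T" and T0: "0 \<in> T" and T_nontrivial: "T \<noteq> {0}"
    and \<sigma>: "solves A T (\<lambda>t. ham_field \<omega> H) \<sigma>"
    and path: "symplectic_path A \<omega> \<H> T \<sigma> F"
begin

lemma H_smooth_in: "c \<in> A \<Longrightarrow> smooth_in c H"
  by (rule smooth_function_smooth_in[OF smooth_H])

lemma \<sigma>_continuous: "continuous_on T \<sigma>"
  by (rule solves_continuous[OF \<sigma>])

lemma \<sigma>_derivative:
  "t \<in> T \<Longrightarrow> c \<in> charts_at A (\<sigma> t) \<Longrightarrow> ((\<lambda>s. crd c (\<sigma> s)) has_vector_derivative ham_field \<omega> H (\<sigma> t) c) (at t within T)"
  using \<sigma> unfolding solves_def by blast

lemma velocity_\<sigma>: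
  assumes "t \<in> T" "c \<in> charts_at A (\<sigma> t)"
  shows "velocity T \<sigma> t c = ham_field \<omega> H (\<sigma> t) c"
  unfolding velocity_def
  by (rule vector_derivative_within[OF at_within_interval_nontrivial[OF interval T0 T_nontrivial assms(1)] \<sigma>_derivative[OF assms]])

lemma smooth_in_ether:
  assumes "c \<in> charts_at A x" "e \<in> A"
  shows "smooth_in e (\<lambda>z. \<H> c x z $ k)"
proof -
  have c: "c \<in> A" "x \<in> dom_of c" using assms(1) charts_atD by auto
  have "smooth_on ((crd c ` dom_of c) \<times> (crd e ` dom_of e)) (\<lambda>(\<xi>, \<zeta>). \<H> c (crd_inv c \<xi>) (crd_inv e \<zeta>))"
    using one_form c(1) assms(2) unfolding fun_one_form_def by blast
  moreover have "smooth_on (crd e ` dom_of e) (\<lambda>\<zeta>. (crd c x, \<zeta>))"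
  proof -
    have "Ck_family n {0} (crd e ` dom_of e) (\<lambda>t \<zeta>. (crd c x, 0) + (0, \<zeta>))" for n
      by (rule Ck_family_add[OF open_img[OF assms(2)] Ck_family_time_only[OF open_img[OF assms(2)]]
          Ck_family_linear_space[OF open_img[OF assms(2)]]])
        (auto intro: bounded_linear_Pair bounded_linear_zero bounded_linear_ident)
    then show ?thesis unfolding smooth_on_iff_smooth_family smooth_family_def by simp
  qed
  ultimately have "smooth_on (crd e ` dom_of e) ((\<lambda>(\<xi>, \<zeta>). \<H> c (crd_inv c \<xi>) (crd_inv e \<zeta>)) \<circ> (\<lambda>\<zeta>. (crd c x, \<zeta>)))"
    using c(2) by (intro smooth_on_compose[OF open_img[OF assms(2)] open_Times[OF open_img[OF c(1)] open_img[OF assms(2)]]]) auto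
  then have "smooth_in e (\<lambda>z. \<H> c x z)" unfolding smooth_in_def using c by (simp add: o_def)
  then show ?thesis by (rule smooth_in_nth[OF assms(2)])
qed

text \<open>The symplectic path is the flow of this time-dependent Hamiltonian.\<close>

definition path_ham :: "real \<Rightarrow> 'a \<Rightarrow> real" where
  "path_ham t z = 1/2 * contract A \<H> (\<sigma> t) (velocity T \<sigma> t) z"

text \<open>The velocity is a vector and \<open>\<H>\<close> a covector at \<open>\<sigma>(t)\<close>, so their contraction can be computed in any
  chart; in particular one chart can be kept while \<open>t\<close> varies a little.\<close>

lemma path_ham_in_chart:
  assumes t: "t \<in> T" and d: "d \<in> charts_at A (\<sigma> t)"
  shows "path_ham t z = (\<Sum>k\<in>UNIV. (1/2 * ham_field \<omega> H (\<sigma> t) d $ k) * \<H> d (\<sigma> t) z $ k)"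
proof -
  define c where "c = chart_at A (\<sigma> t)"
  have c: "c \<in> charts_at A (\<sigma> t)" unfolding c_def by (rule chart_at)
  have "ham_field \<omega> H (\<sigma> t) d = jac c d (\<sigma> t) *v ham_field \<omega> H (\<sigma> t) c"
    using vector_derivative_within[OF at_within_interval_nontrivial[OF interval T0 T_nontrivial t]
        curve_change_chart[OF \<sigma>_continuous t c d \<sigma>_derivative[OF t c]]]
      velocity_\<sigma>[OF t d] by (simp add: velocity_def)
  moreover have "\<H> c (\<sigma> t) z = transpose (jac c d (\<sigma> t)) *v \<H> d (\<sigma> t) z"
    using one_form c d unfolding fun_one_form_def by blast
  ultimately have "ham_field \<omega> H (\<sigma> t) c \<bullet> \<H> c (\<sigma> t) z = ham_field \<omega> H (\<sigma> t) d \<bullet> \<H> d (\<sigma> t) z"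
    by (simp add: inner_matrix_vector)
  moreover have "path_ham t z = 1/2 * (ham_field \<omega> H (\<sigma> t) c \<bullet> \<H> c (\<sigma> t) z)"
    by (simp add: path_ham_def contract_def Let_def c_def[symmetric] velocity_\<sigma>[OF t c] inner_vec_def)
  ultimately show ?thesis by (simp add: inner_vec_def sum_distrib_left mult.assoc)
qed

text \<open>For times near \<open>t0\<close> one chart around \<open>\<sigma>(t0)\<close> serves, and \<open>path_ham\<close> is a composition of smooth
  functions with \<open>(t, \<zeta>) \<mapsto> (\<sigma>(t), \<zeta>)\<close>.\<close>

lemma smooth_time_path_ham: "smooth_time T path_ham"
  unfolding smooth_time_def smooth_family_def
proof (intro ballI allI)
  fix e n assume e: "e \<in> A"
  let ?S = "crd e ` dom_of e"
  note S = open_img[OF e]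
  show "Ck_family n T ?S (\<lambda>t. path_ham t \<circ> crd_inv e)"
  proof (rule Ck_family_local)
    fix t0 \<zeta>0 assume t0: "t0 \<in> T" and "\<zeta>0 \<in> ?S"
    obtain c where c: "c \<in> charts_at A (\<sigma> t0)" using ex_chart by blast
    have c': "c \<in> A" "\<sigma> t0 \<in> dom_of c" using c charts_atD by auto
    obtain I where I: "open I" "t0 \<in> I" "\<And>s. s \<in> T \<inter> I \<Longrightarrow> \<sigma> s \<in> dom_of c"
      using continuous_on_near[OF \<sigma>_continuous t0 open_dom[OF c'(1)] c'(2)] by metis
    have \<sigma>I: "continuous_on (T \<inter> I) \<sigma>" using \<sigma>_continuous by (rule continuous_on_subset) auto
    have cc: "continuous_on (T \<inter> I) (\<lambda>t. crd c (\<sigma> t))"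
      by (rule continuous_on_compose2[OF continuous_on_crd[OF c'(1)] \<sigma>I]) (use I(3) in auto)
    have h: "continuous_on (T \<inter> I) (\<lambda>t. 1/2 * ham_field \<omega> H (\<sigma> t) c $ k)" for k
    proof -
      have "continuous_on (T \<inter> I) (\<lambda>t. ((\<lambda>q. ham_field \<omega> H q c $ k) \<circ> crd_inv c) (crd c (\<sigma> t)))"
        by (rule continuous_on_compose2[OF smooth_on_continuous[OF
              smooth_ham_field_entry[OF c'(1) H_smooth_in[OF c'(1)], unfolded smooth_in_def]] cc]) (use I(3) in auto)
      then have "continuous_on (T \<inter> I) (\<lambda>t. ham_field \<omega> H (\<sigma> t) c $ k)"
        by (rule continuous_on_eq) (use I(3) c'(1) in auto)
      then show ?thesis by (intro continuous_on_mult continuous_on_const)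
    qed
    have "smooth_on ((crd c ` dom_of c) \<times> ?S) (\<lambda>(\<xi>, \<zeta>). \<H> c (crd_inv c \<xi>) (crd_inv e \<zeta>))"
      using one_form c'(1) e unfolding fun_one_form_def by blast
    then have outer: "Ck_family n (T \<inter> I) ((crd c ` dom_of c) \<times> ?S) (\<lambda>t (\<xi>, \<zeta>). \<H> c (crd_inv c \<xi>) (crd_inv e \<zeta>))"
      unfolding smooth_on_def by (intro Ck_on_imp_Ck_family) simp
    have "Ck_family n (T \<inter> I) ?S (\<lambda>t \<zeta>. (crd c (\<sigma> t), 0) + (0, \<zeta>))"
      by (rule Ck_family_add[OF S Ck_family_time_only[OF S] Ck_family_linear_space[OF S]])
        (auto intro!: bounded_linear_Pair bounded_linear_zero bounded_linear_ident continuous_on_Pair cc continuous_on_const)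
    then have inner: "Ck_family n (T \<inter> I) ?S (\<lambda>t \<zeta>. (crd c (\<sigma> t), \<zeta>))" by simp
    have "Ck_family n (T \<inter> I) ?S (\<lambda>t \<zeta>. (\<lambda>(\<xi>, \<zeta>). \<H> c (crd_inv c \<xi>) (crd_inv e \<zeta>)) (crd c (\<sigma> t), \<zeta>))"
      by (rule Ck_family_compose[OF S open_Times[OF open_img[OF c'(1)] S] outer inner]) (use I(3) in auto)
    then have "Ck_family n (T \<inter> I) ?S (\<lambda>t \<zeta>. \<Sum>k\<in>UNIV. (1/2 * ham_field \<omega> H (\<sigma> t) c $ k) * \<H> c (crd_inv c (crd c (\<sigma> t))) (crd_inv e \<zeta>) $ k)"
      by (intro Ck_family_sum[OF S] Ck_family_mult[OF S] Ck_family_time_only[OF S h] Ck_family_nth[OF S]) simp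
    then have "Ck_family n (T \<inter> I) ?S (\<lambda>t. path_ham t \<circ> crd_inv e)"
      by (subst Ck_family_cong[OF S]) (use I(3) c'(1) in \<open>auto simp: path_ham_in_chart[OF _ charts_atI[OF c'(1)]]\<close>)
    then show "\<exists>I U. open I \<and> t0 \<in> I \<and> open U \<and> \<zeta>0 \<in> U \<and> Ck_family n (T \<inter> I) (?S \<inter> U) (\<lambda>t. path_ham t \<circ> crd_inv e)"
      using I(1,2) by (intro exI[of _ I] exI[of _ UNIV]) auto
  qed
qed

lemma path_field_eq:
  assumes t: "t \<in> T" and e: "e \<in> charts_at A p"
  shows "path_field A \<omega> \<H> T \<sigma> t p e = ham_field \<omega> (path_ham t) p e"
proof -
  have e': "e \<in> A" "p \<in> dom_of e" using e charts_atD by auto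
  define c where "c = chart_at A (\<sigma> t)"
  have c: "c \<in> charts_at A (\<sigma> t)" unfolding c_def by (rule chart_at)
  have sm: "smooth_in e (\<lambda>z. \<H> c (\<sigma> t) z $ k)" for k by (rule smooth_in_ether[OF c e'(1)])
  have "pd e j (path_ham t) p = (\<Sum>k\<in>UNIV. (1/2 * velocity T \<sigma> t c $ k) * pd e j (\<lambda>z. \<H> c (\<sigma> t) z $ k) p)" for j
    using cov_hess_linear_combination(2)[OF e' sm, of j "\<lambda>k. 1/2 * ham_field \<omega> H (\<sigma> t) c $ k"]
    by (simp add: path_ham_in_chart[OF t c, abs_def] velocity_\<sigma>[OF t c])
  then have "ham_field \<omega> (path_ham t) p e $ m = path_field A \<omega> \<H> T \<sigma> t p e $ m" for m
    by (simp add: ham_field_def path_field_def Let_def c_def[symmetric] sum_distrib_left sum_distrib_right mult_ac)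
      (rule sum.swap)
  then show ?thesis by (simp add: vec_eq_iff)
qed

lemma path_flow: "is_flow A T (\<lambda>t. ham_field \<omega> (path_ham t)) F"
proof -
  have "solves A T (path_field A \<omega> \<H> T \<sigma>) \<gamma> \<longleftrightarrow> solves A T (\<lambda>t. ham_field \<omega> (path_ham t)) \<gamma>" for \<gamma>
    by (rule solves_cong) (rule path_field_eq)
  then show ?thesis using path unfolding symplectic_path_def is_flow_def by simp
qed

lemma path_solves: "solves A T (\<lambda>t. ham_field \<omega> (path_ham t)) (\<lambda>t. F t x)" and path_0: "F 0 x = x"
  using path_flow by (auto simp: is_flow_def)

lemma path_smooth_at: "t \<in> T \<Longrightarrow> smooth_at (F t) x"
  and path_preserves_omega: "t \<in> T \<Longrightarrow> preserves_omega_at (F t) x"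
  using ham_flow_symplectic[OF interval T0 smooth_time_path_ham path_flow] by blast+

lemma diagonalD:
  assumes "c \<in> charts_at A x"
  shows "\<H> c x x = 0" "pd c j (\<lambda>z. \<H> c x z $ k) x = 2 * \<omega> c x $ k $ j" "cov_hess \<Gamma> c (\<lambda>z. \<H> c x z $ k) x = 0"
  using bspec[OF spec[OF diagonal[unfolded diagonal_conditions_def]] assms] by blast+

text \<open>These are the conditions on the diagonal, contracted with the velocity. The differential is
  \<open>1/2 \<sigma>'\<^sup>k 2 \<omega>\<^sub>k\<^sub>j = \<sigma>'\<^sup>k \<omega>\<^sub>k\<^sub>j\<close>, and this is the differential of \<open>H\<close> because \<open>\<sigma>'\<close> is its Hamiltonian field.\<close>

lemma path_ham_on_trajectory:
  assumes t: "t \<in> T" and d: "d \<in> charts_at A (\<sigma> t)"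
  shows "path_ham t (\<sigma> t) = 0" "pd d j (path_ham t) (\<sigma> t) = pd d j H (\<sigma> t)" "cov_hess \<Gamma> d (path_ham t) (\<sigma> t) = 0"
proof -
  have d': "d \<in> A" "\<sigma> t \<in> dom_of d" using d charts_atD by auto
  have sm: "smooth_in d (\<lambda>z. \<H> d (\<sigma> t) z $ k)" for k by (rule smooth_in_ether[OF d d'(1)])
  note ch = path_ham_in_chart[OF t d, abs_def]
  show "path_ham t (\<sigma> t) = 0" by (simp add: ch diagonalD(1)[OF d])
  have "pd d j (path_ham t) (\<sigma> t) = (\<Sum>k\<in>UNIV. ham_field \<omega> H (\<sigma> t) d $ k * \<omega> d (\<sigma> t) $ k $ j)"
    unfolding ch cov_hess_linear_combination(2)[OF d' sm] by (simp add: diagonalD(2)[OF d])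
  then show "pd d j (path_ham t) (\<sigma> t) = pd d j H (\<sigma> t)" by (simp add: ham_field_omega[OF d'])
  have "cov_hess \<Gamma> d (path_ham t) (\<sigma> t) $ i $ j = 0" for i j
    unfolding ch cov_hess_linear_combination(1)[OF d' sm] by (simp add: diagonalD(3)[OF d])
  then show "cov_hess \<Gamma> d (path_ham t) (\<sigma> t) = 0" by (simp add: vec_eq_iff)
qed

lemma ham_field_on_trajectory:
  assumes "t \<in> T" "d \<in> charts_at A (\<sigma> t)"
  shows "ham_field \<omega> (path_ham t) (\<sigma> t) d = ham_field \<omega> H (\<sigma> t) d"
  by (simp add: ham_field_def path_ham_on_trajectory(2)[OF assms])

lemma \<sigma>_solves_path: "solves A T (\<lambda>t. ham_field \<omega> (path_ham t)) \<sigma>"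
  using \<sigma> solves_cong[of T \<sigma> "\<lambda>t. ham_field \<omega> H" "\<lambda>t. ham_field \<omega> (path_ham t)"] ham_field_on_trajectory by simp

lemma path_transports: "t \<in> T \<Longrightarrow> F t (\<sigma> 0) = \<sigma> t"
  by (rule solutions_unique[OF interval smooth_field_ham[OF smooth_time_path_ham] path_solves \<sigma>_solves_path T0])
    (simp_all add: path_0)

lemma path_injective:
  assumes "t \<in> T" "F t p = F t q"
  shows "p = q"
  using solutions_unique[OF interval smooth_field_ham[OF smooth_time_path_ham] path_solves[of p] path_solves[of q] assms(1,2) T0]
  by (simp add: path_0)

lemma energy_conserved:
  assumes "t \<in> T"
  shows "H (\<sigma> t) = H (\<sigma> 0)"
proof -
  have "\<exists>k. \<forall>t\<in>T. H (\<sigma> t) = k"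
  proof (rule has_derivative_zero_constant)
    show "convex T" using interval is_interval_convex_1 by blast
    fix t assume t: "t \<in> T"
    obtain c where c: "c \<in> charts_at A (\<sigma> t)" using ex_chart by blast
    have c': "c \<in> A" "\<sigma> t \<in> dom_of c" using c charts_atD by auto
    define h where "h = ham_field \<omega> H (\<sigma> t) c"
    define S where "S = (\<Sum>j\<in>UNIV. h $ j * pd c j H (\<sigma> t))"
    have "S = (\<Sum>j\<in>UNIV. \<Sum>m\<in>UNIV. h $ j * h $ m * \<omega> c (\<sigma> t) $ m $ j)"
      unfolding S_def ham_field_omega[OF c', symmetric] by (simp add: h_def sum_distrib_left mult.assoc)
    also have "\<dots> = (\<Sum>j\<in>UNIV. \<Sum>m\<in>UNIV. - (h $ m * h $ j * \<omega> c (\<sigma> t) $ j $ m))"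
      by (intro sum.cong refl) (subst omega_skew[OF c'], simp)
    also have "\<dots> = - (\<Sum>j\<in>UNIV. \<Sum>m\<in>UNIV. h $ j * h $ m * \<omega> c (\<sigma> t) $ m $ j)"
      by (subst sum.swap) (simp add: sum_negf)
    also have "(\<Sum>j\<in>UNIV. \<Sum>m\<in>UNIV. h $ j * h $ m * \<omega> c (\<sigma> t) $ m $ j) = S"
      unfolding S_def ham_field_omega[OF c', symmetric] by (simp add: h_def sum_distrib_left mult.assoc)
    finally have "S = 0" by simp
    then show "((\<lambda>t. H (\<sigma> t)) has_derivative (\<lambda>h. 0)) (at t within T)"
      using pd_along_curve[OF H_smooth_in[OF c'(1)] c'(1) t c'(2) \<sigma>_continuous \<sigma>_derivative[OF t c]]
      by (simp add: S_def h_def has_vector_derivative_def)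
  qed
  then show ?thesis using assms T0 by metis
qed

end

section \<open>Inverses and pushforwards\<close>

text \<open>The inverse is continuous by invariance of domain. Its derivative at \<open>f x\<close> is the inverse matrix of the
  derivative of \<open>f\<close> at \<open>x\<close>, hence a smooth function composed with the inverse of \<open>f\<close>; this raises the order
  of regularity of the inverse step by step.\<close>

lemma smooth_inverse:
  fixes f :: "real^'d::finite \<Rightarrow> real^'d"
  assumes S: "open S" and f: "smooth_on S f" and inj: "inj_on f S"
    and inv: "\<And>x. x \<in> S \<Longrightarrow> invertible (matrix (frechet_derivative f (at x)))"
  shows "open (f ` S)" "smooth_on (f ` S) (inv_into S f)"
proof -
  have contf: "continuous_on S f" by (rule smooth_on_continuous[OF f])
  show fS: "open (f ` S)" by (rule invariance_of_domain[OF contf S inj])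
  define g where "g = inv_into S f"
  have g: "g y \<in> S" "f (g y) = y" if "y \<in> f ` S" for y
    using that by (auto simp: g_def inv_into_into f_inv_into_f)
  have gf: "g (f x) = x" if "x \<in> S" for x using that inj by (simp add: g_def)
  have contg: "continuous_on (f ` S) g"
  proof (rule continuous_on_open_vimage[OF fS, THEN iffD2], intro allI impI)
    fix W :: "(real^'d) set" assume W: "open W"
    have "g -` W \<inter> f ` S = f ` (S \<inter> W)" using gf by auto
    moreover have "open (f ` (S \<inter> W))"
      by (rule invariance_of_domain) (use contf S W inj in \<open>auto intro: continuous_on_subset inj_on_subset\<close>)
    ultimately show "open (g -` W \<inter> f ` S)" by simp
  qed
  define M where "M = (\<lambda>x. matrix (frechet_derivative f (at x)))"
  have D: "(f has_derivative (*v) (M x)) (at x)" if "x \<in> S" for x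
    using smooth_on_has_derivative[OF f that] unfolding M_def by (simp add: has_derivative_bounded_linear)
  have Dg: "(g has_derivative (*v) (matrix_inv (M (g y)))) (at y)" if y: "y \<in> f ` S" for y
  proof (rule has_derivative_inverse_basic[OF D[OF g(1)[OF y]] _ _ _ fS y g(2)])
    show "(*v) (matrix_inv (M (g y))) \<circ> (*v) (M (g y)) = id"
      using inv[OF g(1)[OF y]] by (simp add: fun_eq_iff matrix_vector_mul_assoc matrix_inv_mult M_def)
    show "continuous (at y) g" using contg fS y continuous_on_eq_continuous_at by blast
  qed auto
  have M: "Ck_family n {0} S (\<lambda>t. M)" for n
  proof (rule Ck_family_vecI[OF S], rule Ck_family_vecI[OF S])
    fix i j
    have "Ck_family n {0} S (\<lambda>t x. frechet_derivative f (at x) (axis j 1) $ i)"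
      using smooth_on_frechet_derivative[OF f, of "axis j 1"]
      unfolding smooth_on_iff_smooth_family smooth_family_def by (intro Ck_family_nth[OF S]) simp
    then show "Ck_family n {0} S (\<lambda>t x. M x $ i $ j)" by (simp add: M_def matrix_def)
  qed
  have Mi: "Ck_family n {0} S (\<lambda>t x. matrix_inv (M x))" for n
    by (rule Ck_family_matrix_inv[OF S M]) (simp add: M_def inv)
  have contg': "continuous_on ({0} \<times> f ` S) (\<lambda>(t :: real, y). g y)"
    using Ck_family_continuous[OF Ck_on_imp_Ck_family[of 0 "f ` S" g "{0}"]] contg by simp
  have "Ck_family n {0} (f ` S) (\<lambda>t. g)" for n
  proof (induction n)
    case 0
    then show ?case using contg' by simp
  next
    case (Suc n)
    have "Ck_family n {0} (f ` S) (\<lambda>t y. matrix_inv (M (g y)))"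
      by (rule Ck_family_compose[OF fS S Mi Suc]) (use g in auto)
    then have "Ck_family n {0} (f ` S) (\<lambda>t y. matrix_inv (M (g y)) *v v)" for v
      by (rule Ck_family_bilinear[OF fS bounded_bilinear_matrix_vector_mult _ Ck_family_time_only[OF fS continuous_on_const]])
    then show ?case
      by (intro Ck_family_SucI[where D = "\<lambda>t y. (*v) (matrix_inv (M (g y)))"] fS contg') (use Dg in auto)
  qed
  then show "smooth_on (f ` S) (inv_into S f)"
    unfolding smooth_on_iff_smooth_family smooth_family_def g_def by blast
qed

lemma frechet_derivative_diff_const: "frechet_derivative (\<lambda>x. f x - k) (at x) = frechet_derivative f (at x)"
proof -
  have "((\<lambda>x. f x - k) has_derivative D) (at x) \<longleftrightarrow> (f has_derivative D) (at x)" for D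
  proof
    assume "((\<lambda>x. f x - k) has_derivative D) (at x)"
    from has_derivative_add[OF this has_derivative_const[of k]] show "(f has_derivative D) (at x)" by simp
  next
    assume "(f has_derivative D) (at x)"
    from has_derivative_diff[OF this has_derivative_const[of k]] show "((\<lambda>x. f x - k) has_derivative D) (at x)" by simp
  qed
  then show ?thesis by (simp add: frechet_derivative_def)
qed

lemma pd_diff_const: "pd c j (\<lambda>q. f q - k) p = pd c j f p"
  using frechet_derivative_diff_const[of "f \<circ> crd_inv c" k] by (simp add: pd_def o_def)

context manifold
begin

lemma smooth_in_diff:
  fixes f g :: "'a \<Rightarrow> real"
  assumes "c \<in> A" "smooth_in c f" "smooth_in c g"
  shows "smooth_in c (\<lambda>q. f q - g q)"
proof -
  have "smooth_in c (\<lambda>q. - 1 * g q)" by (intro smooth_in_mult smooth_in_const assms)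
  then have "Ck_family n {0} (crd c ` dom_of c) (\<lambda>t \<zeta>. (f \<circ> crd_inv c) \<zeta> + ((\<lambda>q. - 1 * g q) \<circ> crd_inv c) \<zeta>)" for n
    using assms(2) unfolding smooth_in_family by (intro Ck_family_add[OF open_img[OF assms(1)]]) (auto simp: o_def)
  then show ?thesis unfolding smooth_in_family by (simp add: o_def)
qed

text \<open>Near \<open>p\<close> the map \<open>Z\<close> is \<open>X\<close> followed by a local inverse of \<open>F\<close>: injectivity of \<open>F\<close> forces \<open>Z\<close> to
  take its values in the neighbourhood on which that inverse is defined.\<close>

lemma smooth_at_factor:
  assumes F: "\<And>x. smooth_at F x" and inj: "inj F" and X: "smooth_at X p" and eq: "\<And>x. X x = F (Z x)"
    and inv: "\<And>x a c. a \<in> charts_at A x \<Longrightarrow> c \<in> charts_at A (F x) \<Longrightarrow> invertible (dmap a c F x)"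
  shows "smooth_at Z p"
proof -
  obtain a e where a: "a \<in> charts_at A p" and e: "e \<in> charts_at A (Z p)" using ex_chart by blast
  obtain c where c: "c \<in> charts_at A (F (Z p))" using ex_chart by blast
  have a': "a \<in> A" "p \<in> dom_of a" and e': "e \<in> A" "Z p \<in> dom_of e" and c': "c \<in> A" "F (Z p) \<in> dom_of c"
    using a e c charts_atD by auto
  obtain U where U: "Z p \<in> U" "smooth_rep e c F U" using smooth_at_rep[OF F e c] by blast
  have U': "open U" "U \<subseteq> dom_of e" "F ` U \<subseteq> dom_of c" "smooth_on (crd e ` U) (crd c \<circ> F \<circ> crd_inv e)"
    using U(2) by (auto simp: smooth_rep_def)
  define f where "f = crd c \<circ> F \<circ> crd_inv e"
  have oU: "open (crd e ` U)" by (rule open_crd_image[OF e'(1) U'(1,2)])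
  have fU: "f (crd e u) = crd c (F u)" if "u \<in> U" for u
    using that U'(2) e'(1) by (auto simp: f_def subset_iff)
  have injf: "inj_on f (crd e ` U)"
  proof (rule inj_onI)
    fix \<xi> \<eta> assume "\<xi> \<in> crd e ` U" "\<eta> \<in> crd e ` U" and eqf: "f \<xi> = f \<eta>"
    then obtain u w where uw: "u \<in> U" "w \<in> U" "\<xi> = crd e u" "\<eta> = crd e w" by blast
    then have "crd c (F u) = crd c (F w)" using eqf fU by simp
    then have "F u = F w" using uw(1,2) U'(3) c'(1) by (metis crd_inv_crd image_subset_iff)
    then show "\<xi> = \<eta>" using inj uw by (auto dest: injD)
  qed
  have invf: "invertible (matrix (frechet_derivative f (at \<xi>)))" if \<xi>: "\<xi> \<in> crd e ` U" for \<xi>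
  proof -
    obtain u where u: "u \<in> U" "\<xi> = crd e u" using \<xi> by blast
    have "invertible (dmap e c F u)"
      by (rule inv) (use u U'(2,3) e'(1) c'(1) in \<open>auto intro!: charts_atI\<close>)
    then show ?thesis by (simp add: dmap_def f_def u)
  qed
  note g = smooth_inverse[OF oU U'(4)[folded f_def] injf invf]
  define G where "G = inv_into (crd e ` U) f"
  obtain V where V: "p \<in> V" "smooth_rep a c X V"
    using smooth_at_rep[OF X a, of c] c eq by auto
  have V': "open V" "V \<subseteq> dom_of a" "X ` V \<subseteq> dom_of c" "smooth_on (crd a ` V) (crd c \<circ> X \<circ> crd_inv a)"
    using V(2) by (auto simp: smooth_rep_def)
  define P where "P = V \<inter> X -` (dom_of c \<inter> crd c -` (f ` crd e ` U))"
  have "open P" unfolding P_def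
    by (rule continuous_open_preimage[OF smooth_rep_continuous[OF a'(1) c'(1) V(2)] V'(1) open_crd_preimage[OF c'(1) g(1)]])
  have pP: "p \<in> P"
    using V(1) c'(2) U(1) fU[OF U(1)] by (auto simp: P_def eq image_iff intro!: bexI[of _ "Z p"])
  have ZU: "Z q \<in> U \<and> crd e (Z q) = G (crd c (X q))" if q: "q \<in> P" for q
  proof -
    obtain u where u: "u \<in> U" "crd c (X q) = crd c (F u)" using q fU by (auto simp: P_def)
    have "X q = F u" using u q U'(3) c'(1) by (metis IntD1 IntD2 P_def crd_inv_crd image_subset_iff vimageE)
    then have Zu: "Z q = u" using eq inj by (auto dest: injD)
    moreover have "G (f (crd e u)) = crd e u" unfolding G_def using injf u(1) by simp
    ultimately show ?thesis using u fU[OF u(1)] by simp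
  qed
  have PV: "P \<subseteq> V" by (auto simp: P_def)
  have Pa: "P \<subseteq> dom_of a" using PV V'(2) by blast
  have oP: "open (crd a ` P)" by (rule open_crd_image[OF a'(1) \<open>open P\<close> Pa])
  have XP: "(crd c \<circ> X \<circ> crd_inv a) \<xi> \<in> f ` crd e ` U" if \<xi>: "\<xi> \<in> crd a ` P" for \<xi>
  proof -
    obtain q where "q \<in> P" "\<xi> = crd a q" using \<xi> by blast
    then show ?thesis using Pa a'(1) by (auto simp: P_def subset_iff)
  qed
  have "smooth_on (crd a ` P) (G \<circ> (crd c \<circ> X \<circ> crd_inv a))"
    unfolding G_def
    by (rule smooth_on_compose[OF oP g smooth_on_subset[OF V'(4)] XP]) (use PV in auto)
  then have "smooth_on (crd a ` P) (crd e \<circ> Z \<circ> crd_inv a)"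
    by (rule smooth_on_cong[OF oP, THEN iffD1, rotated]) (use ZU Pa a'(1) in \<open>auto simp: subset_iff\<close>)
  moreover have "Z ` P \<subseteq> dom_of e" using ZU U'(2) by blast
  ultimately have "smooth_rep a e Z P" using \<open>open P\<close> Pa by (simp add: smooth_rep_def)
  then show ?thesis unfolding smooth_at_def using a e pP by blast
qed

end

context symplectic_manifold
begin

text \<open>\<open>J\<^sup>* \<omega> J = \<omega>\<close> exhibits \<open>\<Psi> J\<^sup>* \<omega>\<close> as a left inverse of the square matrix \<open>J\<close>, hence as a right
  inverse, and this is the identity for the Poisson tensor.\<close>

lemma preserves_omega_dmap:
  assumes "preserves_omega_at F x" "a \<in> charts_at A x" "c \<in> charts_at A (F x)"
  shows "invertible (dmap a c F x)"
    and "dmap a c F x ** poisson \<omega> a x ** transpose (dmap a c F x) = poisson \<omega> c (F x)"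
proof -
  define J where "J = dmap a c F x"
  have a: "a \<in> A" "x \<in> dom_of a" and c: "c \<in> A" "F x \<in> dom_of c" using assms(2,3) charts_atD by auto
  have "transpose J ** \<omega> c (F x) ** J = \<omega> a x" using assms unfolding preserves_omega_at_def J_def by blast
  then have "poisson \<omega> a x ** (transpose J ** \<omega> c (F x) ** J) = mat 1" by (simp add: omega_poisson[OF a])
  then have l: "(poisson \<omega> a x ** transpose J ** \<omega> c (F x)) ** J = mat 1" by (simp add: matrix_mul_assoc)
  then have r: "J ** (poisson \<omega> a x ** transpose J ** \<omega> c (F x)) = mat 1" by (simp add: matrix_left_right_inverse)
  show "invertible (dmap a c F x)" unfolding J_def[symmetric] invertible_def using l r by blast
  have "J ** poisson \<omega> a x ** transpose J = J ** poisson \<omega> a x ** transpose J ** (\<omega> c (F x) ** poisson \<omega> c (F x))"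
    by (simp add: omega_poisson[OF c])
  also have "\<dots> = (J ** (poisson \<omega> a x ** transpose J ** \<omega> c (F x))) ** poisson \<omega> c (F x)"
    by (simp only: matrix_mul_assoc)
  finally show "dmap a c F x ** poisson \<omega> a x ** transpose (dmap a c F x) = poisson \<omega> c (F x)"
    by (simp add: r J_def[symmetric])
qed

lemma ham_field_gradient: "ham_field \<omega> f p c = transpose (poisson \<omega> c p) *v (\<chi> j. pd c j f p)"
  by (simp add: ham_field_def vec_eq_iff matrix_vector_mult_def transpose_def mult.commute del: transpose_matrix_vector)

lemma ham_field_pushforward:
  assumes sm: "smooth_at F x" and F: "preserves_omega_at F x" and a: "a \<in> charts_at A x" and c: "c \<in> charts_at A (F x)"
    and f: "smooth_in c f"
  shows "dmap a c F x *v ham_field \<omega> (f \<circ> F) x a = ham_field \<omega> f (F x) c"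
proof -
  define J where "J = dmap a c F x"
  define P where "P = poisson \<omega> a x"
  have "(\<chi> j. pd a j (f \<circ> F) x) = transpose J *v (\<chi> m. pd c m f (F x))"
    using pd_compose[OF a c f smooth_at_continuous[OF sm] smooth_at_has_dmap[OF sm a c]]
    by (simp add: vec_eq_iff matrix_vector_mult_def transpose_def J_def mult.commute del: transpose_matrix_vector)
  then have "J *v ham_field \<omega> (f \<circ> F) x a = (J ** transpose P ** transpose J) *v (\<chi> m. pd c m f (F x))"
    by (simp add: ham_field_gradient P_def matrix_vector_mul_assoc matrix_mul_assoc del: transpose_matrix_vector)
  also have "J ** transpose P ** transpose J = transpose (J ** P ** transpose J)"
    by (simp add: matrix_transpose_mul matrix_mul_assoc)
  also have "J ** P ** transpose J = poisson \<omega> c (F x)"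
    using preserves_omega_dmap(2)[OF F a c] by (simp add: J_def P_def)
  finally show ?thesis by (simp add: ham_field_gradient J_def o_def del: transpose_matrix_vector)
qed

lemma dmap_compose:
  assumes "smooth_at F x" "smooth_at G (F x)" "a \<in> charts_at A x" "b \<in> charts_at A (F x)" "c \<in> charts_at A (G (F x))"
  shows "dmap a c (G \<circ> F) x = dmap b c G (F x) ** dmap a b F x"
  by (rule has_dmap_imp_dmap[OF has_dmap_compose[OF assms(3,4) smooth_at_continuous[OF assms(1)]
      smooth_at_has_dmap[OF assms(1,3,4)] smooth_at_has_dmap[OF assms(2,4,5)]]])

lemma preserves_omega_factor:
  assumes Z: "smooth_at Z p" and F: "smooth_at F (Z p)" "preserves_omega_at F (Z p)"
    and X: "preserves_omega_at X p" and eq: "X = F \<circ> Z"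
  shows "preserves_omega_at Z p"
proof -
  obtain a e where a: "a \<in> charts_at A p" and e: "e \<in> charts_at A (Z p)" using ex_chart by blast
  obtain c where c: "c \<in> charts_at A (F (Z p))" using ex_chart by blast
  have "\<omega> a p = transpose (dmap a c X p) ** \<omega> c (F (Z p)) ** dmap a c X p"
    using X a c unfolding preserves_omega_at_def eq by simp
  also have "dmap a c X p = dmap e c F (Z p) ** dmap a e Z p" unfolding eq by (rule dmap_compose[OF Z F(1) a e c])
  also have "transpose (dmap e c F (Z p) ** dmap a e Z p) ** \<omega> c (F (Z p)) ** (dmap e c F (Z p) ** dmap a e Z p) =
      transpose (dmap a e Z p) ** (transpose (dmap e c F (Z p)) ** \<omega> c (F (Z p)) ** dmap e c F (Z p)) ** dmap a e Z p"
    by (simp add: matrix_transpose_mul matrix_mul_assoc)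
  also have "transpose (dmap e c F (Z p)) ** \<omega> c (F (Z p)) ** dmap e c F (Z p) = \<omega> e (Z p)"
    using F(2) e c unfolding preserves_omega_at_def by blast
  finally show ?thesis by (intro preserves_omega_atI[OF Z a e]) simp
qed

lemma smooth_time_const: "smooth_function A f \<Longrightarrow> smooth_time T (\<lambda>t. f)"
  unfolding smooth_time_def smooth_function_def smooth_family_def smooth_on_def
  by (intro ballI allI Ck_on_imp_Ck_family) simp

lemma matrix_has_vector_derivativeI:
  fixes M :: "real \<Rightarrow> real^'m^'n"
  assumes "\<And>\<eta>. ((\<lambda>s. M s *v \<eta>) has_vector_derivative M' *v \<eta>) (at t within T)"
  shows "(M has_vector_derivative M') (at t within T)"
proof -
  have "((\<lambda>s. M s $ i $ j) has_vector_derivative M' $ i $ j) (at t within T)" for i j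
    using bounded_linear.has_vector_derivative[OF bounded_linear_vec_nth assms[of "axis j 1"], of i]
    by (simp add: matrix_vector_mult_basis column_def)
  then show ?thesis
    unfolding has_vector_derivative_def has_derivative_componentwise_within[of M]
    by (auto simp: Basis_vec_def inner_axis)
qed

end

context ether_trajectory
begin

section \<open>The factorization of the flow\<close>

text \<open>What remains of \<open>H\<close> once the motion along the symplectic path is split off.\<close>

definition residual_ham :: "real \<Rightarrow> 'a \<Rightarrow> real" where
  "residual_ham t w = H w - path_ham t w"

lemma moving_hamiltonian_eq:
  "moving_hamiltonian A \<H> T H \<sigma> F t = (\<lambda>z. (residual_ham t \<circ> F t) z - H (\<sigma> 0))"
  by (simp add: fun_eq_iff moving_hamiltonian_def residual_ham_def path_ham_def)

lemma smooth_path_ham: "t \<in> T \<Longrightarrow> c \<in> A \<Longrightarrow> smooth_in c (path_ham t)"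
  by (rule smooth_time_smooth_in[OF smooth_time_path_ham])

lemma smooth_residual_ham: "t \<in> T \<Longrightarrow> c \<in> A \<Longrightarrow> smooth_in c (residual_ham t)"
  unfolding residual_ham_def[abs_def] by (intro smooth_in_diff H_smooth_in smooth_path_ham)

lemma pd_residual_ham:
  assumes "t \<in> T" "c \<in> A" "p \<in> dom_of c"
  shows "pd c j (residual_ham t) p = pd c j H p - pd c j (path_ham t) p"
  unfolding residual_ham_def[abs_def]
  by (rule pd_diff[OF H_smooth_in[OF assms(2)] smooth_path_ham[OF assms(1,2)] assms(3)])

lemma ham_field_residual:
  assumes "t \<in> T" "c \<in> A" "p \<in> dom_of c"
  shows "ham_field \<omega> (residual_ham t) p c = ham_field \<omega> H p c - ham_field \<omega> (path_ham t) p c"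
  by (simp add: ham_field_def pd_residual_ham[OF assms] vec_eq_iff left_diff_distrib sum_subtractf)

lemma ham_field_moving:
  assumes t: "t \<in> T" and a: "a \<in> charts_at A x" and c: "c \<in> charts_at A (F t x)"
  shows "dmap a c (F t) x *v ham_field \<omega> (moving_hamiltonian A \<H> T H \<sigma> F t) x a = ham_field \<omega> (residual_ham t) (F t x) c"
proof -
  have "ham_field \<omega> (moving_hamiltonian A \<H> T H \<sigma> F t) x a = ham_field \<omega> (residual_ham t \<circ> F t) x a"
    unfolding moving_hamiltonian_eq ham_field_def pd_diff_const by (simp add: o_def)
  then show ?thesis
    using ham_field_pushforward[OF path_smooth_at[OF t] path_preserves_omega[OF t] a c
        smooth_residual_ham[OF t charts_atD(1)[OF c]]] by simp
qed

lemma smooth_field_H: "smooth_field T (\<lambda>t. ham_field \<omega> H)"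
  by (rule smooth_field_ham[OF smooth_time_const[OF smooth_H]])

text \<open>The composed curve has velocity \<open>ham (path_ham t) + ham (H - path_ham t) = ham H\<close>.\<close>

theorem flow_factorization:
  assumes X: "is_flow A T (\<lambda>t. ham_field \<omega> H) X"
    and Z: "is_flow A T (\<lambda>t. ham_field \<omega> (moving_hamiltonian A \<H> T H \<sigma> F t)) Z" and t: "t \<in> T"
  shows "X t x = F t (Z t x)"
proof -
  let ?M = "moving_hamiltonian A \<H> T H \<sigma> F"
  note v = smooth_field_ham[OF smooth_time_path_ham]
  have Xs: "solves A T (\<lambda>t. ham_field \<omega> H) (\<lambda>t. X t x)" and X0: "X 0 x = x" using X by (auto simp: is_flow_def)
  have Zs: "solves A T (\<lambda>t. ham_field \<omega> (?M t)) (\<lambda>t. Z t x)" and Z0: "Z 0 x = x" using Z by (auto simp: is_flow_def)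
  have "solves A T (\<lambda>t. ham_field \<omega> H) (\<lambda>t. F t (Z t x))"
    unfolding solves_def
  proof (intro conjI ballI)
    have Zd: "((\<lambda>s. crd b (Z s x)) has_vector_derivative ham_field \<omega> (?M t) (Z t x) b) (at t within T)"
      if "t \<in> T" "b \<in> charts_at A (Z t x)" for t b
      using Zs that unfolding solves_def by blast
    note along = flow_along_curve[where F = F and z = "\<lambda>s. Z s x", OF interval v path_solves _ path_smooth_at _ _ solves_continuous[OF Zs] Zd]
    show "continuous_on T (\<lambda>t. F t (Z t x))"
      unfolding continuous_on_eq_continuous_within
    proof
      fix t assume t: "t \<in> T"
      obtain b c where b: "b \<in> charts_at A (Z t x)" and c: "c \<in> charts_at A (F t (Z t x))" using ex_chart by blast
      show "continuous (at t within T) (\<lambda>t. F t (Z t x))" by (rule along(2)[OF t t b c t b])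
    qed
    fix t c assume t: "t \<in> T" and c: "c \<in> charts_at A (F t (Z t x))"
    have c': "c \<in> A" "F t (Z t x) \<in> dom_of c" using c charts_atD by auto
    obtain b where b: "b \<in> charts_at A (Z t x)" using ex_chart by blast
    show "((\<lambda>s. crd c (F s (Z s x))) has_vector_derivative ham_field \<omega> H (F t (Z t x)) c) (at t within T)"
      using along(1)[OF t t b c t b] c'
      by (simp add: fld_def ham_field_moving[OF t b c] ham_field_residual[OF t c'])
  qed
  from solutions_unique[OF interval smooth_field_H Xs this T0 _ t] show ?thesis by (simp add: X0 Z0 path_0)
qed

section \<open>The moving Hamiltonian at the starting point\<close>

lemma \<sigma>_charts_path: "t \<in> T \<Longrightarrow> d \<in> charts_at A (\<sigma> t) \<Longrightarrow> d \<in> charts_at A (F t (\<sigma> 0))"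
  by (simp add: path_transports)

lemma residual_stationary:
  assumes t: "t \<in> T" and d: "d \<in> charts_at A (\<sigma> t)"
  shows "pd d j (residual_ham t) (\<sigma> t) = 0" "pd d j (pd d k (residual_ham t)) (\<sigma> t) = cov_hess \<Gamma> d H (\<sigma> t) $ j $ k"
proof -
  have d': "d \<in> A" "\<sigma> t \<in> dom_of d" using d charts_atD by auto
  show "pd d j (residual_ham t) (\<sigma> t) = 0"
    by (simp add: pd_residual_ham[OF t d'] path_ham_on_trajectory(2)[OF t d])
  have "pd d j (pd d k (residual_ham t)) (\<sigma> t) = pd d j (\<lambda>q. pd d k H q - pd d k (path_ham t) q) (\<sigma> t)"
    by (rule pd_cong[OF d'(1) open_dom[OF d'(1)] d'(2,2)]) (rule pd_residual_ham[OF t d'(1)])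
  also have "\<dots> = pd d j (pd d k H) (\<sigma> t) - pd d j (pd d k (path_ham t)) (\<sigma> t)"
    by (rule pd_diff[OF smooth_in_pd[OF d'(1) H_smooth_in[OF d'(1)]] smooth_in_pd[OF d'(1) smooth_path_ham[OF t d'(1)]] d'(2)])
  also have "pd d j (pd d k (path_ham t)) (\<sigma> t) = (\<Sum>m\<in>UNIV. pd d m H (\<sigma> t) * \<Gamma> d (\<sigma> t) m j k)"
  proof -
    have "cov_hess \<Gamma> d (path_ham t) (\<sigma> t) $ j $ k = 0" by (simp add: path_ham_on_trajectory(3)[OF t d])
    then show ?thesis by (simp add: cov_hess_def path_ham_on_trajectory(2)[OF t d])
  qed
  finally show "pd d j (pd d k (residual_ham t)) (\<sigma> t) = cov_hess \<Gamma> d H (\<sigma> t) $ j $ k"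
    by (simp add: cov_hess_def)
qed

lemma moving_stationary:
  assumes t: "t \<in> T"
  shows "moving_hamiltonian A \<H> T H \<sigma> F t (\<sigma> 0) = 0"
    and "c \<in> charts_at A (\<sigma> 0) \<Longrightarrow> pd c j (moving_hamiltonian A \<H> T H \<sigma> F t) (\<sigma> 0) = 0"
proof -
  obtain d where d: "d \<in> charts_at A (\<sigma> t)" using ex_chart by blast
  show "moving_hamiltonian A \<H> T H \<sigma> F t (\<sigma> 0) = 0"
    by (simp add: moving_hamiltonian_eq residual_ham_def path_transports[OF t] path_ham_on_trajectory(1)[OF t d] energy_conserved[OF t])
  assume c: "c \<in> charts_at A (\<sigma> 0)"
  note d1 = \<sigma>_charts_path[OF t d]
  show "pd c j (moving_hamiltonian A \<H> T H \<sigma> F t) (\<sigma> 0) = 0"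
    unfolding moving_hamiltonian_eq pd_diff_const
    using pd_compose[OF c d1 smooth_residual_ham[OF t charts_atD(1)[OF d]] smooth_at_continuous[OF path_smooth_at[OF t]]
        smooth_at_has_dmap[OF path_smooth_at[OF t] c d1], of j]
    by (simp add: path_transports[OF t] residual_stationary(1)[OF t d] o_def)
qed

text \<open>At a stationary point the matrix of second derivatives transforms as a tensor under the
  change of variables \<open>F t\<close>.\<close>

lemma moving_hessian:
  assumes t: "t \<in> T" and c: "c \<in> charts_at A (\<sigma> 0)" and d: "d \<in> charts_at A (\<sigma> t)"
  shows "cov_hess \<Gamma> c (moving_hamiltonian A \<H> T H \<sigma> F t) (\<sigma> 0) =
    transpose (dmap c d (F t) (\<sigma> 0)) ** cov_hess \<Gamma> d H (\<sigma> t) ** dmap c d (F t) (\<sigma> 0)"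
proof -
  let ?M = "moving_hamiltonian A \<H> T H \<sigma> F t" and ?y = "\<sigma> 0" and ?K = "residual_ham t"
  define J where "J = dmap c d (F t)"
  note d1 = \<sigma>_charts_path[OF t d]
  have c': "c \<in> A" "?y \<in> dom_of c" and d': "d \<in> A" "\<sigma> t \<in> dom_of d" using c d charts_atD by auto
  obtain U where U: "?y \<in> U" "smooth_rep c d (F t) U" using smooth_at_rep[OF path_smooth_at[OF t] c d1] by blast
  have U': "open U" "U \<subseteq> dom_of c" "F t ` U \<subseteq> dom_of d" "smooth_on (crd c ` U) (crd d \<circ> F t \<circ> crd_inv c)"
    using U(2) by (auto simp: smooth_rep_def)
  have oU: "open (crd c ` U)" by (rule open_crd_image[OF c'(1) U'(1,2)])
  have first: "pd c k ?M q = (\<Sum>m\<in>UNIV. (pd d m ?K \<circ> F t) q * J q $ m $ k)" if "q \<in> U" for q k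
  proof -
    have cq: "c \<in> charts_at A q" and dq: "d \<in> charts_at A (F t q)" using that U' c'(1) d'(1) by (auto intro: charts_atI)
    show ?thesis unfolding moving_hamiltonian_eq pd_diff_const J_def
      using pd_compose[OF cq dq smooth_residual_ham[OF t d'(1)] smooth_at_continuous[OF path_smooth_at[OF t]]
          smooth_at_has_dmap[OF path_smooth_at[OF t] cq dq], of k] by (simp add: o_def)
  qed
  have dJ: "((\<lambda>q. J q $ m $ k) \<circ> crd_inv c) differentiable (at (crd c ?y))" for m k
  proof -
    have "smooth_on (crd c ` U) (\<lambda>\<xi>. frechet_derivative (crd d \<circ> F t \<circ> crd_inv c) (at \<xi>) (axis k 1))"
      by (rule smooth_on_frechet_derivative[OF U'(4)])
    then have "(\<lambda>\<xi>. frechet_derivative (crd d \<circ> F t \<circ> crd_inv c) (at \<xi>) (axis k 1)) differentiable (at (crd c ?y))"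
      using smooth_on_has_derivative U(1) unfolding frechet_derivative_works by blast
    then have "(\<lambda>\<xi>. frechet_derivative (crd d \<circ> F t \<circ> crd_inv c) (at \<xi>) (axis k 1) $ m) differentiable (at (crd c ?y))"
      unfolding differentiable_def using bounded_linear.has_derivative[OF bounded_linear_vec_nth] by blast
    then show ?thesis
      by (rule differentiable_cong_open[OF oU, THEN iffD1, rotated -1])
        (use U(1) U'(2) c'(1) in \<open>auto simp: J_def dmap_def matrix_def subset_iff\<close>)
  qed
  have grad: "((pd d m ?K \<circ> F t) \<circ> crd_inv c has_derivative
      (\<lambda>h. \<Sum>l\<in>UNIV. h $ l * pd d l (pd d m ?K) (F t ?y)) \<circ> (*v) (J ?y)) (at (crd c ?y))" for m
    unfolding J_def
    by (rule gradient_compose[OF c d1 smooth_in_pd[OF d'(1) smooth_residual_ham[OF t d'(1)]]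
        smooth_at_continuous[OF path_smooth_at[OF t]] smooth_at_has_dmap[OF path_smooth_at[OF t] c d1]])
  then have dK: "((pd d m ?K \<circ> F t) \<circ> crd_inv c) differentiable (at (crd c ?y))" for m
    unfolding differentiable_def by blast
  have dKJ: "((\<lambda>q. (pd d m ?K \<circ> F t) q * J q $ m $ k) \<circ> crd_inv c) differentiable (at (crd c ?y))" for m k
    using differentiable_mult[OF dK[of m] dJ[of m k]] by (simp add: o_def)
  have "cov_hess \<Gamma> c ?M ?y $ j $ k = (transpose (J ?y) ** cov_hess \<Gamma> d H (\<sigma> t) ** J ?y) $ j $ k" for j k
  proof -
    have "cov_hess \<Gamma> c ?M ?y $ j $ k = pd c j (pd c k ?M) ?y"
      by (simp add: cov_hess_def moving_stationary(2)[OF t c])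
    also have "\<dots> = pd c j (\<lambda>q. \<Sum>m\<in>UNIV. (pd d m ?K \<circ> F t) q * J q $ m $ k) ?y"
      by (rule pd_cong[OF c'(1) U'(1) U(1) c'(2)]) (rule first)
    also have "\<dots> = (\<Sum>m\<in>UNIV. pd c j (pd d m ?K \<circ> F t) ?y * J ?y $ m $ k)"
      unfolding pd_sum_at[OF dKJ] pd_mult_at[OF dK dJ c'(2,1)]
      by (simp add: path_transports[OF t] residual_stationary(1)[OF t d])
    also have "\<dots> = (\<Sum>m\<in>UNIV. (\<Sum>l\<in>UNIV. J ?y $ l $ j * cov_hess \<Gamma> d H (\<sigma> t) $ l $ m) * J ?y $ m $ k)"
      using pd_eqI[OF grad]
      by (simp add: path_transports[OF t] residual_stationary(2)[OF t d] matrix_vector_mult_basis column_def)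
    also have "\<dots> = (transpose (J ?y) ** cov_hess \<Gamma> d H (\<sigma> t) ** J ?y) $ j $ k"
      by (simp add: matrix_matrix_mult_def transpose_def)
    finally show ?thesis .
  qed
  then show ?thesis by (simp add: vec_eq_iff J_def)
qed

section \<open>Parallel translation and the differential of the flow\<close>

lemma tangent_change_chart:
  "v \<in> tangent_space A p \<Longrightarrow> c \<in> charts_at A p \<Longrightarrow> d \<in> charts_at A p \<Longrightarrow> v d = jac c d p *v v c"
  unfolding tangent_space_def by blast

lemma path_linearization:
  assumes t: "t \<in> T" and d: "d \<in> charts_at A (\<sigma> t)"
  shows "fmat (\<lambda>t. ham_field \<omega> (path_ham t)) d t (\<sigma> t) = - gamma_mat d (\<sigma> t) (ham_field \<omega> H (\<sigma> t) d)"
proof -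
  have d': "d \<in> A" "\<sigma> t \<in> dom_of d" using d charts_atD by auto
  have "poisson \<omega> d (\<sigma> t) ** (0 :: real^'d^'d) = 0" by (simp add: matrix_matrix_mult_def vec_eq_iff)
  then show ?thesis
    using ham_field_derivative[where f = path_ham, OF d' smooth_path_ham[OF t d'(1)]]
    by (simp add: path_ham_on_trajectory(3)[OF t d] ham_field_on_trajectory[OF t d])
qed

text \<open>Linearized along the trajectory, the path equation is the equation of parallel translation:
  the second covariant derivatives of the path Hamiltonian vanish there, so only the Christoffel
  symbols remain.\<close>

theorem parallel_translation_eq_dmap:
  assumes V: "parallel_translation A \<Gamma> T \<sigma> V" and v: "v \<in> tangent_space A (\<sigma> 0)"
    and t: "t \<in> T" and c: "c \<in> charts_at A (\<sigma> 0)" and d: "d \<in> charts_at A (\<sigma> t)"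
  shows "V t v d = dmap c d (F t) (\<sigma> 0) *v v c"
proof -
  have V0: "V 0 v = v" and par: "parallel_along A \<Gamma> T \<sigma> (\<lambda>t. V t v)"
    using V v unfolding parallel_translation_def by blast+
  have Vtan: "V t v \<in> tangent_space A (\<sigma> t)" if "t \<in> T" for t using par that unfolding parallel_along_def by blast
  have "V t v d - dmap c d (F t) (\<sigma> 0) *v v c = 0"
  proof (rule linearized_solutions_unique[where u = "\<lambda>t d. V t v d - dmap c d (F t) (\<sigma> 0) *v v c" and c = d,
        OF interval smooth_field_ham[OF smooth_time_path_ham] \<sigma>_continuous _ _ T0 c _ t d])
    show "V t v e - dmap c e (F t) (\<sigma> 0) *v v c = jac d e (\<sigma> t) *v (V t v d - dmap c d (F t) (\<sigma> 0) *v v c)"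
      if "t \<in> T" "d \<in> charts_at A (\<sigma> t)" "e \<in> charts_at A (\<sigma> t)" for t d e
      using tangent_change_chart[OF Vtan[OF that(1)] that(2,3)]
        dmap_change_target[OF path_smooth_at[OF that(1)] c \<sigma>_charts_path[OF that(1,2)] \<sigma>_charts_path[OF that(1,3)]]
      by (simp add: matrix_vector_mult_diff_distrib matrix_vector_mul_assoc path_transports[OF that(1)])
    show "((\<lambda>s. V s v d - dmap c d (F s) (\<sigma> 0) *v v c) has_vector_derivative
        fmat (\<lambda>t. ham_field \<omega> (path_ham t)) d t (\<sigma> t) *v (V t v d - dmap c d (F t) (\<sigma> 0) *v v c)) (at t within T)"
      if t: "t \<in> T" and d: "d \<in> charts_at A (\<sigma> t)" for t d
    proof -
      have d': "d \<in> A" "\<sigma> t \<in> dom_of d" using d charts_atD by auto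
      have "((\<lambda>s. V s v d) has_vector_derivative
            (\<chi> m. - (\<Sum>j\<in>UNIV. \<Sum>k\<in>UNIV. \<Gamma> d (\<sigma> t) m j k * velocity T \<sigma> t d $ j * V t v d $ k))) (at t within T)"
        using par t d unfolding parallel_along_def by blast
      moreover have "(\<chi> m. - (\<Sum>j\<in>UNIV. \<Sum>k\<in>UNIV. \<Gamma> d (\<sigma> t) m j k * velocity T \<sigma> t d $ j * V t v d $ k)) =
          fmat (\<lambda>t. ham_field \<omega> (path_ham t)) d t (\<sigma> t) *v V t v d"
      proof -
        have "(\<Sum>j\<in>UNIV. \<Sum>k\<in>UNIV. \<Gamma> d (\<sigma> t) m j k * velocity T \<sigma> t d $ j * V t v d $ k) =
            (gamma_mat d (\<sigma> t) (ham_field \<omega> H (\<sigma> t) d) *v V t v d) $ m" for m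
        proof -
          have "(\<Sum>j\<in>UNIV. \<Sum>k\<in>UNIV. \<Gamma> d (\<sigma> t) m j k * velocity T \<sigma> t d $ j * V t v d $ k) =
            (\<Sum>k\<in>UNIV. \<Sum>j\<in>UNIV. \<Gamma> d (\<sigma> t) m k j * velocity T \<sigma> t d $ j * V t v d $ k)"
            by (subst sum.swap) (intro sum.cong refl, subst Gamma_symmetric[OF d'], rule refl)
          then show ?thesis
            by (simp add: gamma_mat_def matrix_vector_mult_def sum_distrib_right velocity_\<sigma>[OF t d])
        qed
        then show ?thesis unfolding path_linearization[OF t d]
          by (simp add: vec_eq_iff matrix_vector_mult_def sum_negf)
      qed
      moreover have "((\<lambda>s. dmap c d (F s) (\<sigma> 0) *v v c) has_vector_derivative
          fmat (\<lambda>t. ham_field \<omega> (path_ham t)) d t (\<sigma> t) *v (dmap c d (F t) (\<sigma> 0) *v v c)) (at t within T)"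
        using dmap_ode[where F = F, OF interval smooth_field_ham[OF smooth_time_path_ham] path_solves t path_smooth_at[OF t] c \<sigma>_charts_path[OF t d]]
        by (simp add: path_transports[OF t])
      ultimately show ?thesis
        by (simp add: matrix_vector_mult_diff_distrib has_vector_derivative_diff)
    qed
    show "V 0 v c - dmap c c (F 0) (\<sigma> 0) *v v c = 0"
      using identity_at(3)[of "F 0", OF path_0 c c] by (simp add: V0 jac_self[OF c])
  qed
  then show ?thesis by simp
qed

lemma matrix_in_parallel_translation:
  assumes "parallel_translation A \<Gamma> T \<sigma> V" "t \<in> T" "c \<in> charts_at A (\<sigma> 0)" "d \<in> charts_at A (\<sigma> t)"
  shows "matrix_in A (\<sigma> 0) c d (V t) = dmap c d (F t) (\<sigma> 0)"
proof -
  have "(\<lambda>\<xi>. V t (tangent_of A (\<sigma> 0) c \<xi>) d) = (*v) (dmap c d (F t) (\<sigma> 0))"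
    using parallel_translation_eq_dmap[OF assms(1) tangent_ofI(1)[OF assms(3)] assms(2,3,4)] tangent_ofI(2)[OF assms(3)]
    by (simp add: fun_eq_iff)
  then show ?thesis by (simp add: matrix_in_def)
qed

text \<open>Both sides solve the equation of the flow \<open>X\<close> linearized along the trajectory; on the left hand
  side the Christoffel part comes from \<open>V\<close> and the Hessian part from \<open>W\<close>.\<close>

theorem translation_composed_with_linear_solution:
  assumes X: "is_flow A T (\<lambda>t. ham_field \<omega> H) X" and V: "parallel_translation A \<Gamma> T \<sigma> V"
    and W: "linear_system_solution A \<omega> \<Gamma> T H \<sigma> V W" and v: "v \<in> tangent_space A (\<sigma> 0)"
    and X\<sigma>: "\<And>t. X t (\<sigma> 0) = \<sigma> t"
    and t: "t \<in> T" and c: "c \<in> charts_at A (\<sigma> 0)" and d: "d \<in> charts_at A (\<sigma> t)"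
  shows "V t (W t v) d = dmap c d (X t) (\<sigma> 0) *v v c"
proof -
  let ?y = "\<sigma> 0" and ?v = "\<lambda>t. ham_field \<omega> H"
  have Xs: "solves A T ?v (\<lambda>t. X t x)" and X0: "X 0 x = x" for x using X by (auto simp: is_flow_def)
  have Xsm: "smooth_at (X t) x" if "t \<in> T" for t x
    by (rule ham_flow_symplectic(1)[OF interval T0 smooth_time_const[OF smooth_H] X that])
  have W0: "W 0 v = v" and Wtan: "\<And>t. t \<in> T \<Longrightarrow> W t v \<in> tangent_space A ?y"
    using W v unfolding linear_system_solution_def by blast+
  define J where "J = (\<lambda>d t. dmap c d (F t) ?y)"
  have Wode: "((\<lambda>s. W s v c) has_vector_derivative
      - (poisson \<omega> c ?y ** (transpose (J d t) ** cov_hess \<Gamma> d H (\<sigma> t) ** J d t)) *v W t v c) (at t within T)"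
    if "t \<in> T" "d \<in> charts_at A (\<sigma> t)" for t d
  proof -
    have "let M = - (poisson \<omega> c ?y ** hess_pullback A \<Gamma> H (V t) ?y (\<sigma> t) c d)
           in ((\<lambda>s. W s v c) has_vector_derivative (M *v W t v c)) (at t within T)"
      using W v that c unfolding linear_system_solution_def by blast
    then show ?thesis
      by (simp add: Let_def hess_pullback_def matrix_in_parallel_translation[OF V that(1) c that(2)] J_def)
  qed
  have VW: "V t (W t v) d = J d t *v W t v c" if "t \<in> T" "d \<in> charts_at A (\<sigma> t)" for t d
    unfolding J_def by (rule parallel_translation_eq_dmap[OF V Wtan[OF that(1)] that(1) c that(2)])
  have Vtan: "V t (W t v) \<in> tangent_space A (\<sigma> t)" if "t \<in> T" for t
    using V Wtan[OF that] that unfolding parallel_translation_def parallel_along_def by blast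
  have Xcharts: "d \<in> charts_at A (X t ?y)" if "d \<in> charts_at A (\<sigma> t)" for t d using that by (simp add: X\<sigma>)
  have "V t (W t v) d - dmap c d (X t) ?y *v v c = 0"
  proof (rule linearized_solutions_unique[where u = "\<lambda>t d. V t (W t v) d - dmap c d (X t) ?y *v v c" and c = d,
        OF interval smooth_field_H \<sigma>_continuous _ _ T0 c _ t d])
    show "V t (W t v) e - dmap c e (X t) ?y *v v c = jac d e (\<sigma> t) *v (V t (W t v) d - dmap c d (X t) ?y *v v c)"
      if "t \<in> T" "d \<in> charts_at A (\<sigma> t)" "e \<in> charts_at A (\<sigma> t)" for t d e
      using tangent_change_chart[OF Vtan[OF that(1)] that(2,3)]
        dmap_change_target[OF Xsm[OF that(1)] c Xcharts[OF that(2)] Xcharts[OF that(3)]]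
      by (simp add: matrix_vector_mult_diff_distrib matrix_vector_mul_assoc X\<sigma>)
    show "((\<lambda>s. V s (W s v) d - dmap c d (X s) ?y *v v c) has_vector_derivative
        fmat ?v d t (\<sigma> t) *v (V t (W t v) d - dmap c d (X t) ?y *v v c)) (at t within T)"
      if t: "t \<in> T" and d: "d \<in> charts_at A (\<sigma> t)" for t d
    proof -
      have d': "d \<in> A" "\<sigma> t \<in> dom_of d" using d charts_atD by auto
      define C where "C = cov_hess \<Gamma> d H (\<sigma> t)"
      define G where "G = gamma_mat d (\<sigma> t) (ham_field \<omega> H (\<sigma> t) d)"
      define P where "P = poisson \<omega> d (\<sigma> t)"
      define w where "w = W t v c"
      have "((\<lambda>s. J d s *v \<eta>) has_vector_derivative (- G ** J d t) *v \<eta>) (at t within T)" for \<eta>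
        using dmap_ode[where F = F, OF interval smooth_field_ham[OF smooth_time_path_ham] path_solves t path_smooth_at[OF t] c \<sigma>_charts_path[OF t d], of \<eta>]
        by (simp add: path_transports[OF t] path_linearization[OF t d] J_def G_def matrix_vector_mul_assoc)
      then have "(J d has_vector_derivative - G ** J d t) (at t within T)" by (rule matrix_has_vector_derivativeI)
      from bounded_bilinear.has_vector_derivative[OF bounded_bilinear_matrix_vector_mult this Wode[OF t d]]
      have D: "((\<lambda>s. J d s *v W s v c) has_vector_derivative
          J d t *v (- (poisson \<omega> c ?y ** (transpose (J d t) ** C ** J d t)) *v w) + (- G ** J d t) *v w) (at t within T)"
        by (simp add: C_def w_def)
      have JPJ: "J d t ** poisson \<omega> c ?y ** transpose (J d t) = P"
        using preserves_omega_dmap(2)[OF path_preserves_omega[OF t] c \<sigma>_charts_path[OF t d]]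
        by (simp add: J_def P_def path_transports[OF t])
      have neg: "- M *v x = - (M *v x)" for M :: "real^'d^'d" and x
        by (simp add: matrix_vector_mult_def vec_eq_iff sum_negf)
      have negr: "M *v - x = - (M *v x)" for M :: "real^'d^'d" and x
        by (simp add: matrix_vector_mult_def vec_eq_iff sum_negf)
      have "J d t *v (- (poisson \<omega> c ?y ** (transpose (J d t) ** C ** J d t)) *v w) =
          - ((J d t ** poisson \<omega> c ?y ** transpose (J d t)) *v (C *v (J d t *v w)))"
        by (simp add: neg negr matrix_vector_mul_assoc matrix_mul_assoc)
      also have "\<dots> = - (P ** C) *v (J d t *v w)" by (simp add: JPJ neg matrix_vector_mul_assoc[symmetric])
      finally have "J d t *v (- (poisson \<omega> c ?y ** (transpose (J d t) ** C ** J d t)) *v w) + (- G ** J d t) *v w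
          = (- (P ** C) - G) *v (J d t *v w)"
        by (simp add: matrix_vector_mul_assoc[symmetric] neg matrix_vector_mult_diff_rdistrib)
      moreover have "fmat ?v d t (\<sigma> t) = - (P ** C) - G"
        using ham_field_derivative[where f = "\<lambda>t. H", OF d' H_smooth_in[OF d'(1)], of t] by (simp add: P_def C_def G_def)
      ultimately have D1: "((\<lambda>s. J d s *v W s v c) has_vector_derivative fmat ?v d t (\<sigma> t) *v V t (W t v) d) (at t within T)"
        using D by (simp add: VW[OF t d] w_def)
      obtain I where I: "open I" "t \<in> I" "\<And>s. s \<in> T \<inter> I \<Longrightarrow> \<sigma> s \<in> dom_of d"
        using continuous_on_near[OF \<sigma>_continuous t open_dom[OF d'(1)] d'(2)] by metis
      obtain e where e: "e > 0" "ball t e \<subseteq> I" using I open_contains_ball by blast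
      have D2: "((\<lambda>s. V s (W s v) d) has_vector_derivative fmat ?v d t (\<sigma> t) *v V t (W t v) d) (at t within T)"
        by (rule has_vector_derivative_transform_within[OF D1 e(1) t])
          (use I(3) e(2) d'(1) in \<open>auto simp: VW charts_atI dist_commute subset_iff\<close>)
      have "((\<lambda>s. dmap c d (X s) ?y *v v c) has_vector_derivative
          fmat ?v d t (\<sigma> t) *v (dmap c d (X t) ?y *v v c)) (at t within T)"
        using dmap_ode[where F = X, OF interval smooth_field_H Xs t Xsm[OF t] c Xcharts[OF d]] by (simp add: X\<sigma>)
      with D2 show ?thesis by (simp add: matrix_vector_mult_diff_distrib has_vector_derivative_diff)
    qed
    have "V 0 (W 0 v) = v" using V v unfolding parallel_translation_def by (simp add: W0)
    then show "V 0 (W 0 v) c - dmap c c (X 0) ?y *v v c = 0"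
      using identity_at(3)[of "X 0", OF X0 c c] by (simp add: jac_self[OF c])
  qed
  then show ?thesis by simp
qed

text \<open>\<open>Z\<^sup>t\<close> is the symplectic map \<open>X\<^sup>t\<close> followed by the inverse of the symplectic map \<open>F\<^sup>t\<close>.\<close>

lemma residual_flow_symplectic:
  assumes X: "is_flow A T (\<lambda>t. ham_field \<omega> H) X"
    and Z: "is_flow A T (\<lambda>t. ham_field \<omega> (moving_hamiltonian A \<H> T H \<sigma> F t)) Z" and t: "t \<in> T"
  shows "symplectic_map A \<omega> (Z t)"
proof (rule symplectic_mapI)
  fix x
  note XS = ham_flow_symplectic[OF interval T0 smooth_time_const[OF smooth_H] X t]
  have eq: "X t x = F t (Z t x)" for x by (rule flow_factorization[OF X Z t])
  show sm: "smooth_at (Z t) x"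
    by (rule smooth_at_factor[OF path_smooth_at[OF t] _ XS(1) eq preserves_omega_dmap(1)[OF path_preserves_omega[OF t]]])
      (auto intro: injI path_injective[OF t])
  show "preserves_omega_at (Z t) x"
    by (rule preserves_omega_factor[OF sm path_smooth_at[OF t] path_preserves_omega[OF t] XS(2)])
      (use eq in auto)
qed

end

theorem theorem6p1:
  fixes A :: "('a::{t2_space, second_countable_topology}, 'd::finite) chart set"
    and n :: nat
    and \<omega> :: "('a, 'd) two_form"
    and \<Gamma> :: "('a, 'd) christoffel"
    and \<H> :: "('a, 'd) fun_one_form"
    and H :: "'a \<Rightarrow> real"
    and T :: "real set"
    and X F Z :: "real \<Rightarrow> 'a \<Rightarrow> 'a"
    and V W :: "real \<Rightarrow> ('a, 'd) tangent \<Rightarrow> ('a, 'd) tangent"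
    and y :: 'a
    and \<sigma> :: "real \<Rightarrow> 'a"
    and Hy :: "real \<Rightarrow> 'a \<Rightarrow> real"
  assumes "smooth_manifold A" and "CARD('d) = 2 * n"
    and "symplectic_form A \<omega>"
    and "connection A \<Gamma>" and "torsion_free A \<Gamma>" and "preserves_form A \<omega> \<Gamma>"
    and "ether_hamiltonian A \<omega> \<Gamma> \<H>"
    and "smooth_function A H"
    and "is_interval T" and "0 \<in> T" and "T \<noteq> {0}"
    and "is_flow A T (\<lambda>t. ham_field \<omega> H) X"
    and "\<sigma> = (\<lambda>\<tau>. X \<tau> y)"
    and "symplectic_path A \<omega> \<H> T \<sigma> F"
    and "Hy = moving_hamiltonian A \<H> T H \<sigma> F"
    and "is_flow A T (\<lambda>t. ham_field \<omega> (Hy t)) Z"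
    and "parallel_translation A \<Gamma> T \<sigma> V"
    and "linear_system_solution A \<omega> \<Gamma> T H \<sigma> V W"
  shows "\<forall>t\<in>T.
      X t = F t \<circ> Z t \<and>
      (Hy t y = 0 \<and>
       (\<forall>c\<in>charts_at A y. \<forall>j. pd c j (Hy t) y = 0) \<and>
       (\<forall>c\<in>charts_at A y. \<forall>d\<in>charts_at A (X t y).
          cov_hess \<Gamma> c (Hy t) y = hess_pullback A \<Gamma> H (V t) y (X t y) c d)) \<and>
      (symplectic_map A \<omega> (Z t) \<and> Z t y = y \<and>
       symplectic_map A \<omega> (F t) \<and> F t y = X t y \<and>
       has_differential A (X t) (V t \<circ> W t) y)"
proof -
  note Hy = assms(15) and X = assms(12) and V = assms(17) and W = assms(18)
  have X0: "X 0 x = x" and Xs: "solves A T (\<lambda>t. ham_field \<omega> H) (\<lambda>t. X t x)" for x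
    using X by (auto simp: is_flow_def)
  interpret ether_trajectory A \<omega> \<Gamma> \<H> H T \<sigma> F
    using assms Xs by unfold_locales (auto simp: ether_hamiltonian_def)
  have \<sigma>0: "\<sigma> 0 = y" and X\<sigma>: "X t y = \<sigma> t" for t by (simp_all add: assms(13) X0)
  note Z = assms(16)[unfolded Hy]
  show ?thesis
  proof (intro ballI conjI allI)
    fix t assume t: "t \<in> T"
    have fac: "X t x = F t (Z t x)" for x by (rule flow_factorization[OF X Z t])
    show "X t = F t \<circ> Z t" by (rule ext) (simp add: fac)
    show "Hy t y = 0" using moving_stationary(1)[OF t] by (simp add: Hy \<sigma>0)
    show "pd c j (Hy t) y = 0" if "c \<in> charts_at A y" for c j
      using moving_stationary(2)[OF t, of c j] that by (simp add: Hy \<sigma>0)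
    show "cov_hess \<Gamma> c (Hy t) y = hess_pullback A \<Gamma> H (V t) y (X t y) c d"
      if "c \<in> charts_at A y" "d \<in> charts_at A (X t y)" for c d
      using moving_hessian[OF t, of c d] matrix_in_parallel_translation[OF V t, of c d] that
      by (simp add: Hy hess_pullback_def \<sigma>0 X\<sigma>)
    show "symplectic_map A \<omega> (Z t)" by (rule residual_flow_symplectic[OF X Z t])
    show Fy: "F t y = X t y" using path_transports[OF t] by (simp add: \<sigma>0 X\<sigma>)
    show "Z t y = y" by (rule path_injective[OF t]) (simp add: fac[symmetric] Fy)
    show "symplectic_map A \<omega> (F t)" by (rule symplectic_mapI[OF path_smooth_at[OF t] path_preserves_omega[OF t]])
    have sm: "smooth_at (X t) y" by (rule ham_flow_symplectic(1)[OF assms(9,10) smooth_time_const[OF smooth_H] X t])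
    show "has_differential A (X t) (V t \<circ> W t) y"
      unfolding has_differential_def
    proof (intro conjI ballI)
      show "isCont (X t) y" by (rule smooth_at_continuous[OF sm])
      show "(V t \<circ> W t) ` tangent_space A y \<subseteq> tangent_space A (X t y)"
        using V W t unfolding parallel_translation_def parallel_along_def linear_system_solution_def \<sigma>0 X\<sigma> by auto
      fix c d assume c: "c \<in> charts_at A y" and d: "d \<in> charts_at A (X t y)"
      have "(\<lambda>\<xi>. (V t \<circ> W t) (tangent_of A y c \<xi>) d) = (*v) (dmap c d (X t) y)"
      proof
        fix \<xi>
        show "(V t \<circ> W t) (tangent_of A y c \<xi>) d = dmap c d (X t) y *v \<xi>"
          using translation_composed_with_linear_solution[OF X V W, of "tangent_of A y c \<xi>" t c d] c d t tangent_ofI[OF c]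
          by (simp add: \<sigma>0 X\<sigma>)
      qed
      then show "((crd d \<circ> X t \<circ> crd_inv c) has_derivative (\<lambda>\<xi>. (V t \<circ> W t) (tangent_of A y c \<xi>) d)) (at (crd c y))"
        using smooth_at_has_dmap[OF sm c d] by (simp add: has_dmap_def)
    qed
  qed
qed

end
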